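(* Let $D\subset\mathbb{R}^d$ be a bounded domain such that the classical Dirichlet problem on $D$ has a solution for every continuous boundary data. Let $f:\partial D\to[0,\infty]$ be a non-negative Borel measurable function and assume that $H_Df$ is not identically $+\infty$ on $D$. Then $H_Df$ is the unique harmonic function on $D$ which converges to $f$ controlled by some real-valued non-negative superharmonic function on $D$. More precisely, there exists a non-negative Borel measurable function $g$ on $\partial D$ such that $k:=H_Dg$ is real-valued on $D$ and $H_Df$ converges to $f$ controlled by $k$.
   Context: $(X(t))_{t\ge0}$ under $\mathbb{P}^x$ is $d$-dimensional Brownian motion started at $x$, $\mathbb{E}^x$ the corresponding expectation, and $\tau_D=\inf\{t>0: X(t)\notin D\}$. For a Borel function $f$ on $\partial D$ bounded below, $H_Df(x):=\mathbb{E}^x f(X(\tau_D))$, $x\in D$. The classical Dirichlet problem with continuous boundary data $\varphi$ asks for a harmonic $h$ on $D$ with $\lim_{D\ni x\to y}h(x)=\varphi(y)$ for all $y\in\partial D$. Controlled convergence: for $f:\partial D\to\overline{\mathbb{R}}$ and $h,k:D\to\mathbb{R}$ with $k\ge0$, $h$ converges to $f$ controlled by $k$ if for every $A\subset D$ and $y\in\partial D\cap\overline{A}$: (1) if $\limsup_{A\ni x\to y}k(x)<\infty$ then $f(y)\in\mathbb{R}$ and $f(y)=\lim_{A\ni x\to y}h(x)$; (2) if $\lim_{A\ni x\to y}k(x)=\infty$ then $\lim_{A\ni x\to y}\frac{h(x)}{1+k(x)}=0$. *)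

theory Defs
  imports "HOL-Probability.Probability"
begin

text \<open>Brownian motion in the euclidean space 'a started at x, on the probability space M:
  X 0 = x and continuous paths (a.s.), independent increments over any finite increasing
  family of times, and Gaussian increments: for every unit vector v the projection of
  X t - X s onto v is N(0, t - s).  (By Cramer-Wold, X t - X s is then N(0,(t-s) I).)\<close>
definition brownian_motion_from ::
  "'w measure \<Rightarrow> (real \<Rightarrow> 'w \<Rightarrow> 'a::euclidean_space) \<Rightarrow> 'a \<Rightarrow> bool" where
  "brownian_motion_from M X x \<longleftrightarrow>
     prob_space M \<and>
     (\<forall>t\<ge>0. X t \<in> borel_measurable M) \<and>
     (AE \<omega> in M. X 0 \<omega> = x \<and> continuous_on {0..} (\<lambda>t. X t \<omega>)) \<and>
     (\<forall>(n::nat) (ts::nat \<Rightarrow> real). 0 \<le> ts 0 \<and> strict_mono ts \<longrightarrow>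
        prob_space.indep_vars M (\<lambda>_. borel) (\<lambda>i \<omega>. X (ts (Suc i)) \<omega> - X (ts i) \<omega>) {..<n}) \<and>
     (\<forall>s t v. 0 \<le> s \<and> s < t \<and> norm v = 1 \<longrightarrow>
        distributed M lborel (\<lambda>\<omega>. inner v (X t \<omega> - X s \<omega>))
          (\<lambda>y. ennreal (normal_density 0 (sqrt (t - s)) y)))"

definition exit_time :: "'a set \<Rightarrow> (real \<Rightarrow> 'w \<Rightarrow> 'a) \<Rightarrow> 'w \<Rightarrow> real" where
  "exit_time D X \<omega> = Inf {t. 0 < t \<and> X t \<omega> \<notin> D}"

definition HD :: "('a \<Rightarrow> 'w measure) \<Rightarrow> (real \<Rightarrow> 'w \<Rightarrow> 'a) \<Rightarrow> 'a set \<Rightarrow> ('a \<Rightarrow> ennreal) \<Rightarrow> 'a \<Rightarrow> ennreal" where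
  "HD P X D f x = (\<integral>\<^sup>+ \<omega>. f (X (exit_time D X \<omega>) \<omega>) \<partial>P x)"

definition harmonic_on :: "'a::euclidean_space set \<Rightarrow> ('a \<Rightarrow> real) \<Rightarrow> bool" where
  "harmonic_on D h \<longleftrightarrow>
     (\<forall>x\<in>D. h differentiable (at x)) \<and>
     (\<forall>b\<in>Basis. \<forall>x\<in>D. (\<lambda>y. frechet_derivative h (at y) b) differentiable (at x)) \<and>
     (\<forall>b\<in>Basis. \<forall>c\<in>Basis. continuous_on D
        (\<lambda>x. frechet_derivative (\<lambda>y. frechet_derivative h (at y) b) (at x) c)) \<and>
     (\<forall>x\<in>D. (\<Sum>b\<in>Basis. frechet_derivative (\<lambda>y. frechet_derivative h (at y) b) (at x) b) = 0)"

text \<open>Real-valued superharmonic function on an open set D: lower semicontinuous and satisfying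
  the super-mean-value inequality on every closed ball in D (volume means; real-valued
  superharmonic functions are locally integrable).\<close>
definition superharmonic_on :: "'a::euclidean_space set \<Rightarrow> ('a \<Rightarrow> real) \<Rightarrow> bool" where
  "superharmonic_on D u \<longleftrightarrow>
     (\<forall>x\<in>D. \<forall>c. c < u x \<longrightarrow> (\<forall>\<^sub>F y in at x within D. c < u y)) \<and>
     (\<forall>x r. 0 < r \<and> cball x r \<subseteq> D \<longrightarrow>
        set_integrable lborel (cball x r) u \<and>
        (\<integral>y\<in>cball x r. u y \<partial>lborel) / measure lborel (cball x r) \<le> u x)"

definition controlled_convergence ::
  "'a::euclidean_space set \<Rightarrow> ('a \<Rightarrow> ereal) \<Rightarrow> ('a \<Rightarrow> real) \<Rightarrow> ('a \<Rightarrow> real) \<Rightarrow> bool" where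
  "controlled_convergence D f h k \<longleftrightarrow>
     (\<forall>A. A \<subseteq> D \<longrightarrow> (\<forall>y\<in>frontier D \<inter> closure A.
        (Limsup (at y within A) (\<lambda>x. ereal (k x)) < \<infinity> \<longrightarrow>
           \<bar>f y\<bar> \<noteq> \<infinity> \<and> (h \<longlongrightarrow> real_of_ereal (f y)) (at y within A)) \<and>
        (filterlim k at_top (at y within A) \<longrightarrow>
           ((\<lambda>x. h x / (1 + k x)) \<longlongrightarrow> 0) (at y within A))))"

end

theory Submission
  imports Defs
begin

text \<open>Let \<open>h\<close> be harmonic with continuous boundary values. Sample the Brownian path on a time grid and freeze
  it once it has left a compact subset \<open>K\<close> of \<open>D\<close>. By a second order Taylor expansion only the moments of
  the increments matter, and they cancel up to \<open>o(mesh)\<close> in each step because the Laplacian of \<open>h\<close> vanishes.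
  Letting the mesh tend to \<open>0\<close>, and then \<open>K\<close> grow to \<open>D\<close>, one obtains that the expectation of the boundary
  values at the exit position is \<open>h x\<close>. Hence \<open>H\<^sub>D \<phi>\<close> solves the Dirichlet problem for continuous \<open>\<phi>\<close>; its
  mean value property passes to all Borel functions, and mollification turns it back into harmonicity.

  For the controlling function choose \<open>v\<^sub>n \<le> f \<le> u\<^sub>n\<close> with \<open>u\<^sub>n\<close> lower and \<open>v\<^sub>n\<close> bounded and upper
  semicontinuous such that \<open>H\<^sub>D (u\<^sub>n - v\<^sub>n)\<close> is at most \<open>4\<close> to the power \<open>-n\<close> at a fixed point, and let \<open>g\<close> be the
  sum of the functions \<open>2\<^sup>n (u\<^sub>n - v\<^sub>n)\<close>. Then \<open>H\<^sub>D u\<^sub>n\<close> exceeds \<open>H\<^sub>D v\<^sub>n\<close> by at most \<open>k = H\<^sub>D g\<close> divided by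
  \<open>2\<^sup>n\<close>, which squeezes \<open>H\<^sub>D f\<close> wherever \<open>k\<close> stays bounded.

  If \<open>h\<^sub>1\<close> and \<open>h\<^sub>2\<close> converge to \<open>f\<close> controlled by \<open>k\<^sub>1\<close> and \<open>k\<^sub>2\<close>, then \<open>h\<^sub>1 - h\<^sub>2 + \<epsilon> (k\<^sub>1 + k\<^sub>2)\<close> is superharmonic with
  nonnegative lower boundary limits, hence nonnegative; now let \<open>\<epsilon>\<close> tend to \<open>0\<close>.\<close>

section \<open>Mean values of harmonic functions\<close>

text \<open>Nothing is known about how \<open>P x\<close> depends on x, so the argument avoids the
  strong Markov property; the Dirichlet problem takes its place. For continuous boundary data its
  solution gives the integral against the exit law, measurability in the starting point comes from
  the continuity of that solution, and the mean value property for Borel f is an identity between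
  two measures that need only be tested on continuous functions. In the expansion along the grid the
  part of the remainder not small compared with |z|^2 is charged to |z|^4. Its mean is of order
  mesh^2, so the sum over T / mesh steps still vanishes; this also pays for the steps that jump out
  of D. Means are taken against (1 - |y|^2)_+^k instead of over spheres: differentiating such a
  kernel lowers k by one, so one integration by parts links the radial derivative of a mean with the
  Laplacian, and the link is used in both directions. Near a boundary point the control may
  oscillate, which neither clause of \<open>controlled_convergence\<close> covers; uniqueness is
  therefore argued along sequences thinned until each control is bounded or tends to
  infinity.\<close>

text \<open>Dominated convergence along an arbitrary sequence of difference quotients: the mean
  value inequality hands the bound \<open>w\<close> from the derivative to the quotients, and
  \<open>F' t0\<close> is measurable as their limit.\<close>

lemma has_field_derivative_integral:
  fixes F F' :: "real \<Rightarrow> 'b \<Rightarrow> real"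
  assumes d: "0 < d"
    and int: "\<And>t. \<bar>t - t0\<bar> < d \<Longrightarrow> integrable M (F t)"
    and der: "\<And>t y. \<bar>t - t0\<bar> < d \<Longrightarrow> ((\<lambda>t. F t y) has_real_derivative F' t y) (at t)"
    and bd: "\<And>t y. \<bar>t - t0\<bar> < d \<Longrightarrow> \<bar>F' t y\<bar> \<le> w y"
    and w: "integrable M w"
  shows "((\<lambda>t. \<integral>y. F t y \<partial>M) has_real_derivative (\<integral>y. F' t0 y \<partial>M)) (at t0)"
  unfolding has_field_derivative_iff tendsto_at_iff_sequentially
proof (intro allI impI)
  fix X :: "nat \<Rightarrow> real"
  assume X0: "\<forall>i. X i \<in> UNIV - {t0}" and Xl: "X \<longlonglongrightarrow> t0"
  from Xl d have "\<forall>\<^sub>F i in sequentially. \<bar>X i - t0\<bar> < d"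
    by (auto simp: tendsto_iff dist_real_def)
  then obtain n0 where n0: "\<And>i. i \<ge> n0 \<Longrightarrow> \<bar>X i - t0\<bar> < d"
    by (auto simp: eventually_sequentially)
  \<comment> \<open>Drops the first terms of \<open>X\<close>, which may lie outside the interval
    where \<open>F\<close> is controlled.\<close>
  define Z where "Z i = X (i + n0)" for i
  have Z: "Z i \<noteq> t0" "\<bar>Z i - t0\<bar> < d" for i
    using X0 n0 by (auto simp: Z_def)
  have Zl: "Z \<longlonglongrightarrow> t0"
    unfolding Z_def using Xl by (rule LIMSEQ_ignore_initial_segment)
  define Q where "Q i y = (F (Z i) y - F t0 y) / (Z i - t0)" for i y
  have Qint: "integrable M (Q i)" for i
    unfolding Q_def using int[OF Z(2)[of i]] int[of t0] d by simp
  have Qlim: "(\<lambda>i. Q i y) \<longlonglongrightarrow> F' t0 y" for y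
  proof -
    have "((\<lambda>t. (F t y - F t0 y) / (t - t0)) \<longlongrightarrow> F' t0 y) (at t0)"
      using der[of t0 y] d by (simp add: has_field_derivative_iff)
    then show ?thesis
      unfolding tendsto_at_iff_sequentially Q_def using Z Zl by (auto simp: o_def)
  qed
  have Qbd: "\<bar>Q i y\<bar> \<le> w y" for i y
  proof -
    have "norm (F (Z i) y - F t0 y) \<le> w y * norm (Z i - t0)"
    proof (rule field_differentiable_bound[of "ball t0 d" "\<lambda>t. F t y" "\<lambda>t. F' t y"])
      show "((\<lambda>t. F t y) has_real_derivative F' z y) (at z within ball t0 d)"
        if "z \<in> ball t0 d" for z
        using der[of z y] that
        by (auto simp: dist_real_def abs_minus_commute intro: has_field_derivative_at_within)
      show "norm (F' z y) \<le> w y" if "z \<in> ball t0 d" for z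
        using bd[of z y] that by (auto simp: dist_real_def)
    qed (use Z d in \<open>auto simp: dist_real_def abs_minus_commute\<close>)
    then show ?thesis
      using Z(1)[of i] by (simp add: Q_def divide_simps)
  qed
  have meas: "F' t0 \<in> borel_measurable M"
    by (rule borel_measurable_LIMSEQ_metric[of Q]) (use Qint Qlim in auto)
  have "(\<lambda>i. \<integral>y. Q i y \<partial>M) \<longlonglongrightarrow> (\<integral>y. F' t0 y \<partial>M)"
    by (rule integral_dominated_convergence[where w=w])
      (use meas Qint Qlim Qbd w in auto)
  moreover have "(\<integral>y. Q i y \<partial>M) = ((\<integral>y. F (Z i) y \<partial>M) - (\<integral>y. F t0 y \<partial>M)) / (Z i - t0)" for i
    unfolding Q_def using int[OF Z(2)[of i]] int[of t0] d by simp
  ultimately have "(\<lambda>i. ((\<integral>y. F (X (i + n0)) y \<partial>M) - (\<integral>y. F t0 y \<partial>M)) / (X (i + n0) - t0))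
      \<longlonglongrightarrow> (\<integral>y. F' t0 y \<partial>M)"
    by (simp add: Z_def)
  then show "((\<lambda>y. ((\<integral>z. F y z \<partial>M) - (\<integral>z. F t0 z \<partial>M)) / (y - t0)) \<circ> X)
      \<longlonglongrightarrow> (\<integral>y. F' t0 y \<partial>M)"
    unfolding o_def by (rule LIMSEQ_offset)
qed

lemma integral_lborel_translate:
  fixes F :: "'a::euclidean_space \<Rightarrow> real"
  assumes "F \<in> borel_measurable borel"
  shows "(\<integral>y. F (c + y) \<partial>lborel) = (\<integral>y. F y \<partial>lborel)"
proof -
  have "(\<integral>y. F y \<partial>lborel) = (\<integral>y. F y \<partial>distr lborel borel ((+) c))"
    by (simp add: lborel_distr_plus)
  also have "\<dots> = (\<integral>y. F (c + y) \<partial>lborel)"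
    using assms by (subst integral_distr) auto
  finally show ?thesis by simp
qed

lemma integrable_compact_support:
  fixes F :: "'a::euclidean_space \<Rightarrow> real"
  assumes "compact S" "continuous_on S F" "\<And>y. y \<notin> S \<Longrightarrow> F y = 0"
  shows "integrable lborel F"
proof -
  have "(\<lambda>y. indicator S y *\<^sub>R F y) = F"
    using assms(3) by (auto simp: fun_eq_iff indicator_def)
  then show ?thesis
    using borel_integrable_compact[OF assms(1,2)] by simp
qed

lemma integrable_indicator_cball:
  "integrable lborel (indicator (cball (a::'a::euclidean_space) R) :: 'a \<Rightarrow> real)"
  using borel_integrable_compact[of "cball a R" "\<lambda>_. 1::real"] by simp

text \<open>By translation invariance the integral of \<open>F (t *\<^sub>R b + y)\<close> over y
  does not depend on t; its derivative at t = 0, taken under the integral, is the left-hand side.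
  The integration by parts below rests on this.\<close>

lemma integral_directional_derivative_eq_0:
  fixes F :: "'a::euclidean_space \<Rightarrow> real"
  assumes der: "\<And>y. (F has_derivative F' y) (at y)"
    and cont: "continuous_on UNIV (\<lambda>y. F' y b)"
    and supp: "\<And>y. norm y > 1 \<Longrightarrow> F y = 0"
  shows "(\<integral>y. F' y b \<partial>lborel) = 0"
proof -
  have supp': "F' y b = 0" if "norm y > 1" for y
  proof -
    have "(F has_derivative (\<lambda>v. 0)) (at y)"
    proof (rule has_derivative_transform_within_open[of "\<lambda>_. 0"])
      show "open (- cball 0 (1::real) :: 'a set)" by auto
    qed (use that supp in auto)
    then show ?thesis
      using der[of y] has_derivative_unique by metis
  qed
  have contF: "continuous_on A F" for A
    using der has_derivative_continuous continuous_at_imp_continuous_on by blast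
  have Fm: "F \<in> borel_measurable borel"
    using contF by (intro borel_measurable_continuous_onI)
  have "bounded ((\<lambda>y. F' y b) ` cball 0 1)"
    by (intro compact_imp_bounded compact_continuous_image continuous_on_subset[OF cont]) auto
  then obtain C where C: "\<And>y. norm y \<le> 1 \<Longrightarrow> \<bar>F' y b\<bar> \<le> C"
    by (force simp: bounded_iff)
  have C0: "0 \<le> C" using C[of 0] by simp
  \<comment> \<open>For |t| < 1 all translated supports lie in the ball of radius \<open>R\<close>,
    which gives one integrable bound for all t.\<close>
  define R where "R = 1 + norm b"
  have out: "norm y > R \<Longrightarrow> \<bar>t\<bar> < 1 \<Longrightarrow> norm (t *\<^sub>R b + y) > 1" for y t
  proof -
    assume a: "norm y > R" "\<bar>t\<bar> < 1"
    have "norm y \<le> norm (t *\<^sub>R b + y) + norm (t *\<^sub>R b)"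
      by (metis add_diff_cancel_left' norm_triangle_ineq4)
    moreover have "norm (t *\<^sub>R b) \<le> norm b"
      using a(2) by (simp add: mult_left_le_one_le)
    ultimately show ?thesis using a by (simp add: R_def)
  qed
  have "((\<lambda>t. \<integral>y. F (t *\<^sub>R b + y) \<partial>lborel) has_real_derivative
      (\<integral>y. F' (0 *\<^sub>R b + y) b \<partial>lborel)) (at 0)"
  proof (rule has_field_derivative_integral[where d=1 and w="\<lambda>y. C * indicator (cball 0 R) y"])
    fix t :: real assume t: "\<bar>t - 0\<bar> < 1"
    show "integrable lborel (\<lambda>y. F (t *\<^sub>R b + y))"
    proof (rule integrable_compact_support[of "cball 0 R"])
      show "continuous_on (cball 0 R) (\<lambda>y. F (t *\<^sub>R b + y))"
        by (intro continuous_on_compose2[OF contF[of UNIV]] continuous_intros) auto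
      show "F (t *\<^sub>R b + y) = 0" if "y \<notin> cball 0 R" for y
        using that out[of y t] t by (intro supp) auto
    qed auto
    fix y
    have "((\<lambda>s. F (s *\<^sub>R b + y)) has_derivative (\<lambda>s. F' (t *\<^sub>R b + y) (s *\<^sub>R b))) (at t)"
      by (rule has_derivative_compose[OF _ der]) (auto intro!: derivative_eq_intros)
    moreover have "F' (t *\<^sub>R b + y) (s *\<^sub>R b) = s * F' (t *\<^sub>R b + y) b" for s
      using linear_cmul[OF has_derivative_linear[OF der]] by (simp add: )
    ultimately show "((\<lambda>t. F (t *\<^sub>R b + y)) has_real_derivative F' (t *\<^sub>R b + y) b) (at t)"
      by (simp add: has_field_derivative_def mult.commute[of _ "F' (t *\<^sub>R b + y) b"])
    show "\<bar>F' (t *\<^sub>R b + y) b\<bar> \<le> C * indicator (cball 0 R) y"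
    proof (cases "norm (t *\<^sub>R b + y) \<le> 1")
      case True
      then have "norm y \<le> R" using out[of y t] t by fastforce
      then show ?thesis using C[OF True] by simp
    qed (use supp' C0 in \<open>auto simp: indicator_def\<close>)
  qed (auto intro: integrable_indicator_cball)
  moreover have "(\<integral>y. F (t *\<^sub>R b + y) \<partial>lborel) = (\<integral>y. F y \<partial>lborel)" for t
    by (rule integral_lborel_translate[OF Fm])
  ultimately have "((\<lambda>t. \<integral>y. F y \<partial>lborel) has_real_derivative (\<integral>y. F' y b \<partial>lborel)) (at 0)"
    by simp
  then show ?thesis
    using DERIV_unique DERIV_const by blast
qed

section \<open>Polynomial bump kernels and C2 functions\<close>

text \<open>The delicate point is s = 0: there the difference quotient is at most
  \<open>(max 0 y) ^ k\<close>, which tends to 0 because k is at least 1.\<close>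

lemma DERIV_positive_part_power:
  assumes "k \<ge> 1"
  shows "((\<lambda>s::real. (max 0 s) ^ Suc k) has_real_derivative real (Suc k) * (max 0 s) ^ k) (at s)"
proof -
  consider "s > 0" | "s < 0" | "s = 0" by linarith
  then show ?thesis
  proof cases
    case 1
    have "((\<lambda>s::real. s ^ Suc k) has_real_derivative real (Suc k) * (max 0 s) ^ k) (at s)"
      using DERIV_pow[of "Suc k" s] 1 by (simp add: max_def)
    then show ?thesis
      by (rule has_field_derivative_transform_within_open[of _ _ _ "{0<..}"]) (use 1 in \<open>auto simp: max_def\<close>)
  next
    case 2
    have "((\<lambda>s::real. 0) has_real_derivative real (Suc k) * (max 0 s) ^ k) (at s)"
      using 2 assms by (auto simp: max_def power_0_left)
    then show ?thesis
      by (rule has_field_derivative_transform_within_open[of _ _ _ "{..<0}"]) (use 2 in \<open>auto simp: max_def\<close>)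
  next
    case 3
    have "((\<lambda>y::real. (max 0 y) ^ Suc k / y) \<longlongrightarrow> 0) (at 0)"
    proof (rule Lim_null_comparison)
      show "\<forall>\<^sub>F y in at 0. norm ((max 0 y) ^ Suc k / y) \<le> (max 0 y) ^ k"
        by (intro always_eventually) (auto simp: max_def)
      have "((\<lambda>y::real. (max 0 y) ^ k) \<longlongrightarrow> (max 0 0) ^ k) (at 0)"
        by (intro tendsto_intros)
      then show "((\<lambda>y::real. (max 0 y) ^ k) \<longlongrightarrow> 0) (at 0)"
        using assms by (simp add: power_0_left)
    qed
    then show ?thesis
      using 3 assms by (simp add: has_field_derivative_iff power_0_left)
  qed
qed

text \<open>Curried, so that \<open>partial b h\<close> is again a function and second derivatives
  arise by iteration; unfolding gives exactly the terms of \<open>harmonic_on\<close>.\<close>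

definition partial :: "'a::euclidean_space \<Rightarrow> ('a \<Rightarrow> real) \<Rightarrow> 'a \<Rightarrow> real" where
  "partial b h = (\<lambda>x. frechet_derivative h (at x) b)"

definition C2_on :: "'a::euclidean_space set \<Rightarrow> ('a \<Rightarrow> real) \<Rightarrow> bool" where
  "C2_on D h \<longleftrightarrow> (\<forall>x\<in>D. h differentiable (at x)) \<and>
     (\<forall>b\<in>Basis. \<forall>x\<in>D. partial b h differentiable (at x)) \<and>
     (\<forall>b\<in>Basis. \<forall>c\<in>Basis. continuous_on D (partial c (partial b h)))"

definition laplacian :: "('a::euclidean_space \<Rightarrow> real) \<Rightarrow> 'a \<Rightarrow> real" where
  "laplacian h x = (\<Sum>b\<in>Basis. partial b (partial b h) x)"

lemma harmonic_on_iff: "harmonic_on D h \<longleftrightarrow> C2_on D h \<and> (\<forall>x\<in>D. laplacian h x = 0)"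
  by (auto simp: harmonic_on_def C2_on_def laplacian_def partial_def)

lemma has_derivative_partial:
  assumes "h differentiable (at x)"
  shows "(h has_derivative (\<lambda>v. \<Sum>b\<in>Basis. (v \<bullet> b) * partial b h x)) (at x)"
proof -
  have d: "(h has_derivative frechet_derivative h (at x)) (at x)"
    using assms frechet_derivative_works by blast
  then interpret linear "frechet_derivative h (at x)"
    by (rule has_derivative_linear)
  have "frechet_derivative h (at x) v = (\<Sum>b\<in>Basis. (v \<bullet> b) * partial b h x)" for v
  proof -
    have "frechet_derivative h (at x) v = frechet_derivative h (at x) (\<Sum>b\<in>Basis. (v \<bullet> b) *\<^sub>R b)"
      by (simp add: euclidean_representation)
    also have "\<dots> = (\<Sum>b\<in>Basis. (v \<bullet> b) * partial b h x)"
      by (simp add: sum scale partial_def)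
    finally show ?thesis .
  qed
  then show ?thesis using d by presburger
qed

lemma partial_eqI:
  assumes "(h has_derivative h') (at x)"
  shows "partial b h x = h' b"
  using assms frechet_derivative_at[OF assms] by (simp add: partial_def)

lemma C2_on_has_derivative:
  assumes "C2_on D h" "x \<in> D"
  shows "(h has_derivative (\<lambda>v. \<Sum>b\<in>Basis. (v \<bullet> b) * partial b h x)) (at x)"
  using assms by (intro has_derivative_partial) (auto simp: C2_on_def)

lemma C2_on_partial_has_derivative:
  assumes "C2_on D h" "x \<in> D" "b \<in> Basis"
  shows "(partial b h has_derivative (\<lambda>v. \<Sum>c\<in>Basis. (v \<bullet> c) * partial c (partial b h) x)) (at x)"
  using assms by (intro has_derivative_partial) (auto simp: C2_on_def)

lemma C2_on_continuous:
  assumes "C2_on D h"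
  shows "continuous_on D h"
    and "b \<in> Basis \<Longrightarrow> continuous_on D (partial b h)"
    and "b \<in> Basis \<Longrightarrow> c \<in> Basis \<Longrightarrow> continuous_on D (partial c (partial b h))"
    and "continuous_on D (laplacian h)"
proof -
  show "continuous_on D h"
    using C2_on_has_derivative[OF assms] has_derivative_continuous continuous_at_imp_continuous_on
    by blast
  show "continuous_on D (partial b h)" if "b \<in> Basis"
    using C2_on_partial_has_derivative[OF assms _ that] has_derivative_continuous
      continuous_at_imp_continuous_on by blast
  show *: "continuous_on D (partial c (partial b h))" if "b \<in> Basis" "c \<in> Basis" for b c
    using that assms by (auto simp: C2_on_def)
  show "continuous_on D (laplacian h)"
    unfolding laplacian_def[abs_def] by (intro continuous_intros *) auto
qed

text \<open>The gradient of the kernel with exponent k + 1 is -2 (k + 1) y times the kernel with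
  exponent k. Larger exponents make the kernel smoother across the unit sphere.\<close>

definition bump :: "nat \<Rightarrow> 'a::euclidean_space \<Rightarrow> real" where
  "bump k y = (max 0 (1 - y \<bullet> y)) ^ k"

lemma bump_nonneg: "0 \<le> bump k y"
  by (simp add: bump_def)

lemma bump_le_1: "bump k y \<le> 1"
  unfolding bump_def by (intro power_le_one) auto

lemma bump_eq_0: "k \<ge> 1 \<Longrightarrow> norm y \<ge> 1 \<Longrightarrow> bump k y = 0"
proof -
  assume "k \<ge> 1" "norm y \<ge> 1"
  then have "y \<bullet> y \<ge> 1"
    using power_mono[of 1 "norm y" 2] by (simp add: power2_norm_eq_inner)
  then show ?thesis using \<open>k \<ge> 1\<close> by (simp add: bump_def power_0_left max_def)
qed

lemma continuous_on_bump [continuous_intros]: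
  "continuous_on S f \<Longrightarrow> continuous_on S (\<lambda>x. bump k (f x))"
  unfolding bump_def by (intro continuous_intros)

lemma borel_measurable_bump [measurable]: "bump k \<in> borel_measurable borel"
  by (intro borel_measurable_continuous_onI continuous_intros)

lemma bump_pos: "norm y < 1 \<Longrightarrow> 0 < bump k y"
proof -
  assume "norm y < 1"
  then have "y \<bullet> y < 1"
    by (metis dot_square_norm norm_ge_zero power2_less_eq_zero_iff power_less_one_iff zero_neq_numeral zero_less_numeral)
  then show ?thesis by (simp add: bump_def max_def)
qed

lemma bump_has_derivative:
  assumes "k \<ge> 1"
  shows "(bump (Suc k) has_derivative (\<lambda>v. - (2 * real (Suc k)) * (y \<bullet> v) * bump k y)) (at y)"
proof -
  have "((\<lambda>y. 1 - y \<bullet> y) has_derivative (\<lambda>v. - (y \<bullet> v + v \<bullet> y))) (at y)"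
    by (auto intro!: derivative_eq_intros simp: inner_commute)
  from has_derivative_compose[OF this DERIV_positive_part_power[OF assms, unfolded has_field_derivative_def]]
  show ?thesis
    unfolding bump_def
    by (rule has_derivative_eq_rhs) (auto simp: fun_eq_iff inner_commute algebra_simps)
qed

lemma integrable_times_bump:
  assumes "k \<ge> 1" "continuous_on (cball 0 1) f"
  shows "integrable lborel (\<lambda>y. f y * bump k y)"
  using assms
  by (intro integrable_compact_support[of "cball 0 1"] continuous_intros) (auto simp: bump_eq_0)

lemma integrable_bump: "k \<ge> 1 \<Longrightarrow> integrable lborel (bump k :: 'a::euclidean_space \<Rightarrow> real)"
  using integrable_times_bump[of k "\<lambda>_. 1"] by simp

lemma continuous_on_times_bump:
  fixes f :: "'a::euclidean_space \<Rightarrow> real"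
  assumes "k \<ge> 1" "1 < \<rho>" "continuous_on (ball 0 \<rho>) f"
  shows "continuous_on UNIV (\<lambda>y. f y * bump k y)"
proof -
  have "continuous_on (ball 0 \<rho>) (\<lambda>y. f y * bump k y)"
    using assms by (intro continuous_intros)
  moreover have "continuous_on (- cball 0 1) (\<lambda>y. f y * bump k y)"
    by (rule continuous_on_eq[of _ "\<lambda>_. 0"]) (use assms in \<open>auto simp: bump_eq_0\<close>)
  ultimately have "continuous_on (ball 0 \<rho> \<union> - cball 0 1) (\<lambda>y. f y * bump k y)"
    by (intro continuous_on_open_Un) auto
  moreover have "ball 0 \<rho> \<union> - cball 0 1 = (UNIV :: 'a set)"
    using assms by auto
  ultimately show ?thesis by simp
qed

section \<open>Means over scaled bump kernels\<close>

text \<open>Integration by parts for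
  \<open>partial b h (x + r *\<^sub>R y) * bump (Suc k) y\<close>: in the product rule one term
  differentiates the bump and lowers its exponent, the other yields the second derivative with a
  factor r, and the sum integrates to 0.\<close>

lemma partial_bump_integral:
  assumes D: "open D" "C2_on D h" and R: "cball x R \<subseteq> D" "0 < r" "r < R" and k: "k \<ge> 1"
    and b: "b \<in> Basis"
  shows "2 * real (Suc k) * (\<integral>y. (y \<bullet> b) * partial b h (x + r *\<^sub>R y) * bump k y \<partial>lborel)
    = r * (\<integral>y. partial b (partial b h) (x + r *\<^sub>R y) * bump (Suc k) y \<partial>lborel)"
proof -
  let ?f = "\<lambda>y. partial b h (x + r *\<^sub>R y)"
  let ?g = "\<lambda>c y. partial c (partial b h) (x + r *\<^sub>R y)"
  \<comment> \<open>The product rule, written down for every y. It is justified by differentiability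
    only while x + r y is in D; further out both bumps vanish and so does the product.\<close>
  define F' where "F' y v = ?f y * (- (2 * real (Suc k)) * (y \<bullet> v) * bump k y)
      + (\<Sum>c\<in>Basis. (r * (v \<bullet> c)) * ?g c y) * bump (Suc k) y" for y v
  have inD: "x + r *\<^sub>R y \<in> D" if "norm y < R / r" for y
  proof -
    have "norm (r *\<^sub>R y) < R" using that R by (simp add: field_simps)
    then show ?thesis using R(1) by (auto simp: dist_norm subset_iff)
  qed
  have Rr: "1 < R / r" using R by simp
  have cf: "continuous_on (ball 0 (R / r)) ?f"
    by (rule continuous_on_compose2[OF C2_on_continuous(2)[OF D(2) b]])
      (use inD in \<open>auto intro!: continuous_intros\<close>)
  have cg: "continuous_on (ball 0 (R / r)) (?g b)"
    by (rule continuous_on_compose2[OF C2_on_continuous(3)[OF D(2) b b]])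
      (use inD in \<open>auto intro!: continuous_intros\<close>)
  have sub: "cball 0 1 \<subseteq> (ball 0 (R / r) :: 'a set)"
    using Rr by auto
  have i1: "integrable lborel (\<lambda>y. (y \<bullet> b) * ?f y * bump k y)"
    by (intro integrable_times_bump[OF k] continuous_intros continuous_on_subset[OF cf sub])
  have i2: "integrable lborel (\<lambda>y. ?g b y * bump (Suc k) y)"
    using k by (intro integrable_times_bump continuous_intros continuous_on_subset[OF cg sub]) auto
  have F'b: "F' y b = - (2 * real (Suc k)) * ((y \<bullet> b) * ?f y * bump k y) + r * (?g b y * bump (Suc k) y)" for y
  proof -
    have "(\<Sum>c\<in>Basis. (r * (b \<bullet> c)) * ?g c y) = (\<Sum>c\<in>Basis. if c = b then r * ?g c y else 0)"
      using b by (intro sum.cong) (auto simp: inner_Basis)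
    then show ?thesis using b by (simp add: F'_def)
  qed
  have "(\<integral>y. F' y b \<partial>lborel) = 0"
  proof (rule integral_directional_derivative_eq_0)
    fix y :: 'a
    show "((\<lambda>y. ?f y * bump (Suc k) y) has_derivative F' y) (at y)"
    proof (cases "norm y < R / r")
      case True
      have "((\<lambda>y. x + r *\<^sub>R y) has_derivative (\<lambda>v. r *\<^sub>R v)) (at y)"
        by (auto intro!: derivative_eq_intros)
      from has_derivative_compose[OF this C2_on_partial_has_derivative[OF D(2) inD[OF True] b]]
      have "(?f has_derivative (\<lambda>v. \<Sum>c\<in>Basis. ((r *\<^sub>R v) \<bullet> c) * ?g c y)) (at y)" .
      from has_derivative_mult[OF this bump_has_derivative[OF k]]
      show ?thesis by (rule has_derivative_eq_rhs) (simp add: F'_def fun_eq_iff algebra_simps)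
    next
      case False
      then have y: "norm y > 1" using Rr by linarith
      have "((\<lambda>y. 0) has_derivative F' y) (at y)"
        using y k by (auto simp: F'_def[abs_def] bump_eq_0)
      then show ?thesis
        by (rule has_derivative_transform_within_open[of _ _ _ UNIV "- cball 0 1"])
          (use y in \<open>auto simp: bump_eq_0\<close>)
    qed
  next
    have "continuous_on UNIV (\<lambda>y. (y \<bullet> b) * ?f y * bump k y)"
      "continuous_on UNIV (\<lambda>y. ?g b y * bump (Suc k) y)"
      using k Rr by (intro continuous_on_times_bump[of _ "R / r"] continuous_intros cf cg; simp)+
    then show "continuous_on UNIV (\<lambda>y. F' y b)"
      unfolding F'b by (intro continuous_on_add continuous_on_mult_left)
  qed (auto simp: bump_eq_0)
  then show ?thesis
    unfolding F'b using i1 i2 by simp argo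
qed

text \<open>Differentiation under the integral produces the radial derivative of h;
  \<open>partial_bump_integral\<close> turns each of its components into a second derivative against
  the next bump, and these add up to the Laplacian.\<close>

lemma deriv_bump_mean:
  assumes D: "open D" "C2_on D h" and R: "cball x R \<subseteq> D" "0 < r" "r < R" and k: "k \<ge> 1"
  shows "((\<lambda>r. \<integral>y. h (x + r *\<^sub>R y) * bump k y \<partial>lborel) has_real_derivative
    r / (2 * real (Suc k)) * (\<integral>y. laplacian h (x + r *\<^sub>R y) * bump (Suc k) y \<partial>lborel)) (at r)"
proof -
  let ?F' = "\<lambda>t y. (\<Sum>b\<in>Basis. (y \<bullet> b) * partial b h (x + t *\<^sub>R y) * bump k y)"
  have inB: "x + t *\<^sub>R y \<in> cball x R" if "norm y \<le> 1" "\<bar>t\<bar> \<le> R" for y t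
  proof -
    have "norm (t *\<^sub>R y) \<le> R * 1"
      unfolding norm_scaleR using that by (intro mult_mono) auto
    then show ?thesis by (simp add: dist_norm)
  qed
  have "\<exists>C. \<forall>y\<in>cball x R. \<bar>partial b h y\<bar> \<le> C" if "b \<in> Basis" for b
  proof -
    have "bounded (partial b h ` cball x R)"
      by (intro compact_imp_bounded compact_continuous_image continuous_on_subset[OF C2_on_continuous(2)[OF D(2) that]] R(1)) auto
    then show ?thesis by (force simp: bounded_iff)
  qed
  then obtain C where C: "\<And>b y. b \<in> Basis \<Longrightarrow> y \<in> cball x R \<Longrightarrow> \<bar>partial b h y\<bar> \<le> C b"
    by metis
  \<comment> \<open>Keeps every s with |s - r| < d strictly between 0 and R.\<close>
  define d where "d = min r (R - r)"
  have d: "0 < d" using R by (simp add: d_def)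
  have t: "0 < t" "t < R" if "\<bar>t - r\<bar> < d" for t
    using that R by (auto simp: d_def)
  have cont: "continuous_on (cball 0 1) (\<lambda>y. f (x + t *\<^sub>R y))"
    if "continuous_on D f" "\<bar>t\<bar> \<le> R" for f :: "'a \<Rightarrow> real" and t
    by (rule continuous_on_compose2[OF that(1)]) (use inB that R(1) in \<open>auto intro!: continuous_intros\<close>)
  have "((\<lambda>r. \<integral>y. h (x + r *\<^sub>R y) * bump k y \<partial>lborel) has_real_derivative (\<integral>y. ?F' r y \<partial>lborel)) (at r)"
  proof (rule has_field_derivative_integral[OF d, where w = "\<lambda>y. (\<Sum>b\<in>Basis. C b) * bump k y"])
    fix s assume s: "\<bar>s - r\<bar> < d"
    show "integrable lborel (\<lambda>y. h (x + s *\<^sub>R y) * bump k y)"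
      using t[OF s] by (intro integrable_times_bump k cont C2_on_continuous(1)[OF D(2)]) auto
    fix y :: 'a
    show "((\<lambda>t. h (x + t *\<^sub>R y) * bump k y) has_real_derivative ?F' s y) (at s)"
    proof (cases "norm y \<le> 1")
      case True
      then have "x + s *\<^sub>R y \<in> D" using inB[of y s] t[OF s] R(1) by auto
      then have "((\<lambda>t. h (x + t *\<^sub>R y)) has_derivative (\<lambda>u. \<Sum>b\<in>Basis. ((u *\<^sub>R y) \<bullet> b) * partial b h (x + s *\<^sub>R y))) (at s)"
        by (intro has_derivative_compose[where f = "\<lambda>t. x + t *\<^sub>R y" and g = h] C2_on_has_derivative[OF D(2)])
          (auto intro!: derivative_eq_intros)
      from has_derivative_mult_left[OF this, of "bump k y"]
      show ?thesis unfolding has_field_derivative_def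
        by (rule has_derivative_eq_rhs) (simp add: fun_eq_iff sum_distrib_left sum_distrib_right algebra_simps)
    qed (use k in \<open>simp add: bump_eq_0\<close>)
    show "\<bar>?F' s y\<bar> \<le> (\<Sum>b\<in>Basis. C b) * bump k y"
    proof (cases "norm y \<le> 1")
      case True
      have "\<bar>?F' s y\<bar> \<le> (\<Sum>b\<in>Basis. \<bar>y \<bullet> b\<bar> * \<bar>partial b h (x + s *\<^sub>R y)\<bar> * bump k y)"
        by (rule order_trans[OF sum_abs]) (simp add: abs_mult bump_nonneg)
      also have "\<dots> \<le> (\<Sum>b\<in>Basis. 1 * C b * bump k y)"
      proof (intro sum_mono mult_mono C inB)
        fix b :: 'a assume "b \<in> Basis"
        then show "\<bar>y \<bullet> b\<bar> \<le> 1" using Basis_le_norm[of b y] True by simp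
        show "0 \<le> 1 * C b"
          using C[OF \<open>b \<in> Basis\<close>, of x] R by force
      qed (use True t[OF s] bump_nonneg in auto)
      finally show ?thesis by (simp add: sum_distrib_right)
    qed (use k in \<open>simp add: bump_eq_0\<close>)
  next
    show "integrable lborel (\<lambda>y. (\<Sum>b\<in>Basis. C b) * bump k (y::'a))"
      by (rule integrable_mult_right[OF integrable_bump[OF k]])
  qed
  moreover have "(\<integral>y. ?F' r y \<partial>lborel) = r / (2 * real (Suc k)) * (\<integral>y. laplacian h (x + r *\<^sub>R y) * bump (Suc k) y \<partial>lborel)"
  proof -
    have "(\<integral>y. ?F' r y \<partial>lborel) = (\<Sum>b\<in>Basis. \<integral>y. (y \<bullet> b) * partial b h (x + r *\<^sub>R y) * bump k y \<partial>lborel)"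
      using R by (intro Bochner_Integration.integral_sum integrable_times_bump k continuous_intros cont C2_on_continuous(2)[OF D(2)]) auto
    also have "\<dots> = (\<Sum>b\<in>Basis. r / (2 * real (Suc k)) * (\<integral>y. partial b (partial b h) (x + r *\<^sub>R y) * bump (Suc k) y \<partial>lborel))"
      using partial_bump_integral[OF D R k] by (intro sum.cong) (auto simp: field_simps)
    also have "\<dots> = r / (2 * real (Suc k)) * (\<integral>y. (\<Sum>b\<in>Basis. partial b (partial b h) (x + r *\<^sub>R y) * bump (Suc k) y) \<partial>lborel)"
      using R by (subst Bochner_Integration.integral_sum)
        (auto intro!: integrable_times_bump continuous_intros cont C2_on_continuous(3)[OF D(2)] simp: sum_distrib_left)
    also have "(\<lambda>y. \<Sum>b\<in>Basis. partial b (partial b h) (x + r *\<^sub>R y) * bump (Suc k) y)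
        = (\<lambda>y. laplacian h (x + r *\<^sub>R y) * bump (Suc k) y)"
      by (simp add: laplacian_def sum_distrib_right)
    finally show ?thesis .
  qed
  ultimately show ?thesis by simp
qed

lemma continuous_on_bump_mean:
  fixes f :: "'a::euclidean_space \<Rightarrow> real"
  assumes f: "continuous_on (cball x R) f" and k: "k \<ge> 1" and R: "0 \<le> R"
  shows "continuous_on {0..R} (\<lambda>r. \<integral>y. f (x + r *\<^sub>R y) * bump k y \<partial>lborel)"
  unfolding continuous_on_sequentially
proof (intro allI impI ballI)
  fix X :: "nat \<Rightarrow> real" and r assume r: "r \<in> {0..R}" and X: "(\<forall>n. X n \<in> {0..R}) \<and> X \<longlonglongrightarrow> r"
  have inB: "x + t *\<^sub>R y \<in> cball x R" if "norm y \<le> 1" "t \<in> {0..R}" for y t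
  proof -
    have "norm (t *\<^sub>R y) \<le> R * 1"
      unfolding norm_scaleR using that by (intro mult_mono) auto
    then show ?thesis by (simp add: dist_norm)
  qed
  have "bounded (f ` cball x R)"
    by (intro compact_imp_bounded compact_continuous_image f) auto
  then obtain C where C: "\<And>y. y \<in> cball x R \<Longrightarrow> \<bar>f y\<bar> \<le> C"
    by (force simp: bounded_iff)
  have int: "integrable lborel (\<lambda>y. f (x + t *\<^sub>R y) * bump k y)" if "t \<in> {0..R}" for t
  proof (intro integrable_times_bump k)
    show "continuous_on (cball 0 1) (\<lambda>y. f (x + t *\<^sub>R y))"
      by (rule continuous_on_compose2[OF f]) (use inB that in \<open>auto intro!: continuous_intros\<close>)
  qed
  have "(\<lambda>n. \<integral>y. f (x + X n *\<^sub>R y) * bump k y \<partial>lborel) \<longlonglongrightarrow> (\<integral>y. f (x + r *\<^sub>R y) * bump k y \<partial>lborel)"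
  proof (rule integral_dominated_convergence[where w = "\<lambda>y. C * bump k y"])
    show "integrable lborel (\<lambda>y::'a. C * bump k y)"
      by (rule integrable_mult_right[OF integrable_bump[OF k]])
    show "AE y in lborel. (\<lambda>n. f (x + X n *\<^sub>R y) * bump k y) \<longlonglongrightarrow> f (x + r *\<^sub>R y) * bump k y"
    proof (rule AE_I2)
      fix y :: 'a
      show "(\<lambda>n. f (x + X n *\<^sub>R y) * bump k y) \<longlonglongrightarrow> f (x + r *\<^sub>R y) * bump k y"
      proof (cases "norm y \<le> 1")
        case True
        have "(\<lambda>n. f (x + X n *\<^sub>R y)) \<longlonglongrightarrow> f (x + r *\<^sub>R y)"
          by (rule continuous_on_tendsto_compose[OF f])
            (use X r True inB in \<open>auto intro!: tendsto_intros always_eventually simp del: mem_cball\<close>)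
        then show ?thesis by (intro tendsto_intros)
      qed (use k in \<open>simp add: bump_eq_0\<close>)
    qed
    show "AE y in lborel. norm (f (x + X n *\<^sub>R y) * bump k y) \<le> C * bump k y" for n
    proof (rule AE_I2)
      fix y :: 'a
      show "norm (f (x + X n *\<^sub>R y) * bump k y) \<le> C * bump k y"
        using C[OF inB[of y "X n"]] X k bump_nonneg[of k y]
        by (cases "norm y \<le> 1") (auto simp: bump_eq_0 abs_mult intro!: mult_right_mono simp del: mem_cball)
    qed
  qed (use int X r in auto)
  then show "((\<lambda>r. \<integral>y. f (x + r *\<^sub>R y) * bump k y \<partial>lborel) \<circ> X) \<longlonglongrightarrow> (\<integral>y. f (x + r *\<^sub>R y) * bump k y \<partial>lborel)"
    by (simp add: o_def)
qed

text \<open>By \<open>deriv_bump_mean\<close> the mean has derivative 0 for positive radii, and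
  continuity at radius 0 identifies the constant.\<close>

lemma harmonic_bump_mean:
  fixes x :: "'a::euclidean_space"
  assumes D: "open D" "harmonic_on D h" and R: "cball x R \<subseteq> D" "0 < r" "r < R" and k: "k \<ge> 1"
  shows "(\<integral>y. h (x + r *\<^sub>R y) * bump k y \<partial>lborel) = h x * (\<integral>y. bump k y \<partial>(lborel :: 'a measure))"
proof -
  have C2: "C2_on D h" and lap: "\<And>y. y \<in> D \<Longrightarrow> laplacian h y = 0"
    using D by (auto simp: harmonic_on_iff)
  let ?m = "\<lambda>r. \<integral>y. h (x + r *\<^sub>R y) * bump k y \<partial>lborel"
  have inB: "x + t *\<^sub>R y \<in> D" if "norm y \<le> 1" "\<bar>t\<bar> \<le> R" for y t
  proof -
    have "norm (t *\<^sub>R y) \<le> R * 1"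
      unfolding norm_scaleR using that by (intro mult_mono) auto
    then show ?thesis using R(1) by (auto simp: dist_norm subset_iff)
  qed
  have "?m r = ?m 0"
  proof (rule DERIV_isconst_end[OF R(2)])
    have "continuous_on {0..R} ?m"
      using R by (intro continuous_on_bump_mean k continuous_on_subset[OF C2_on_continuous(1)[OF C2]]) auto
    then show "continuous_on {0..r} ?m"
      by (rule continuous_on_subset) (use R in auto)
    fix s assume s: "0 < s" "s < r"
    have "(\<lambda>y. laplacian h (x + s *\<^sub>R y) * bump (Suc k) y) = (\<lambda>_. 0)"
    proof
      fix y :: 'a
      show "laplacian h (x + s *\<^sub>R y) * bump (Suc k) y = 0"
        using lap[OF inB[of y s]] s R by (cases "norm y \<le> 1") (auto simp: bump_eq_0)
    qed
    then show "(?m has_real_derivative 0) (at s)"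
      using deriv_bump_mean[OF D(1) C2 R(1) s(1) _ k] s R by simp
  qed
  then show ?thesis by simp
qed

lemma lborel_integral_affine:
  fixes f :: "'a::euclidean_space \<Rightarrow> real"
  assumes [measurable]: "f \<in> borel_measurable borel" and r: "r > 0"
  shows "(\<integral>z. f z \<partial>lborel) = r ^ DIM('a) * (\<integral>y. f (x + r *\<^sub>R y) \<partial>lborel)"
  using r by (subst lborel_affine[of r x]) (simp_all add: integral_density integral_distr)

definition mollifier :: "nat \<Rightarrow> real \<Rightarrow> 'a::euclidean_space \<Rightarrow> real" where
  "mollifier k r y = bump k (y /\<^sub>R r) / (r ^ DIM('a) * (\<integral>y. bump k y \<partial>(lborel :: 'a measure)))"

lemma bump_integral_pos:
  assumes "k \<ge> 1"
  shows "0 < (\<integral>y. bump k y \<partial>(lborel :: 'a::euclidean_space measure))"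
proof -
  have "(\<integral>y. bump k y \<partial>(lborel :: 'a measure)) \<noteq> 0"
  proof
    assume "(\<integral>y. bump k y \<partial>(lborel :: 'a measure)) = 0"
    then have "AE y in (lborel :: 'a measure). bump k y = 0"
      using integrable_bump[OF assms] integral_nonneg_eq_0_iff_AE[of lborel "bump k :: 'a \<Rightarrow> real"]
      by (auto simp: bump_nonneg)
    then have "AE y in (lborel :: 'a measure). y \<notin> ball 0 1"
      by eventually_elim (use bump_pos[of _ k] in fastforce)
    then have "ball 0 1 \<in> null_sets (lborel :: 'a measure)"
      by (subst (asm) AE_iff_null_sets[symmetric]) auto
    then show False
      using open_not_negligible[of "ball (0::'a) 1"]
      by (auto simp: negligible_iff_null_sets null_sets_completionI)
  qed
  moreover have "0 \<le> (\<integral>y. bump k y \<partial>(lborel :: 'a measure))"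
    by (simp add: bump_nonneg)
  ultimately show ?thesis by linarith
qed

lemma mollifier_nonneg: "0 < r \<Longrightarrow> 0 \<le> mollifier k r y"
  by (auto simp: mollifier_def bump_nonneg intro!: divide_nonneg_nonneg mult_nonneg_nonneg)

lemma mollifier_eq_0: "k \<ge> 1 \<Longrightarrow> 0 < r \<Longrightarrow> r \<le> norm y \<Longrightarrow> mollifier k r y = 0"
  by (simp add: mollifier_def bump_eq_0 field_simps)

lemma continuous_on_mollifier [continuous_intros]:
  "continuous_on S f \<Longrightarrow> continuous_on S (\<lambda>x. mollifier k r (f x))"
  unfolding mollifier_def divide_inverse by (intro continuous_intros)

lemma borel_measurable_mollifier [measurable]: "mollifier k r \<in> borel_measurable borel"
  by (intro borel_measurable_continuous_onI continuous_intros)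

lemma mollifier_uminus: "mollifier k r (- y) = mollifier k r y"
  by (simp add: mollifier_def bump_def)

lemma integral_mollifier:
  fixes u :: "'a::euclidean_space \<Rightarrow> real"
  assumes "u \<in> borel_measurable borel" "0 < r"
  shows "(\<integral>z. u z * mollifier k r (z - x) \<partial>lborel) =
    (\<integral>y. u (x + r *\<^sub>R y) * bump k y \<partial>lborel) / (\<integral>y. bump k y \<partial>(lborel :: 'a measure))"
proof -
  have "(\<integral>z. u z * mollifier k r (z - x) \<partial>lborel) =
      r ^ DIM('a) * (\<integral>y. u (x + r *\<^sub>R y) * mollifier k r (x + r *\<^sub>R y - x) \<partial>lborel)"
    using assms by (intro lborel_integral_affine borel_measurable_times
        borel_measurable_continuous_onI[of "\<lambda>z. mollifier k r (z - x)"] continuous_intros)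
  also have "(\<lambda>y. u (x + r *\<^sub>R y) * mollifier k r (x + r *\<^sub>R y - x)) =
      (\<lambda>y. (u (x + r *\<^sub>R y) * bump k y) / (r ^ DIM('a) * (\<integral>y. bump k y \<partial>(lborel :: 'a measure))))"
    using assms by (simp add: mollifier_def)
  finally show ?thesis using assms by simp
qed

lemma integrable_mollifier:
  assumes "k \<ge> 1" "0 < r"
  shows "integrable lborel (\<lambda>z. mollifier k r (z - x :: 'a::euclidean_space))"
  using assms
  by (intro integrable_compact_support[of "cball x r"] continuous_intros)
    (auto simp: mollifier_eq_0 dist_norm norm_minus_commute)

lemma integral_mollifier_eq_1:
  assumes "k \<ge> 1" "0 < r"
  shows "(\<integral>z. mollifier k r (z - x :: 'a::euclidean_space) \<partial>lborel) = 1"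
  using integral_mollifier[of "\<lambda>_. 1" r k x] bump_integral_pos[OF assms(1), where ?'a = 'a] assms(2) by simp

lemma harmonic_mollifier_mean:
  fixes x :: "'a::euclidean_space"
  assumes D: "open D" "harmonic_on D h" and R: "cball x R \<subseteq> D" "0 < r" "r < R" and k: "k \<ge> 1"
  shows "(\<integral>z. h z * mollifier k r (z - x) \<partial>lborel) = h x"
proof -
  have c: "continuous_on D h"
    using D by (auto simp: harmonic_on_iff intro: C2_on_continuous)
  \<comment> \<open>Cutting h off outside \<open>cball x R\<close> makes it Borel on the whole space
    and leaves its product with the kernel unchanged.\<close>
  define u where "u z = indicator (cball x R) z *\<^sub>R h z" for z
  have m: "u \<in> borel_measurable borel"
    unfolding u_def by (intro borel_measurable_continuous_on_indicator continuous_on_subset[OF c R(1)]) auto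
  have 1: "h z * mollifier k r (z - x) = u z * mollifier k r (z - x)" for z
    using R k by (cases "z \<in> cball x R") (auto simp: u_def mollifier_eq_0 dist_norm norm_minus_commute)
  have 2: "u (x + r *\<^sub>R y) * bump k y = h (x + r *\<^sub>R y) * bump k y" for y
  proof (cases "norm y \<le> 1")
    case True
    then have "x + r *\<^sub>R y \<in> cball x R"
      using R mult_mono[of r R "norm y" 1] by (auto simp: dist_norm)
    then show ?thesis by (simp add: u_def)
  qed (use k in \<open>simp add: bump_eq_0\<close>)
  show ?thesis
    unfolding 1 integral_mollifier[OF m R(2)] 2 harmonic_bump_mean[OF D R k]
    using bump_integral_pos[OF k, where ?'a = 'a] by simp
qed

section \<open>Means over balls\<close>

lemma cball_in_open_enlarge:
  fixes x :: "'a::euclidean_space"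
  assumes "open D" "cball x r \<subseteq> D" "0 < r"
  obtains R where "r < R" "cball x R \<subseteq> D"
proof -
  obtain e where e: "0 < e" "{z. infdist z (cball x r) \<le> e} \<subseteq> D"
    using compact_in_open_separated[of "cball x r" D] assms by auto
  have "cball x (r + e) \<subseteq> D"
  proof
    fix z assume z: "z \<in> cball x (r + e)"
    \<comment> \<open>The homothety centred at x that shrinks radius r + e to r moves z by at most e
      and puts it into \<open>cball x r\<close>.\<close>
    define p where "p = x + (r / (r + e)) *\<^sub>R (z - x)"
    have "norm (z - x) \<le> r + e" using z by (simp add: dist_norm norm_minus_commute)
    then have a: "r / (r + e) * norm (z - x) \<le> r" "e / (r + e) * norm (z - x) \<le> e"
      using assms(3) e(1) by (simp_all add: divide_simps mult.commute)
    have "p \<in> cball x r"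
      using a(1) assms(3) e(1) by (simp add: p_def dist_norm)
    moreover have "z - p = (e / (r + e)) *\<^sub>R (z - x)"
    proof -
      have "1 - r / (r + e) = e / (r + e)" using assms(3) e(1) by (simp add: field_simps)
      moreover have "z - p = (1 - r / (r + e)) *\<^sub>R (z - x)" by (simp add: p_def algebra_simps)
      ultimately show ?thesis by simp
    qed
    then have "dist z p \<le> e"
      using a(2) assms(3) e(1) by (simp add: dist_norm)
    ultimately have "infdist z (cball x r) \<le> e"
      by (meson infdist_le2)
    then show "z \<in> D" using e by auto
  qed
  then show thesis using that[of "r + e"] e by simp
qed

text \<open>\<open>superharmonic_on\<close> speaks of uniform means over closed balls, so the
  indicator of a ball has to be recovered from the bumps. It is the limit of difference quotients,
  with respect to s^2, of the truncated paraboloids s^2 - |z - x|^2, which are multiples of the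
  first bump.\<close>

lemma harmonic_ball_mean:
  fixes x :: "'a::euclidean_space"
  assumes D: "open D" "harmonic_on D h" and r: "cball x r \<subseteq> D" "0 < r"
  shows "set_integrable lborel (cball x r) h"
    and "(\<integral>y\<in>cball x r. h y \<partial>lborel) = h x * measure lborel (cball x r)"
proof -
  have c: "continuous_on D h"
    using D by (auto simp: harmonic_on_iff intro: C2_on_continuous)
  show si: "set_integrable lborel (cball x r) h"
    unfolding set_integrable_def
    by (intro borel_integrable_compact continuous_on_subset[OF c r(1)]) auto
  obtain R where R: "r < R" "cball x R \<subseteq> D"
    using cball_in_open_enlarge[OF D(1) r] .
  \<comment> \<open>Subtracting \<open>h x\<close> makes every kernel mean 0, so that normalising
    constants play no part in the limit; the cut-off makes the function integrable.\<close>
  define G where "G z = indicator (cball x R) z *\<^sub>R (h z - h x)" for z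
  have Gi: "integrable lborel G"
    unfolding G_def
    by (intro borel_integrable_compact continuous_intros continuous_on_subset[OF c R(2)]) auto
  have Gm: "G \<in> borel_measurable borel"
    using borel_measurable_integrable[OF Gi] by simp
  have key: "(\<integral>z. G z * max 0 (s\<^sup>2 - (norm (z - x))\<^sup>2) \<partial>lborel) = 0"
    and keyi: "integrable lborel (\<lambda>z. G z * max 0 (s\<^sup>2 - (norm (z - x))\<^sup>2))"
    if s: "0 < s" "s < R" for s
  proof -
    \<comment> \<open>The truncated paraboloid is s^2 times a scaled \<open>bump 1\<close>, hence a
      constant multiple of \<open>mollifier 1 s\<close>.\<close>
    have eq: "G z * max 0 (s\<^sup>2 - (norm (z - x))\<^sup>2) =
        (s\<^sup>2 * (s ^ DIM('a) * (\<integral>y. bump 1 y \<partial>(lborel :: 'a measure)))) *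
        (h z * mollifier 1 s (z - x) - h x * mollifier 1 s (z - x))" for z
    proof -
      have 1: "max 0 (s\<^sup>2 - (norm (z - x))\<^sup>2) = s\<^sup>2 * bump 1 ((z - x) /\<^sub>R s)"
      proof -
        have "s\<^sup>2 - (norm (z - x))\<^sup>2 = s\<^sup>2 * (1 - ((z - x) /\<^sub>R s) \<bullet> ((z - x) /\<^sub>R s))"
        proof -
          have "((z - x) /\<^sub>R s) \<bullet> ((z - x) /\<^sub>R s) = (norm (z - x))\<^sup>2 / s\<^sup>2"
            by (simp add: dot_square_norm power2_eq_square divide_inverse flip: inverse_mult_distrib abs_mult)
          then show ?thesis using s by (simp add: right_diff_distrib)
        qed
        moreover have "max 0 (s\<^sup>2 * a) = s\<^sup>2 * max 0 a" for a :: real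
          using s by (auto simp: max_def zero_le_mult_iff mult_le_0_iff)
        ultimately show ?thesis by (simp add: bump_def)
      qed
      have 2: "G z * bump 1 ((z - x) /\<^sub>R s) = (h z - h x) * bump 1 ((z - x) /\<^sub>R s)"
      proof (cases "z \<in> cball x R")
        case False
        then have "s \<le> norm (z - x)" using s by (simp add: dist_norm norm_minus_commute)
        then have "1 \<le> norm (z - x) / s" using s by simp
        then have "1 \<le> norm ((z - x) /\<^sub>R s)" using s by (simp add: divide_inverse mult.commute)
        then show ?thesis by (simp add: bump_eq_0)
      qed (simp add: G_def)
      define B where "B = bump 1 ((z - x) /\<^sub>R s)"
      define c where "c = s ^ DIM('a) * (\<integral>y. bump 1 y \<partial>(lborel :: 'a measure))"
      have c: "c \<noteq> 0" using s bump_integral_pos[of 1, where ?'a = 'a] by (simp add: c_def)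
      have "G z * (s\<^sup>2 * B) = (s\<^sup>2 * c) * (((h z - h x) * B) / c)"
        using 2 c by (simp add: B_def)
      then show ?thesis
        unfolding 1 mollifier_def B_def[symmetric] c_def[symmetric]
        by (simp add: left_diff_distrib diff_divide_distrib)
    qed
    have i1: "integrable lborel (\<lambda>z. h z * mollifier 1 s (z - x))"
      using s by (intro integrable_compact_support[of "cball x R"] continuous_intros continuous_on_subset[OF c R(2)])
        (auto simp: mollifier_eq_0 dist_norm norm_minus_commute)
    have i2: "integrable lborel (\<lambda>z. h x * mollifier 1 s (z - x))"
      by (rule integrable_mult_right[OF integrable_mollifier]) (use s in auto)
    show "integrable lborel (\<lambda>z. G z * max 0 (s\<^sup>2 - (norm (z - x))\<^sup>2))"
      unfolding eq by (intro integrable_mult_right Bochner_Integration.integrable_diff i1 i2)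
    show "(\<integral>z. G z * max 0 (s\<^sup>2 - (norm (z - x))\<^sup>2) \<partial>lborel) = 0"
      unfolding eq using i1 i2 harmonic_mollifier_mean[OF D R(2) s, of 1] s
      by (simp add: integral_mollifier_eq_1)
  qed
  \<comment> \<open>With this choice the radii \<open>\<sigma> n\<close> stay below R, and their
    squares decrease to r^2.\<close>
  define a where "a = (R\<^sup>2 - r\<^sup>2) / 2"
  have a: "0 < a"
    using R r power_strict_mono[of r R 2] by (simp add: a_def)
  define \<sigma> where "\<sigma> n = sqrt (r\<^sup>2 + a / real (Suc n))" for n
  have \<sigma>2: "(\<sigma> n)\<^sup>2 = r\<^sup>2 + a / real (Suc n)" for n
    using a by (simp add: \<sigma>_def)
  have \<sigma>: "0 < \<sigma> n" "\<sigma> n < R" for n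
  proof -
    show "0 < \<sigma> n" using a r by (simp add: \<sigma>_def add_pos_pos)
    have "a / real (Suc n) \<le> a" using a by (simp add: divide_simps)
    moreover have "a < R\<^sup>2 - r\<^sup>2" using a by (simp add: a_def)
    ultimately have "(\<sigma> n)\<^sup>2 < R\<^sup>2" unfolding \<sigma>2 by linarith
    then show "\<sigma> n < R" using R r power2_less_imp_less[of "\<sigma> n" R] by simp
  qed
  \<comment> \<open>Since the squared radius approaches r^2 from above, the quotient equals 1 on the
    whole closed ball, its sphere included.\<close>
  define Q where "Q n z = (max 0 ((\<sigma> n)\<^sup>2 - (norm (z - x))\<^sup>2) - max 0 (r\<^sup>2 - (norm (z - x))\<^sup>2)) / (a / real (Suc n))"
    for n z
  have Q01: "0 \<le> Q n z" "Q n z \<le> 1" for n z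
  proof -
    have t: "0 < a / real (Suc n)" using a by simp
    have "0 \<le> (max 0 (p + t - q) - max 0 (p - q)) / t" "(max 0 (p + t - q) - max 0 (p - q)) / t \<le> 1"
      if "0 < t" for p q t :: real
      using that by (auto simp: max_def divide_le_eq_1 intro!: divide_nonneg_pos)
    from this[OF t] show "0 \<le> Q n z" "Q n z \<le> 1"
      unfolding Q_def \<sigma>2 by blast+
  qed
  have Q0: "(\<integral>z. G z * Q n z \<partial>lborel) = 0" for n
  proof -
    have "G z * Q n z = (G z * max 0 ((\<sigma> n)\<^sup>2 - (norm (z - x))\<^sup>2) - G z * max 0 (r\<^sup>2 - (norm (z - x))\<^sup>2)) / (a / real (Suc n))" for z
      by (simp add: Q_def algebra_simps)
    then show ?thesis using key[OF \<sigma>] keyi[OF \<sigma>] key[OF r(2) R(1)] keyi[OF r(2) R(1)] by simp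
  qed
  have "(\<lambda>n. \<integral>z. G z * Q n z \<partial>lborel) \<longlonglongrightarrow> (\<integral>z. G z * indicator (cball x r) z \<partial>lborel)"
  proof (rule integral_dominated_convergence[where w = "\<lambda>z. \<bar>G z\<bar>"])
    show "AE z in lborel. (\<lambda>n. G z * Q n z) \<longlonglongrightarrow> G z * indicator (cball x r) z"
    proof (rule AE_I2)
      fix z
      have "(\<lambda>n. Q n z) \<longlonglongrightarrow> indicator (cball x r) z"
      proof (cases "norm (z - x) \<le> r")
        case True
        then have "(norm (z - x))\<^sup>2 \<le> r\<^sup>2" by (simp add: power_mono)
        moreover have "0 \<le> a / real (Suc n)" for n using a by simp
        ultimately have "Q n z = 1" for n
          using a unfolding Q_def \<sigma>2 max_def by (auto simp: add_increasing2 simp del: of_nat_Suc)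
        then show ?thesis using True by (simp add: dist_norm norm_minus_commute)
      next
        case False
        then have lt: "r\<^sup>2 < (norm (z - x))\<^sup>2" using r by (simp add: power_strict_mono)
        have "(\<lambda>n. a / real (Suc n)) \<longlonglongrightarrow> 0"
          by (rule LIMSEQ_Suc) (rule lim_const_over_n)
        then have "\<forall>\<^sub>F n in sequentially. a / real (Suc n) < (norm (z - x))\<^sup>2 - r\<^sup>2"
          using lt by (intro order_tendstoD) auto
        then have "\<forall>\<^sub>F n in sequentially. Q n z = 0"
          by eventually_elim (use lt in \<open>auto simp: Q_def \<sigma>2\<close>)
        then show ?thesis using False by (simp add: dist_norm norm_minus_commute tendsto_eventually)
      qed
      then show "(\<lambda>n. G z * Q n z) \<longlonglongrightarrow> G z * indicator (cball x r) z"
        by (intro tendsto_intros)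
    qed
    show "AE z in lborel. norm (G z * Q n z) \<le> \<bar>G z\<bar>" for n
      using Q01[of n] by (intro AE_I2) (simp add: abs_mult mult_left_le)
    show "(\<lambda>z. G z * Q n z) \<in> borel_measurable lborel" for n
      unfolding Q_def using Gm by measurable
  qed (use Gm Gi in \<open>auto intro!: borel_measurable_times borel_measurable_indicator borel_closed\<close>)
  then have "(\<integral>z. G z * indicator (cball x r) z \<partial>lborel) = 0"
    unfolding Q0 by (simp add: LIMSEQ_const_iff)
  moreover have "G z * indicator (cball x r) z = indicator (cball x r) z *\<^sub>R h z - h x * indicator (cball x r) z" for z
    using R by (auto simp: G_def indicator_def)
  ultimately have "(\<integral>z. indicator (cball x r) z *\<^sub>R h z \<partial>lborel) - h x * measure lborel (cball x r) = 0"
    using si[unfolded set_integrable_def] integrable_indicator_cball[of x r] by simp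
  then show "(\<integral>y\<in>cball x r. h y \<partial>lborel) = h x * measure lborel (cball x r)"
    by (simp add: set_lebesgue_integral_def)
qed

section \<open>Smoothing by convolution\<close>

lemma compact_support_uniformly_continuous:
  fixes f :: "'a::euclidean_space \<Rightarrow> real"
  assumes "continuous_on UNIV f" and supp: "\<And>y. \<rho> \<le> norm y \<Longrightarrow> f y = 0"
  shows "uniformly_continuous_on UNIV f"
  unfolding uniformly_continuous_on_def
proof (intro allI impI)
  fix e :: real assume e: "0 < e"
  have "uniformly_continuous_on (cball 0 (\<rho> + 1)) f"
    by (intro compact_uniformly_continuous continuous_on_subset[OF assms(1)]) auto
  then obtain d where d: "d > 0"
    "\<And>x x'. x \<in> cball 0 (\<rho> + 1) \<Longrightarrow> x' \<in> cball 0 (\<rho> + 1) \<Longrightarrow> dist x' x < d \<Longrightarrow> dist (f x') (f x) < e"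
    using e unfolding uniformly_continuous_on_def by metis
  show "\<exists>d>0. \<forall>x\<in>UNIV. \<forall>x'\<in>UNIV. dist x' x < d \<longrightarrow> dist (f x') (f x) < e"
  proof (intro exI[of _ "min d 1"] conjI ballI impI)
    fix x x' :: 'a assume *: "dist x' x < min d 1"
    then have n: "\<bar>norm x - norm x'\<bar> < 1"
      using norm_triangle_ineq3[of x x'] by (simp add: dist_norm norm_minus_commute)
    show "dist (f x') (f x) < e"
    proof (cases "norm x \<le> \<rho> + 1 \<and> norm x' \<le> \<rho> + 1")
      case True
      then show ?thesis using d(2)[of x x'] * by simp
    next
      case False
      then have "f x = 0" "f x' = 0" using n by (auto intro!: supp)
      then show ?thesis using e by simp
    qed
  qed (use d in auto)
qed

lemma compact_support_bounded:
  fixes f :: "'a::euclidean_space \<Rightarrow> real"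
  assumes "continuous_on UNIV f" and supp: "\<And>y. \<rho> \<le> norm y \<Longrightarrow> f y = 0"
  obtains C where "0 \<le> C" "\<And>y. \<bar>f y\<bar> \<le> C"
proof -
  have "bounded (f ` cball 0 \<rho>)"
    by (intro compact_imp_bounded compact_continuous_image continuous_on_subset[OF assms(1)]) auto
  then obtain C where C: "\<And>y. norm y \<le> \<rho> \<Longrightarrow> \<bar>f y\<bar> \<le> C"
    by (force simp: bounded_iff)
  have "\<bar>f y\<bar> \<le> max C 0" for y
    using C[of y] supp[of y] by (cases "norm y \<le> \<rho>") auto
  then show thesis using that[of "max C 0"] by auto
qed

lemma integrable_convolution:
  fixes u G :: "'a::euclidean_space \<Rightarrow> real"
  assumes u: "integrable lborel u" and G: "continuous_on UNIV G"
    and supp: "\<And>y. \<rho> \<le> norm y \<Longrightarrow> G y = 0"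
  shows "integrable lborel (\<lambda>z. u z * G (x - z))"
proof -
  obtain C where C: "0 \<le> C" "\<And>y. \<bar>G y\<bar> \<le> C"
    using compact_support_bounded[OF G supp] by blast
  have Gm: "(\<lambda>z. G (x - z)) \<in> borel_measurable lborel"
    by simp (intro borel_measurable_continuous_onI continuous_on_compose2[OF G] continuous_intros; simp)
  show ?thesis
  proof (rule Bochner_Integration.integrable_bound)
    show "integrable lborel (\<lambda>z. C * u z)" using u by simp
    show "(\<lambda>z. u z * G (x - z)) \<in> borel_measurable lborel"
      using u Gm by (intro borel_measurable_times) auto
    show "AE z in lborel. norm (u z * G (x - z)) \<le> norm (C * u z)"
    proof (rule AE_I2)
      fix z
      show "norm (u z * G (x - z)) \<le> norm (C * u z)"
        using mult_right_mono[OF C(2)[of "x - z"], of "\<bar>u z\<bar>"] C(1) by (simp add: abs_mult mult.commute)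
    qed
  qed
qed

lemma continuous_convolution:
  fixes u G :: "'a::euclidean_space \<Rightarrow> real"
  assumes u: "integrable lborel u" and G: "continuous_on UNIV G"
    and supp: "\<And>y. \<rho> \<le> norm y \<Longrightarrow> G y = 0"
  shows "continuous_on UNIV (\<lambda>x. \<integral>z. u z * G (x - z) \<partial>lborel)"
  unfolding continuous_on_iff
proof (intro ballI allI impI)
  fix x :: 'a and e :: real assume e: "0 < e"
  define A where "A = (\<integral>z. \<bar>u z\<bar> \<partial>lborel)"
  have A: "0 \<le> A" by (simp add: A_def)
  have "uniformly_continuous_on UNIV G"
    by (rule compact_support_uniformly_continuous[OF G supp])
  then obtain d where d: "d > 0" "\<And>y y'. dist y' y < d \<Longrightarrow> dist (G y') (G y) < e / (A + 1)"
    using e A unfolding uniformly_continuous_on_def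
    by (metis UNIV_I add_nonneg_pos divide_pos_pos zero_less_one)
  show "\<exists>d>0. \<forall>x'\<in>UNIV. dist x' x < d \<longrightarrow>
      dist (\<integral>z. u z * G (x' - z) \<partial>lborel) (\<integral>z. u z * G (x - z) \<partial>lborel) < e"
  proof (intro exI[of _ d] conjI ballI impI)
    fix x' assume x': "dist x' x < d"
    have i: "integrable lborel (\<lambda>z. u z * G (x - z))" for x
      by (rule integrable_convolution[OF u G supp])
    have "\<bar>(\<integral>z. u z * G (x' - z) \<partial>lborel) - (\<integral>z. u z * G (x - z) \<partial>lborel)\<bar>
        = \<bar>\<integral>z. u z * G (x' - z) - u z * G (x - z) \<partial>lborel\<bar>"
      using i[of x'] i[of x] by simp
    also have "\<dots> \<le> (\<integral>z. \<bar>u z * G (x' - z) - u z * G (x - z)\<bar> \<partial>lborel)"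
      by (rule integral_abs_bound)
    also have "\<dots> \<le> (\<integral>z. (e / (A + 1)) * \<bar>u z\<bar> \<partial>lborel)"
    proof (rule integral_mono)
      fix z
      have "\<bar>G (x' - z) - G (x - z)\<bar> \<le> e / (A + 1)"
        using d(2)[of "x' - z" "x - z"] x' by (simp add: dist_norm)
      then show "\<bar>u z * G (x' - z) - u z * G (x - z)\<bar> \<le> (e / (A + 1)) * \<bar>u z\<bar>"
        by (metis abs_ge_zero abs_mult mult.commute mult_left_mono right_diff_distrib)
    qed (use i[of x'] i[of x] u in auto)
    also have "\<dots> = (e / (A + 1)) * A" by (simp add: A_def)
    also have "\<dots> < e" using e A by (simp add: field_simps)
    finally show "dist (\<integral>z. u z * G (x' - z) \<partial>lborel) (\<integral>z. u z * G (x - z) \<partial>lborel) < e"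
      by (simp add: dist_real_def)
  qed (rule d)
qed

text \<open>Uniform continuity of the compactly supported \<open>g b\<close> makes the first order
  remainder of G small compared with |v|, uniformly in the base point; integrating it against |u|
  preserves this.\<close>

lemma convolution_has_derivative:
  fixes u G :: "'a::euclidean_space \<Rightarrow> real" and g :: "'a \<Rightarrow> 'a \<Rightarrow> real"
  assumes u: "integrable lborel u"
    and der: "\<And>y. (G has_derivative (\<lambda>v. \<Sum>b\<in>Basis. (v \<bullet> b) * g b y)) (at y)"
    and cont: "\<And>b. b \<in> Basis \<Longrightarrow> continuous_on UNIV (g b)"
    and supp: "\<And>y. \<rho> \<le> norm y \<Longrightarrow> G y = 0"
    and supp': "\<And>b y. b \<in> Basis \<Longrightarrow> \<rho> \<le> norm y \<Longrightarrow> g b y = 0"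
  shows "((\<lambda>x. \<integral>z. u z * G (x - z) \<partial>lborel) has_derivative
      (\<lambda>v. \<Sum>b\<in>Basis. (v \<bullet> b) * (\<integral>z. u z * g b (x - z) \<partial>lborel))) (at x)"
  unfolding has_derivative_at_alt
proof (intro conjI allI impI)
  show "bounded_linear (\<lambda>v. \<Sum>b\<in>Basis. (v \<bullet> b) * (\<integral>z. u z * g b (x - z) \<partial>lborel))"
    by (intro bounded_linear_sum bounded_linear_mult_const bounded_linear_inner_left)
  have contG: "continuous_on UNIV G"
    using der has_derivative_continuous continuous_at_imp_continuous_on by blast
  fix e :: real assume e: "0 < e"
  define A where "A = (\<integral>z. \<bar>u z\<bar> \<partial>lborel)"
  have A: "0 \<le> A" by (simp add: A_def)
  \<comment> \<open>The tolerance is shared among the coordinates; A + 1 in place of A covers the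
    case A = 0.\<close>
  define e' where "e' = e / ((A + 1) * DIM('a))"
  have e': "0 < e'" using e A by (simp add: e'_def)
  have "\<exists>d>0. \<forall>y y'. dist y' y < d \<longrightarrow> dist (g b y') (g b y) < e'" if "b \<in> Basis" for b
    using compact_support_uniformly_continuous[OF cont[OF that] supp'[OF that]] e'
    unfolding uniformly_continuous_on_def by auto
  then obtain \<delta> where \<delta>: "\<And>b. b \<in> Basis \<Longrightarrow> \<delta> b > 0"
    "\<And>b y y'. b \<in> Basis \<Longrightarrow> dist y' y < \<delta> b \<Longrightarrow> dist (g b y') (g b y) < e'"
    by metis
  define d where "d = Min (\<delta> ` Basis)"
  have d: "0 < d" "\<And>b. b \<in> Basis \<Longrightarrow> d \<le> \<delta> b"
    using \<delta>(1) by (auto simp: d_def)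
  have rem: "\<bar>G (y + v) - G y - (\<Sum>b\<in>Basis. (v \<bullet> b) * g b y)\<bar> \<le> (DIM('a) * e') * norm v"
    if v: "norm v < d" for y v
  proof -
    \<comment> \<open>Subtracting the linear part frozen at y leaves a function whose derivative is
      small near y, to which the mean value inequality applies.\<close>
    let ?f = "\<lambda>z. G z - (\<Sum>b\<in>Basis. (z \<bullet> b) * g b y)"
    have "norm (?f (y + v) - ?f y) \<le> (DIM('a) * e') * norm (y + v - y)"
    proof (rule differentiable_bound[of "ball y d" ?f "\<lambda>z v. \<Sum>b\<in>Basis. (v \<bullet> b) * (g b z - g b y)"])
      fix z assume z: "z \<in> ball y d"
      have "(?f has_derivative (\<lambda>v. (\<Sum>b\<in>Basis. (v \<bullet> b) * g b z) - (\<Sum>b\<in>Basis. (v \<bullet> b) * g b y))) (at z within ball y d)"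
        by (intro has_derivative_diff has_derivative_at_withinI[OF der] has_derivative_sum
            has_derivative_mult_left has_derivative_inner_left has_derivative_ident)
      then show "(?f has_derivative (\<lambda>v. \<Sum>b\<in>Basis. (v \<bullet> b) * (g b z - g b y))) (at z within ball y d)"
        by (simp add: right_diff_distrib sum_subtractf)
      show "onorm (\<lambda>v. \<Sum>b\<in>Basis. (v \<bullet> b) * (g b z - g b y)) \<le> DIM('a) * e'"
      proof (rule onorm_bound)
        fix v :: 'a
        have "norm (\<Sum>b\<in>Basis. (v \<bullet> b) * (g b z - g b y)) \<le> (\<Sum>b\<in>(Basis :: 'a set). norm v * e')"
        proof (rule sum_norm_le)
          fix b :: 'a assume b: "b \<in> Basis"
          have "\<bar>g b z - g b y\<bar> \<le> e'"
            using \<delta>(2)[OF b, of z y] d(2)[OF b] z by (simp add: dist_real_def dist_commute)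
          then show "norm ((v \<bullet> b) * (g b z - g b y)) \<le> norm v * e'"
            using Basis_le_norm[OF b, of v] by (auto simp: abs_mult intro!: mult_mono)
        qed
        then show "norm (\<Sum>b\<in>Basis. (v \<bullet> b) * (g b z - g b y)) \<le> DIM('a) * e' * norm v"
          by (simp add: algebra_simps)
      qed (use e' in auto)
    qed (use v d in \<open>auto simp: dist_norm\<close>)
    then show ?thesis
      by (simp add: inner_add_left distrib_right sum.distrib algebra_simps)
  qed
  have iG: "integrable lborel (\<lambda>z. u z * G (x - z))" for x
    by (rule integrable_convolution[OF u contG supp])
  have ig: "integrable lborel (\<lambda>z. u z * g b (x - z))" if "b \<in> Basis" for b x
    by (rule integrable_convolution[OF u cont[OF that] supp'[OF that]])
  show "\<exists>d>0. \<forall>y. norm (y - x) < d \<longrightarrow>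
      norm ((\<integral>z. u z * G (y - z) \<partial>lborel) - (\<integral>z. u z * G (x - z) \<partial>lborel) -
        (\<Sum>b\<in>Basis. ((y - x) \<bullet> b) * (\<integral>z. u z * g b (x - z) \<partial>lborel))) \<le> e * norm (y - x)"
  proof (intro exI[of _ d] conjI allI impI d(1))
    fix y assume y: "norm (y - x) < d"
    let ?R = "\<lambda>z. G (y - z) - G (x - z) - (\<Sum>b\<in>Basis. ((y - x) \<bullet> b) * g b (x - z))"
    have "u z * ?R z = u z * G (y - z) - u z * G (x - z) - (\<Sum>b\<in>Basis. ((y - x) \<bullet> b) * (u z * g b (x - z)))" for z
      by (simp add: right_diff_distrib sum_distrib_left ac_simps)
    then have iR: "integrable lborel (\<lambda>z. u z * ?R z)" and
      eqR: "(\<integral>z. u z * ?R z \<partial>lborel) = (\<integral>z. u z * G (y - z) \<partial>lborel) - (\<integral>z. u z * G (x - z) \<partial>lborel) -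
        (\<Sum>b\<in>Basis. ((y - x) \<bullet> b) * (\<integral>z. u z * g b (x - z) \<partial>lborel))"
      using iG[of x] iG[of y] ig[where x = x] by (auto simp: Bochner_Integration.integral_sum)
    have "\<bar>\<integral>z. u z * ?R z \<partial>lborel\<bar> \<le> (\<integral>z. (DIM('a) * e' * norm (y - x)) * \<bar>u z\<bar> \<partial>lborel)"
    proof (rule order_trans[OF integral_abs_bound], rule integral_mono)
      fix z
      have "\<bar>?R z\<bar> \<le> DIM('a) * e' * norm (y - x)"
        using rem[OF y, of "x - z"] by (simp add: algebra_simps)
      then show "\<bar>u z * ?R z\<bar> \<le> (DIM('a) * e' * norm (y - x)) * \<bar>u z\<bar>"
        unfolding abs_mult[of "u z"] mult.commute[of "\<bar>u z\<bar>"] by (rule mult_right_mono) simp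
    next
      show "integrable lborel (\<lambda>z. \<bar>u z * ?R z\<bar>)"
        by (rule integrable_abs[OF iR])
      show "integrable lborel (\<lambda>z. (DIM('a) * e' * norm (y - x)) * \<bar>u z\<bar>)"
        using u by (intro integrable_mult_right integrable_abs)
    qed
    also have "(\<integral>z. (DIM('a) * e' * norm (y - x)) * \<bar>u z\<bar> \<partial>lborel) = DIM('a) * e' * A * norm (y - x)"
      by (simp add: A_def)
    also have "DIM('a) * e' = e / (A + 1)"
      by (simp add: e'_def)
    also have "e / (A + 1) * A * norm (y - x) \<le> e * norm (y - x)"
      using e A by (intro mult_right_mono) (simp_all add: field_simps)
    finally have "\<bar>\<integral>z. u z * ?R z \<partial>lborel\<bar> \<le> e * norm (y - x)" .
    with eqR show "norm ((\<integral>z. u z * G (y - z) \<partial>lborel) - (\<integral>z. u z * G (x - z) \<partial>lborel) -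
        (\<Sum>b\<in>Basis. ((y - x) \<bullet> b) * (\<integral>z. u z * g b (x - z) \<partial>lborel))) \<le> e * norm (y - x)"
      by simp
  qed
qed

lemma scaled_bump_has_derivative:
  assumes "k \<ge> 1"
  shows "((\<lambda>y. bump (Suc k) (y /\<^sub>R r)) has_derivative
    (\<lambda>v. - (2 * real (Suc k) / r\<^sup>2) * (y \<bullet> v) * bump k (y /\<^sub>R r))) (at y)"
proof -
  have "((\<lambda>y. y /\<^sub>R r) has_derivative (\<lambda>v. v /\<^sub>R r)) (at y)"
    by (auto intro!: derivative_eq_intros)
  from has_derivative_compose[OF this bump_has_derivative[OF assms]]
  show ?thesis
    by (rule has_derivative_eq_rhs) (simp add: fun_eq_iff power2_eq_square divide_inverse algebra_simps)
qed

text \<open>The exponent 3 is the least one for which the kernel is twice continuously differentiable.\<close>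

lemma mollifier_convolution_C2:
  fixes u :: "'a::euclidean_space \<Rightarrow> real"
  assumes u: "integrable lborel u" and r: "0 < r"
  shows "C2_on UNIV (\<lambda>x. \<integral>z. u z * mollifier 3 r (x - z) \<partial>lborel)"
proof -
  define N where "N = r ^ DIM('a) * (\<integral>y. bump 3 y \<partial>(lborel :: 'a measure))"
  \<comment> \<open>\<open>g\<close> and \<open>g2\<close> are the first and second partial
    derivatives of the kernel, read off from \<open>scaled_bump_has_derivative\<close>: the factors
    are 6 = 2 * 3 and 4 = 2 * 2, and each time a bump is differentiated the scaling contributes 1 /
    r^2.\<close>
  define g where "g b y = - (6 / (r\<^sup>2 * N)) * (y \<bullet> b) * bump 2 (y /\<^sub>R r)" for b y :: 'a
  define g2 where "g2 b c y = - (6 / (r\<^sup>2 * N)) *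
    ((c \<bullet> b) * bump 2 (y /\<^sub>R r) - (4 / r\<^sup>2) * (y \<bullet> b) * (y \<bullet> c) * bump 1 (y /\<^sub>R r))" for b c y :: 'a
  have out: "bump k (y /\<^sub>R r) = 0" if "k \<ge> 1" "r \<le> norm y" for k and y :: 'a
    using that r by (intro bump_eq_0) (auto simp: field_simps)
  have eucl: "y \<bullet> v = (\<Sum>b\<in>Basis. (v \<bullet> b) * (y \<bullet> b))" for y v :: 'a
    by (subst euclidean_inner) (simp add: mult.commute)
  have d1: "(mollifier 3 r has_derivative (\<lambda>v. \<Sum>b\<in>Basis. (v \<bullet> b) * g b y)) (at y)" for y
  proof -
    from has_derivative_mult_left[OF scaled_bump_has_derivative[of 2 r y], of "1 / N"]
    have "((\<lambda>y. bump 3 (y /\<^sub>R r) / N) has_derivative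
        (\<lambda>v. (- (6 / r\<^sup>2) * (y \<bullet> v) * bump 2 (y /\<^sub>R r)) / N)) (at y)" by simp
    then show ?thesis
      unfolding mollifier_def[abs_def] N_def[symmetric]
    proof (rule has_derivative_eq_rhs, intro ext)
      fix v
      have "(\<Sum>b\<in>Basis. (v \<bullet> b) * g b y) = (- (6 / r\<^sup>2) * (\<Sum>b\<in>Basis. (v \<bullet> b) * (y \<bullet> b)) * bump 2 (y /\<^sub>R r)) / N"
        by (simp add: g_def sum_distrib_left sum_distrib_right sum_divide_distrib sum_negf ac_simps)
      then show "(- (6 / r\<^sup>2) * (y \<bullet> v) * bump 2 (y /\<^sub>R r)) / N = (\<Sum>b\<in>Basis. (v \<bullet> b) * g b y)"
        by (simp only: eucl[of y v])
    qed
  qed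
  have d2: "(g b has_derivative (\<lambda>v. \<Sum>c\<in>Basis. (v \<bullet> c) * g2 b c y)) (at y)" for b y
  proof -
    have "((\<lambda>y. bump 2 (y /\<^sub>R r)) has_derivative (\<lambda>v. - (4 / r\<^sup>2) * (y \<bullet> v) * bump 1 (y /\<^sub>R r))) (at y)"
      using scaled_bump_has_derivative[of 1 r y] unfolding Suc_1 by simp
    from has_derivative_mult[OF has_derivative_inner_left[OF has_derivative_ident, of b] this]
    have "((\<lambda>y. (y \<bullet> b) * bump 2 (y /\<^sub>R r)) has_derivative
        (\<lambda>v. (y \<bullet> b) * (- (4 / r\<^sup>2) * (y \<bullet> v) * bump 1 (y /\<^sub>R r)) + (v \<bullet> b) * bump 2 (y /\<^sub>R r))) (at y)" .
    from has_derivative_mult_right[OF this, of "- (6 / (r\<^sup>2 * N))"]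
    have "(g b has_derivative (\<lambda>v. - (6 / (r\<^sup>2 * N)) * ((y \<bullet> b) * (- (4 / r\<^sup>2) * (y \<bullet> v) * bump 1 (y /\<^sub>R r))
        + (v \<bullet> b) * bump 2 (y /\<^sub>R r)))) (at y)"
      unfolding g_def[abs_def] by (simp only: mult.assoc)
    then show ?thesis
    proof (rule has_derivative_eq_rhs, intro ext)
      fix v
      let ?K = "- (6 / (r\<^sup>2 * N))"
      have "(\<Sum>c\<in>Basis. (v \<bullet> c) * g2 b c y) =
          (\<Sum>c\<in>Basis. ?K * bump 2 (y /\<^sub>R r) * ((v \<bullet> c) * (b \<bullet> c))
            - ?K * (4 / r\<^sup>2) * (y \<bullet> b) * bump 1 (y /\<^sub>R r) * ((v \<bullet> c) * (y \<bullet> c)))"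
        unfolding g2_def inner_commute[of _ b] by (intro sum.cong refl) (simp only: right_diff_distrib ac_simps)
      also have "\<dots> = ?K * bump 2 (y /\<^sub>R r) * (b \<bullet> v) - ?K * (4 / r\<^sup>2) * (y \<bullet> b) * bump 1 (y /\<^sub>R r) * (y \<bullet> v)"
        unfolding sum_subtractf sum_distrib_left[symmetric] eucl[symmetric] ..
      finally show "?K * ((y \<bullet> b) * (- (4 / r\<^sup>2) * (y \<bullet> v) * bump 1 (y /\<^sub>R r)) + (v \<bullet> b) * bump 2 (y /\<^sub>R r))
          = (\<Sum>c\<in>Basis. (v \<bullet> c) * g2 b c y)"
        by (simp add: algebra_simps inner_commute[of v b])
    qed
  qed
  have cm: "continuous_on UNIV (mollifier 3 r :: 'a \<Rightarrow> real)"
    by (intro continuous_intros)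
  have cg: "continuous_on UNIV (g b)" for b
    unfolding g_def[abs_def] by (intro continuous_intros)
  have cg2: "continuous_on UNIV (g2 b c)" for b c
    unfolding g2_def[abs_def] by (intro continuous_intros)
  have D1: "((\<lambda>x. \<integral>z. u z * mollifier 3 r (x - z) \<partial>lborel) has_derivative
      (\<lambda>v. \<Sum>b\<in>Basis. (v \<bullet> b) * (\<integral>z. u z * g b (x - z) \<partial>lborel))) (at x)" for x
    by (rule convolution_has_derivative[OF u d1 cg, of r]) (use r out in \<open>auto simp: mollifier_eq_0 g_def\<close>)
  have D2: "((\<lambda>x. \<integral>z. u z * g b (x - z) \<partial>lborel) has_derivative
      (\<lambda>v. \<Sum>c\<in>Basis. (v \<bullet> c) * (\<integral>z. u z * g2 b c (x - z) \<partial>lborel))) (at x)" for b x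
    by (rule convolution_has_derivative[OF u d2 cg2, of r]) (use r out in \<open>auto simp: g_def g2_def\<close>)
  have sum_Basis: "(\<Sum>c\<in>Basis. (b \<bullet> c) * f c) = f b" if "b \<in> Basis" for b :: 'a and f :: "'a \<Rightarrow> real"
  proof -
    have "(\<Sum>c\<in>Basis. (b \<bullet> c) * f c) = (\<Sum>c\<in>Basis. if c = b then f c else 0)"
      using that by (intro sum.cong) (auto simp: inner_Basis)
    then show ?thesis using that by simp
  qed
  have p1: "partial b (\<lambda>x. \<integral>z. u z * mollifier 3 r (x - z) \<partial>lborel) = (\<lambda>x. \<integral>z. u z * g b (x - z) \<partial>lborel)"
    if "b \<in> Basis" for b
    using partial_eqI[OF D1] sum_Basis[OF that] by (simp add: fun_eq_iff)
  have p2: "partial c (\<lambda>x. \<integral>z. u z * g b (x - z) \<partial>lborel) = (\<lambda>x. \<integral>z. u z * g2 b c (x - z) \<partial>lborel)"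
    if "c \<in> Basis" for b c
    using partial_eqI[OF D2] sum_Basis[OF that] by (simp add: fun_eq_iff)
  have "continuous_on UNIV (\<lambda>x. \<integral>z. u z * g2 b c (x - z) \<partial>lborel)" for b c
    by (rule continuous_convolution[OF u cg2, of r]) (use out in \<open>auto simp: g2_def\<close>)
  moreover have "(\<lambda>x. \<integral>z. u z * mollifier 3 r (x - z) \<partial>lborel) differentiable (at x)"
    "(\<lambda>x. \<integral>z. u z * g b (x - z) \<partial>lborel) differentiable (at x)" for b x
    using D1 D2 unfolding differentiable_def by blast+
  ultimately show ?thesis
    unfolding C2_on_def by (simp add: p1 p2)
qed

section \<open>Harmonicity from the mean value property\<close>

text \<open>Partial derivatives depend only on the values near a point. This is needed because the
  radius of mollification in the next lemma varies from point to point.\<close>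

lemma C2_on_local:
  assumes "open D" and loc: "\<And>x. x \<in> D \<Longrightarrow> \<exists>S U. open S \<and> x \<in> S \<and> C2_on S U \<and> (\<forall>y\<in>S. u y = U y)"
  shows "C2_on D u"
proof -
  have "u differentiable (at x) \<and> (\<forall>b\<in>Basis. partial b u differentiable (at x)) \<and>
      (\<forall>b\<in>Basis. \<forall>c\<in>Basis. isCont (partial c (partial b u)) x)" if x: "x \<in> D" for x
  proof -
    obtain S U where S: "open S" "x \<in> S" "C2_on S U" "\<And>y. y \<in> S \<Longrightarrow> u y = U y"
      using loc[OF x] by blast
    have tr: "f differentiable (at y)" "partial b f y = partial b F y"
      if "y \<in> S" "F differentiable (at y)" "\<And>y. y \<in> S \<Longrightarrow> f y = F y" for y f F b
    proof -
      have "(F has_derivative frechet_derivative F (at y)) (at y)"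
        using that frechet_derivative_works by blast
      then have "(f has_derivative frechet_derivative F (at y)) (at y)"
        by (rule has_derivative_transform_within_open[OF _ S(1) that(1)]) (use that in auto)
      then show "f differentiable (at y)" "partial b f y = partial b F y"
        using partial_eqI by (auto simp: differentiable_def partial_def)
    qed
    have 1: "U differentiable (at y)" if "y \<in> S" for y
      using S(3) that by (auto simp: C2_on_def)
    have 2: "partial b U differentiable (at y)" if "y \<in> S" "b \<in> Basis" for y b
      using S(3) that by (auto simp: C2_on_def)
    have p1: "partial b u y = partial b U y" if "y \<in> S" for y b
      using tr(2)[OF that 1[OF that] S(4)] by simp
    have p2: "partial c (partial b u) y = partial c (partial b U) y" if "y \<in> S" "b \<in> Basis" for y b c
      using tr(2)[OF that(1) 2[OF that] p1] by simp
    have "isCont (partial c (partial b u)) x" if bc: "b \<in> Basis" "c \<in> Basis" for b c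
    proof -
      have "continuous_on S (partial c (partial b U))"
        using S(3) bc by (auto simp: C2_on_def)
      then have "continuous_on S (partial c (partial b u))"
        by (rule continuous_on_eq) (simp add: p2 bc)
      then show ?thesis using S(1,2) by (simp add: continuous_on_eq_continuous_at)
    qed
    then show ?thesis
      using tr(1)[OF S(2) 1 S(4)] tr(1)[OF S(2) 2 p1] S(2) by auto
  qed
  then show ?thesis
    unfolding C2_on_def by (auto intro!: continuous_at_imp_continuous_on)
qed

text \<open>A function equal to its own mollifications is locally a convolution, hence C2. Its bump
  means are constant in the radius, so the bump means of its Laplacian vanish, and shrinking the
  radius isolates the Laplacian at x.\<close>

lemma mollifier_mean_imp_harmonic:
  fixes u :: "'a::euclidean_space \<Rightarrow> real"
  assumes D: "open D" and um: "u \<in> borel_measurable borel"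
    and bd: "\<And>x. x \<in> D \<Longrightarrow> \<exists>r>0. \<exists>C. \<forall>z\<in>cball x r. \<bar>u z\<bar> \<le> C"
    and mean: "\<And>x r R. 0 < r \<Longrightarrow> r < R \<Longrightarrow> cball x R \<subseteq> D \<Longrightarrow> u x = (\<integral>z. u z * mollifier 3 r (z - x) \<partial>lborel)"
  shows "harmonic_on D u"
proof -
  have C2: "C2_on D u"
  proof (rule C2_on_local[OF D])
    fix x assume x: "x \<in> D"
    obtain r1 C where r1: "0 < r1" "\<And>z. z \<in> cball x r1 \<Longrightarrow> \<bar>u z\<bar> \<le> C"
      using bd[OF x] by blast
    obtain r2 where r2: "0 < r2" "cball x r2 \<subseteq> D"
      using D x open_contains_cball by blast
    \<comment> \<open>For y in \<open>ball x r\<close> the ball of radius 2 * r around y lies in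
      \<open>cball x r2\<close>, so \<open>mean\<close> applies, and the kernel centred at y is
      supported in \<open>cball x r1\<close>.\<close>
    define r where "r = min r1 r2 / 4"
    have r: "0 < r" "4 * r \<le> r1" "4 * r \<le> r2"
      using r1 r2 by (auto simp: r_def)
    \<comment> \<open>The cut-off makes u integrable and is invisible to the convolution near
      x.\<close>
    define u0 where "u0 z = u z * indicator (cball x r1) z" for z
    have "integrable lborel u0"
    proof (rule Bochner_Integration.integrable_bound)
      show "integrable lborel (\<lambda>z. C * indicator (cball x r1) z)"
        by (rule integrable_mult_right[OF integrable_indicator_cball])
      show "u0 \<in> borel_measurable lborel"
        unfolding u0_def using um borel_closed[OF closed_cball, of x r1] by measurable
      show "AE z in lborel. norm (u0 z) \<le> norm (C * indicator (cball x r1) z)"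
        using r1 by (intro AE_I2) (force simp: u0_def indicator_def)
    qed
    then have "C2_on UNIV (\<lambda>y. \<integral>z. u0 z * mollifier 3 r (y - z) \<partial>lborel)"
      using r by (intro mollifier_convolution_C2)
    then have "C2_on (ball x r) (\<lambda>y. \<integral>z. u0 z * mollifier 3 r (y - z) \<partial>lborel)"
      unfolding C2_on_def using continuous_on_subset[OF _ subset_UNIV] by blast
    moreover have "u y = (\<integral>z. u0 z * mollifier 3 r (y - z) \<partial>lborel)" if y: "y \<in> ball x r" for y
    proof -
      have "cball y (2 * r) \<subseteq> D"
      proof
        fix z assume "z \<in> cball y (2 * r)"
        then have "dist x z \<le> r2"
          using dist_triangle[of x z y] y r by simp
        then show "z \<in> D" using r2 by auto
      qed
      then have "u y = (\<integral>z. u z * mollifier 3 r (z - y) \<partial>lborel)"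
        using r by (intro mean[of r "2 * r"]) auto
      also have "\<dots> = (\<integral>z. u0 z * mollifier 3 r (y - z) \<partial>lborel)"
      proof (rule Bochner_Integration.integral_cong[OF refl])
        fix z
        have "mollifier 3 r (z - y) = mollifier 3 r (y - z)"
          using mollifier_uminus[of 3 r "y - z"] by simp
        moreover have "mollifier 3 r (y - z) = 0" if "z \<notin> cball x r1"
        proof -
          have "r \<le> norm (y - z)"
            using that y r dist_triangle[of x z y] by (simp add: dist_norm)
          then show ?thesis using r by (simp add: mollifier_eq_0)
        qed
        ultimately show "u z * mollifier 3 r (z - y) = u0 z * mollifier 3 r (y - z)"
          by (auto simp: u0_def indicator_def)
      qed
      finally show ?thesis .
    qed
    ultimately show "\<exists>S U. open S \<and> x \<in> S \<and> C2_on S U \<and> (\<forall>y\<in>S. u y = U y)"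
      using r by (intro exI[of _ "ball x r"] exI[of _ "\<lambda>y. \<integral>z. u0 z * mollifier 3 r (y - z) \<partial>lborel"]) auto
  qed
  have "laplacian u x = 0" if x: "x \<in> D" for x
  proof -
    obtain R where R: "0 < R" "cball x R \<subseteq> D"
      using D x open_contains_cball by blast
    let ?m = "\<lambda>r. \<integral>y. u (x + r *\<^sub>R y) * bump 3 y \<partial>lborel"
    \<comment> \<open>The exponent is 4 because \<open>deriv_bump_mean\<close> raises the exponent 3
      of the mollifier by one.\<close>
    let ?J = "\<lambda>r. \<integral>y. laplacian u (x + r *\<^sub>R y) * bump 4 y \<partial>lborel"
    have m: "?m r = u x * (\<integral>y. bump 3 y \<partial>(lborel :: 'a measure))" if "0 < r" "r < R" for r
      using mean[OF that R(2)] integral_mollifier[OF um that(1), of 3 x]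
        bump_integral_pos[of 3, where ?'a = 'a] by (simp add: field_simps)
    have J0: "?J r = 0" if r: "0 < r" "r < R" for r
    proof -
      have "(?m has_real_derivative 0) (at r)"
      proof (rule has_field_derivative_transform_within_open)
        show "((\<lambda>_. u x * (\<integral>y. bump 3 y \<partial>(lborel :: 'a measure))) has_real_derivative 0) (at r)"
          by simp
        show "open {0<..<R}" "r \<in> {0<..<R}" using r by auto
      qed (use m in auto)
      then have "r / (2 * real (Suc 3)) * ?J r = 0"
        using deriv_bump_mean[OF D C2 R(2) r, of 3] DERIV_unique by fastforce
      then show ?thesis using r by simp
    qed
    have "continuous_on {0..R} ?J"
      using R by (intro continuous_on_bump_mean continuous_on_subset[OF C2_on_continuous(4)[OF C2]]) auto
    then have "(?J \<longlongrightarrow> ?J 0) (at 0 within {0..R})"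
      using R by (simp only: continuous_on) (drule bspec[of _ _ 0]; simp)
    \<comment> \<open>\<open>?J\<close> is known to vanish for positive radii only; at 0 it is the
      Laplacian at x times the mass of the bump.\<close>
    then have "(?J \<longlongrightarrow> ?J 0) (at 0 within {0<..<R})"
      by (rule tendsto_within_subset) auto
    moreover have "(?J \<longlongrightarrow> 0) (at 0 within {0<..<R})"
      by (rule tendsto_eventually) (use J0 in \<open>auto simp: eventually_at_filter\<close>)
    moreover have "at 0 within {0<..<R} \<noteq> bot"
      using R by (simp add: trivial_limit_within islimpt_greaterThanLessThan1)
    ultimately have "?J 0 = 0"
      using tendsto_unique by blast
    then show ?thesis
      using bump_integral_pos[of 4, where ?'a = 'a] by simp
  qed
  then show ?thesis using C2 by (simp add: harmonic_on_iff)
qed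

section \<open>Minimum principle and uniqueness\<close>

lemma superharmonic_on_add:
  assumes "superharmonic_on D u" "superharmonic_on D v"
  shows "superharmonic_on D (\<lambda>x. u x + v x)"
  unfolding superharmonic_on_def
proof (intro conjI ballI allI impI)
  fix x c assume x: "x \<in> D" and c: "c < u x + v x"
  define e where "e = (u x + v x - c) / 2"
  have e: "0 < e" using c by (simp add: e_def)
  have "\<forall>\<^sub>F y in at x within D. u x - e < u y" "\<forall>\<^sub>F y in at x within D. v x - e < v y"
    using assms x e by (auto simp: superharmonic_on_def)
  then show "\<forall>\<^sub>F y in at x within D. c < u y + v y"
    by eventually_elim (simp add: e_def field_simps)
next
  fix x r assume "0 < r \<and> cball x r \<subseteq> D"
  then have i: "set_integrable lborel (cball x r) u" "set_integrable lborel (cball x r) v"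
    and m: "(\<integral>y\<in>cball x r. u y \<partial>lborel) / measure lborel (cball x r) \<le> u x"
      "(\<integral>y\<in>cball x r. v y \<partial>lborel) / measure lborel (cball x r) \<le> v x"
    using assms by (auto simp: superharmonic_on_def)
  show "set_integrable lborel (cball x r) (\<lambda>x. u x + v x)"
    using i by (rule set_integral_add)
  show "(\<integral>y\<in>cball x r. u y + v y \<partial>lborel) / measure lborel (cball x r) \<le> u x + v x"
    using i m by (simp add: set_integral_add add_divide_distrib)
qed

lemma superharmonic_on_cmult:
  fixes a :: real
  assumes "superharmonic_on D u" "0 < a"
  shows "superharmonic_on D (\<lambda>x. a * u x)"
  unfolding superharmonic_on_def
proof (intro conjI ballI allI impI)
  fix x c assume x: "x \<in> D" and c: "c < a * u x"
  have "c / a < u x" using c assms(2) by (simp add: field_simps)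
  then have "\<forall>\<^sub>F y in at x within D. c / a < u y"
    using assms x by (auto simp: superharmonic_on_def)
  then show "\<forall>\<^sub>F y in at x within D. c < a * u y"
    by eventually_elim (use assms(2) in \<open>simp add: field_simps\<close>)
next
  fix x r assume "0 < r \<and> cball x r \<subseteq> D"
  then have i: "set_integrable lborel (cball x r) u"
    and m: "(\<integral>y\<in>cball x r. u y \<partial>lborel) / measure lborel (cball x r) \<le> u x"
    using assms by (auto simp: superharmonic_on_def)
  show "set_integrable lborel (cball x r) (\<lambda>x. a * u x)"
    using i by simp
  show "(\<integral>y\<in>cball x r. a * u y \<partial>lborel) / measure lborel (cball x r) \<le> a * u x"
    using mult_left_mono[OF m, of a] assms(2) by simp
qed

lemma measure_cball_pos: "0 < r \<Longrightarrow> 0 < measure lborel (cball (x::'a::euclidean_space) r)"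
  using content_cball_pos[of r x] by (simp add: measure_completion)

text \<open>Both signs are needed, since the comparison function below contains \<open>h1\<close>
  and \<open>- h2\<close>.\<close>

lemma harmonic_imp_superharmonic:
  assumes D: "open D" "harmonic_on D h"
  shows "superharmonic_on D h" and "superharmonic_on D (\<lambda>x. - h x)"
proof -
  have c: "continuous_on D h"
    using D by (auto simp: harmonic_on_iff intro: C2_on_continuous)
  then have c': "continuous_on D (\<lambda>x. - h x)" by (intro continuous_intros)
  show "superharmonic_on D h"
    unfolding superharmonic_on_def
  proof (intro conjI ballI allI impI)
    fix x c assume "x \<in> D" "c < h x"
    then show "\<forall>\<^sub>F y in at x within D. c < h y"
      using c by (auto simp: continuous_on intro: order_tendstoD)
  next
    fix x r assume "0 < r \<and> cball x r \<subseteq> D"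
    then show "set_integrable lborel (cball x r) h"
      "(\<integral>y\<in>cball x r. h y \<partial>lborel) / measure lborel (cball x r) \<le> h x"
      using harmonic_ball_mean[OF D, of x r] measure_cball_pos[of r x] by simp_all
  qed
  show "superharmonic_on D (\<lambda>x. - h x)"
    unfolding superharmonic_on_def
  proof (intro conjI ballI allI impI)
    fix x c assume x: "x \<in> D" and "c < - h x"
    from c' x have "((\<lambda>x. - h x) \<longlongrightarrow> - h x) (at x within D)"
      unfolding continuous_on by (rule bspec)
    then show "\<forall>\<^sub>F y in at x within D. c < - h y"
      using \<open>c < - h x\<close> by (rule order_tendstoD(1))
  next
    fix x r assume "0 < r \<and> cball x r \<subseteq> D"
    then show "set_integrable lborel (cball x r) (\<lambda>x. - h x)"
      "(\<integral>y\<in>cball x r. - h y \<partial>lborel) / measure lborel (cball x r) \<le> - h x"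
      using harmonic_ball_mean[OF D, of x r] measure_cball_pos[of r x]
      by (simp_all add: set_integrable_def set_lebesgue_integral_def)
  qed
qed

text \<open>A negative minimum would be attained on a nonempty compact set, which the mean value
  inequality forces to be open as well.\<close>

lemma superharmonic_minimum_principle:
  fixes u :: "'a::euclidean_space \<Rightarrow> real"
  assumes D: "open D" "bounded D" and u: "superharmonic_on D u"
    and bdry: "\<And>y e. y \<in> frontier D \<Longrightarrow> 0 < e \<Longrightarrow> \<forall>\<^sub>F x in at y within D. - e < u x"
    and x: "x \<in> D"
  shows "0 \<le> u x"
proof (rule ccontr)
  assume "\<not> 0 \<le> u x"
  then have neg: "u x < 0" by simp
  \<comment> \<open>For t < 0 the boundary condition keeps this sublevel set away from the frontier
    and lower semicontinuity closes it inside D, so it is compact.\<close>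
  define C where "C t = {z \<in> D. u z \<le> t}" for t
  have compC: "compact (C t)" if t: "t < 0" for t
  proof -
    have "closed (C t)"
      unfolding closed_sequential_limits
    proof (intro allI impI)
      fix z l assume zl: "(\<forall>n. z n \<in> C t) \<and> z \<longlonglongrightarrow> l"
      then have lD: "l \<in> closure D"
        by (auto simp: closure_sequential C_def intro!: exI[of _ z])
      \<comment> \<open>The filter \<open>at l within D\<close> is punctured, so a sequence that
        hits l needs the property at l itself.\<close>
      have ev: "\<exists>n. P (z n)" if "\<forall>\<^sub>F x in at l within D. P x" "l \<in> D \<Longrightarrow> P l" for P
      proof (cases "\<exists>n. z n = l")
        case True
        then show ?thesis using that(2) zl by (auto simp: C_def)
      next
        case False
        then have "filterlim z (at l within D) sequentially"
          using zl by (auto simp: filterlim_at C_def)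
        then have "\<forall>\<^sub>F n in sequentially. P (z n)"
          using that(1) by (auto simp: filterlim_iff)
        then show ?thesis
          by (meson eventually_happens' sequentially_bot)
      qed
      show "l \<in> C t"
      proof (cases "l \<in> D")
        case True
        have "\<not> t < u l"
        proof
          assume "t < u l"
          then have "\<forall>\<^sub>F y in at l within D. t < u y"
            using u True by (auto simp: superharmonic_on_def)
          then obtain n where "t < u (z n)" using \<open>t < u l\<close> ev[of "\<lambda>w. t < u w"] by auto
          moreover have "u (z n) \<le> t" using zl by (auto simp: C_def)
          ultimately show False by simp
        qed
        then show ?thesis using True by (simp add: C_def)
      next
        case False
        then have "l \<in> frontier D"
          using lD D(1) by (simp add: frontier_def interior_open)
        from bdry[OF this, of "- t"] t have "\<forall>\<^sub>F y in at l within D. t < u y" by simp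
        then obtain n where "t < u (z n)" using False ev[of "\<lambda>w. t < u w"] by auto
        moreover have "u (z n) \<le> t" using zl by (auto simp: C_def)
        ultimately show ?thesis by simp
      qed
    qed
    moreover have "bounded (C t)" by (rule bounded_subset[OF D(2)]) (auto simp: C_def)
    ultimately show ?thesis by (simp add: compact_eq_bounded_closed)
  qed
  \<comment> \<open>The sublevel sets at the values of u are nested; the finite intersection
    property supplies a point below all these values, that is, a minimum.\<close>
  have "C (u x) \<inter> (\<Inter>t\<in>u ` C (u x). C t) \<noteq> {}"
  proof (rule compact_imp_fip_image)
    show "compact (C (u x))" by (rule compC[OF neg])
    fix t assume "t \<in> u ` C (u x)"
    then have "t < 0" using neg by (auto simp: C_def)
    then show "closed (C t)" by (intro compact_imp_closed compC)
  next
    fix I assume I: "finite I" "I \<subseteq> u ` C (u x)"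
    show "C (u x) \<inter> (\<Inter>t\<in>I. C t) \<noteq> {}"
    proof (cases "I = {}")
      case True
      then show ?thesis using x by (auto simp: C_def)
    next
      case False
      then have "Min I \<in> u ` C (u x)" using Min_in[OF I(1) False] I(2) by blast
      then obtain z where z: "z \<in> C (u x)" "u z = Min I" by auto
      then have "z \<in> C t" if "t \<in> I" for t using I that by (auto simp: C_def)
      then show ?thesis using z by auto
    qed
  qed
  then obtain p where p: "p \<in> C (u x)" "\<And>z. z \<in> C (u x) \<Longrightarrow> p \<in> C (u z)" by auto
  define m where "m = u p"
  have pD: "p \<in> D" and m0: "m < 0" using p(1) neg by (auto simp: C_def m_def)
  have min: "m \<le> u z" if "z \<in> D" for z
    using p(1) p(2)[of z] that by (cases "u z \<le> u x") (simp_all add: C_def m_def)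
  have "open (C m)"
    unfolding open_contains_ball
  proof
    fix z assume z: "z \<in> C m"
    then have zD: "z \<in> D" and uz: "u z = m" using min[of z] by (simp_all add: C_def)
    obtain r where r: "0 < r" "cball z r \<subseteq> D"
      using D zD open_contains_cball by blast
    have i: "set_integrable lborel (cball z r) u"
      and mean: "(\<integral>y\<in>cball z r. u y \<partial>lborel) / measure lborel (cball z r) \<le> m"
      using u r uz by (auto simp: superharmonic_on_def)
    \<comment> \<open>Nonnegative by minimality, with integral at most 0 by the mean value
      inequality, hence 0 almost everywhere. A point of the open ball with a larger value would, by
      lower semicontinuity, have a whole neighbourhood of them.\<close>
    let ?f = "\<lambda>y. indicator (cball z r) y *\<^sub>R u y - m * indicator (cball z r) y"
    have fi: "integrable lborel ?f"
      using i unfolding set_integrable_def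
      by (intro Bochner_Integration.integrable_diff integrable_mult_right integrable_indicator_cball)
    have fn: "0 \<le> ?f y" for y
      using min[of y] r by (auto simp: indicator_def subset_iff)
    have "(\<integral>y. ?f y \<partial>lborel) = (\<integral>y\<in>cball z r. u y \<partial>lborel) - m * measure lborel (cball z r)"
      using i integrable_indicator_cball[of z r]
      by (simp add: set_integrable_def set_lebesgue_integral_def)
    also have "\<dots> \<le> 0"
      using mean measure_cball_pos[OF r(1), of z] by (simp add: field_simps)
    finally have "(\<integral>y. ?f y \<partial>lborel) = 0"
      by (intro antisym Bochner_Integration.integral_nonneg fn)
    then have ae: "AE y in lborel. ?f y = 0"
      using integral_nonneg_eq_0_iff_AE[OF fi] fn by auto
    have "u y = m" if y: "y \<in> ball z r" for y
    proof (rule ccontr)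
      assume ne: "u y \<noteq> m"
      have yD: "y \<in> D" using y r by auto
      then have "m < u y" using ne min[OF yD] by simp
      then have "\<forall>\<^sub>F w in at y within D. m < u w"
        using u yD by (auto simp: superharmonic_on_def)
      then have "\<forall>\<^sub>F w in nhds y. w \<in> D \<longrightarrow> m < u w"
        unfolding eventually_at_filter by (rule eventually_mono) (use \<open>m < u y\<close> in auto)
      then obtain S where S: "open S" "y \<in> S" "\<And>w. w \<in> S \<Longrightarrow> w \<in> D \<Longrightarrow> m < u w"
        unfolding eventually_nhds by blast
      define V where "V = S \<inter> ball z r"
      have V: "open V" "y \<in> V" using S y by (auto simp: V_def)
      from ae have "AE w in lborel. w \<notin> V"
      proof eventually_elim
        case (elim w)
        have "w \<in> D" "m < u w" "w \<in> cball z r" if "w \<in> V"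
        proof -
          show "w \<in> cball z r" using that by (simp add: V_def)
          then show "w \<in> D" using r(2) by (rule subsetD[rotated])
          then show "m < u w" using that S(3)[of w] by (simp add: V_def)
        qed
        then show ?case using elim by auto
      qed
      then have "V \<in> null_sets lborel"
        using V by (subst (asm) AE_iff_null_sets[symmetric]) auto
      then show False
        using open_not_negligible[of V] V
        by (auto simp: negligible_iff_null_sets null_sets_completionI)
    qed
    then have "ball z r \<subseteq> C m" using r by (auto simp: C_def)
    then show "\<exists>e>0. ball z e \<subseteq> C m" using r by blast
  qed
  moreover have "compact (C m)" by (rule compC[OF m0])
  moreover have "p \<in> C m" using pD by (simp add: C_def m_def)
  \<comment> \<open>A nonempty clopen set is the whole space, which is not bounded.\<close>
  ultimately have "C m = UNIV"
    using clopen[of "C m"] compact_imp_closed by auto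
  then have "bounded (UNIV :: 'a set)"
    using \<open>compact (C m)\<close> compact_imp_bounded by metis
  then show False by simp
qed

section \<open>Controlled convergence along sequences\<close>

text \<open>The set A of the definition is taken to be the range of the sequence. Since y is outside
  D, the sequence never meets y and limits along \<open>at y within range s\<close> pull back to
  s.\<close>

lemma controlled_sequence:
  assumes cc: "controlled_convergence D f h k" and y: "y \<in> frontier D" "open D"
    and s: "\<And>n. s n \<in> D" "s \<longlonglongrightarrow> y"
  shows "(\<exists>B. \<forall>n. k (s n) \<le> B) \<Longrightarrow> \<bar>f y\<bar> \<noteq> \<infinity> \<and> (\<lambda>n. h (s n)) \<longlonglongrightarrow> real_of_ereal (f y)"
    and "filterlim (\<lambda>n. k (s n)) at_top sequentially \<Longrightarrow> (\<lambda>n. h (s n) / (1 + k (s n))) \<longlonglongrightarrow> 0"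
proof -
  have yD: "y \<notin> D" using y by (simp add: frontier_def interior_open)
  have sy: "s n \<noteq> y" for n using s(1)[of n] yD by auto
  let ?A = "range s"
  have A: "?A \<subseteq> D" using s by auto
  have yA: "y \<in> frontier D \<inter> closure ?A"
    using y s by (auto simp: closure_sequential)
  have fl: "filterlim s (at y within ?A) sequentially"
    using s sy by (auto simp: filterlim_at)
  note c = cc[unfolded controlled_convergence_def, rule_format, OF A yA]
  show "\<bar>f y\<bar> \<noteq> \<infinity> \<and> (\<lambda>n. h (s n)) \<longlonglongrightarrow> real_of_ereal (f y)"
    if bd: "\<exists>B. \<forall>n. k (s n) \<le> B"
  proof -
    obtain B where B: "\<And>n. k (s n) \<le> B" using bd by blast
    have "Limsup (at y within ?A) (\<lambda>x. ereal (k x)) \<le> ereal B"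
    proof (rule Limsup_bounded)
      show "\<forall>\<^sub>F x in at y within ?A. ereal (k x) \<le> ereal B"
        unfolding eventually_at_filter by (rule always_eventually) (use B in auto)
    qed
    then have "Limsup (at y within ?A) (\<lambda>x. ereal (k x)) < \<infinity>"
      using le_less_trans by fastforce
    with c have "\<bar>f y\<bar> \<noteq> \<infinity>" and hl: "(h \<longlongrightarrow> real_of_ereal (f y)) (at y within ?A)"
      by simp_all
    then show ?thesis
      using filterlim_compose[OF hl fl] by simp
  qed
  show "(\<lambda>n. h (s n) / (1 + k (s n))) \<longlonglongrightarrow> 0"
    if k: "filterlim (\<lambda>n. k (s n)) at_top sequentially"
  proof -
    have "filterlim k at_top (at y within ?A)"
      unfolding filterlim_at_top
    proof
      fix Z
      from k have "\<forall>\<^sub>F n in sequentially. Z \<le> k (s n)"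
        by (auto simp: filterlim_at_top)
      then obtain N where N: "\<And>n. n \<ge> N \<Longrightarrow> Z \<le> k (s n)"
        by (auto simp: eventually_sequentially)
      \<comment> \<open>Only the finitely many points with index below N can carry a value of k
        below Z, and y has a neighbourhood that avoids them.\<close>
      have "open (- s ` {..<N})" by (intro open_Compl finite_imp_closed) auto
      moreover have "y \<in> - s ` {..<N}" using sy by (metis ComplI imageE)
      ultimately have "\<forall>\<^sub>F x in nhds y. x \<in> - s ` {..<N}"
        by (rule eventually_nhds_in_open)
      then show "\<forall>\<^sub>F x in at y within ?A. Z \<le> k x"
        unfolding eventually_at_filter
      proof eventually_elim
        case (elim x)
        show ?case
        proof (intro impI)
          assume "x \<in> range s"
          then obtain n where "x = s n" by auto
          then show "Z \<le> k x" using elim N[of n] by (cases "n < N") auto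
        qed
      qed
    qed
    with c have "((\<lambda>x. h x / (1 + k x)) \<longlongrightarrow> 0) (at y within ?A)"
      by simp
    from filterlim_compose[OF this fl] show ?thesis .
  qed
qed

text \<open>The two clauses of \<open>controlled_convergence\<close> say nothing about an
  oscillating control; a subsequence always falls under one of them.\<close>

lemma bounded_or_unbounded_subseq:
  fixes k :: "nat \<Rightarrow> real"
  assumes "\<And>n. 0 \<le> k n"
  obtains r where "strict_mono r" "(\<exists>B. \<forall>n. k (r n) \<le> B) \<or> filterlim (k \<circ> r) at_top sequentially"
proof (cases "\<exists>B. \<forall>n. k n \<le> B")
  case True
  then show ?thesis using that[of id] by (auto simp: strict_mono_def)
next
  case False
  have ex: "\<exists>n>m. real m \<le> k n" for m
  proof (rule ccontr)
    assume a: "\<not> (\<exists>n>m. real m \<le> k n)"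
    have "k n \<le> max (Max (k ` {..m})) (real m)" for n
      using a by (cases "n \<le> m") (auto simp: not_le le_max_iff_disj intro: Max_ge less_imp_le)
    then show False using False by blast
  qed
  then obtain g where g: "\<And>m. g m > m" "\<And>m. real m \<le> k (g m)" by metis
  \<comment> \<open>Iterating g gives increasing indices for which \<open>k (r n)\<close> is at
    least \<open>(g ^^ n) 0\<close>, hence at least n.\<close>
  define r where "r n = (g ^^ Suc n) 0" for n
  have r: "strict_mono r"
    unfolding strict_mono_Suc_iff r_def using g by simp
  have "real n \<le> k (r n)" for n
  proof -
    have "n \<le> (g ^^ n) 0"
      by (induction n) (use g in \<open>auto intro: order.strict_trans1 Suc_leI\<close>)
    then show ?thesis using g(2)[of "(g ^^ n) 0"] by (simp add: r_def)
  qed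
  then have "filterlim (k \<circ> r) at_top sequentially"
    by (intro filterlim_at_top_mono[OF filterlim_real_sequentially]) (auto simp: o_def)
  then show ?thesis using that r by blast
qed

text \<open>The hypotheses are symmetric in the two pairs, so applying this inequality twice gives
  uniqueness. Near y one control may stay bounded while the other explodes; dividing by 1 + k1 + k2
  treats both at once.\<close>

lemma controlled_convergence_comparison:
  fixes D :: "'a::euclidean_space set"
  assumes D: "open D" "bounded D"
    and h: "harmonic_on D h1" "harmonic_on D h2"
    and k: "superharmonic_on D k1" "superharmonic_on D k2" "\<And>x. x \<in> D \<Longrightarrow> 0 \<le> k1 x" "\<And>x. x \<in> D \<Longrightarrow> 0 \<le> k2 x"
    and cc: "controlled_convergence D f h1 k1" "controlled_convergence D f h2 k2"
    and x: "x \<in> D"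
  shows "h2 x \<le> h1 x"
proof -
  have key: "0 \<le> (h1 x + (- h2 x)) + e * (k1 x + k2 x)" if e: "0 < e" for e
  proof (rule superharmonic_minimum_principle[OF D _ _ x, of "\<lambda>x. (h1 x + (- h2 x)) + e * (k1 x + k2 x)"])
    show "superharmonic_on D (\<lambda>x. (h1 x + (- h2 x)) + e * (k1 x + k2 x))"
      by (intro superharmonic_on_add superharmonic_on_cmult harmonic_imp_superharmonic D h k e)
    fix y d assume y: "y \<in> frontier D" and d: "0 < (d::real)"
    show "\<forall>\<^sub>F x in at y within D. - d < (h1 x + (- h2 x)) + e * (k1 x + k2 x)"
    proof (rule ccontr)
      let ?u = "\<lambda>x. (h1 x + (- h2 x)) + e * (k1 x + k2 x)"
      assume "\<not> ?thesis"
      then have "\<exists>\<^sub>F x in at y within D. ?u x \<le> - d"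
        by (simp add: frequently_def not_le)
      then have "\<exists>z. z \<in> D \<and> dist z y < inverse (real (Suc n)) \<and> ?u z \<le> - d" for n
        unfolding frequently_at by (auto dest!: spec[of _ "inverse (real (Suc n))"])
      then obtain z where z: "\<And>n. z n \<in> D" "\<And>n. dist (z n) y < inverse (real (Suc n))" "\<And>n. ?u (z n) \<le> - d"
        by metis
      have zl: "z \<longlonglongrightarrow> y"
        unfolding tendsto_dist_iff[of z]
        by (rule tendsto_sandwich[OF _ _ tendsto_const LIMSEQ_inverse_real_of_nat])
          (use z(2) in \<open>auto intro!: always_eventually less_imp_le\<close>)
      \<comment> \<open>The first thinning settles k1, the second k2; what was gained for k1
        survives the second.\<close>
      obtain r where r: "strict_mono r" "(\<exists>B. \<forall>n. k1 (z (r n)) \<le> B) \<or> filterlim (\<lambda>n. k1 (z (r n))) at_top sequentially"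
        using bounded_or_unbounded_subseq[of "\<lambda>n. k1 (z n)"] k(3) z(1) by (auto simp: o_def)
      obtain r' where r': "strict_mono r'" "(\<exists>B. \<forall>n. k2 (z (r (r' n))) \<le> B) \<or> filterlim (\<lambda>n. k2 (z (r (r' n)))) at_top sequentially"
        using bounded_or_unbounded_subseq[of "\<lambda>n. k2 (z (r n))"] k(4) z(1) by (auto simp: o_def)
      define s where "s n = z (r (r' n))" for n
      have sm: "strict_mono (\<lambda>n. r (r' n))"
        using strict_mono_compose[OF r(1) r'(1)] by (simp add: o_def)
      have s: "\<And>n. s n \<in> D" "s \<longlonglongrightarrow> y" "\<And>n. ?u (s n) \<le> - d"
        using z LIMSEQ_subseq_LIMSEQ[OF zl sm] by (auto simp: s_def[abs_def] o_def)
      have k1: "(\<exists>B. \<forall>n. k1 (s n) \<le> B) \<or> filterlim (\<lambda>n. k1 (s n)) at_top sequentially"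
        using r(2) filterlim_compose[OF _ filterlim_subseq[OF r'(1)], of "\<lambda>n. k1 (z (r n))" at_top]
        by (auto simp: s_def)
      have k2: "(\<exists>B. \<forall>n. k2 (s n) \<le> B) \<or> filterlim (\<lambda>n. k2 (s n)) at_top sequentially"
        using r'(2) by (simp add: s_def)
      note c1 = controlled_sequence[OF cc(1) y D(1) s(1,2)] and c2 = controlled_sequence[OF cc(2) y D(1) s(1,2)]
      have kn: "0 \<le> k1 (s n)" "0 \<le> k2 (s n)" for n using k s by auto
      show False
      proof (cases "(\<exists>B. \<forall>n. k1 (s n) \<le> B) \<and> (\<exists>B. \<forall>n. k2 (s n) \<le> B)")
        case True
        then have "(\<lambda>n. h1 (s n) + (- h2 (s n))) \<longlonglongrightarrow> real_of_ereal (f y) + (- real_of_ereal (f y))"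
          using c1 c2 by (intro tendsto_intros) auto
        then have "(\<lambda>n. h1 (s n) + (- h2 (s n))) \<longlonglongrightarrow> 0" by simp
        then have "\<forall>\<^sub>F n in sequentially. - d < h1 (s n) + (- h2 (s n))"
          using d by (intro order_tendstoD) auto
        then obtain n where n: "- d < h1 (s n) + (- h2 (s n))"
          by (meson eventually_happens' sequentially_bot)
        moreover have "0 \<le> e * (k1 (s n) + k2 (s n))"
          using e kn by simp
        ultimately show False using s(3)[of n] by linarith
      next
        case False
        let ?k = "\<lambda>n. k1 (s n) + k2 (s n)"
        have kinf: "filterlim ?k at_top sequentially"
          using False k1 k2 kn
          by (auto intro: filterlim_at_top_mono[OF _ always_eventually] simp: add_increasing add_increasing2)
        \<comment> \<open>Stated for a generic pair: if its own control is bounded, h converges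
          while the total control tends to infinity; otherwise enlarging the denominator only
          helps.\<close>
        have small: "(\<lambda>n. h (s n) / (1 + ?k n)) \<longlonglongrightarrow> 0"
          if "(\<exists>B. \<forall>n. \<kappa> n \<le> B) \<Longrightarrow> \<bar>f y\<bar> \<noteq> \<infinity> \<and> (\<lambda>n. h (s n)) \<longlonglongrightarrow> real_of_ereal (f y)"
            "filterlim \<kappa> at_top sequentially \<Longrightarrow> (\<lambda>n. h (s n) / (1 + \<kappa> n)) \<longlonglongrightarrow> 0"
            "(\<exists>B. \<forall>n. \<kappa> n \<le> B) \<or> filterlim \<kappa> at_top sequentially"
            "\<And>n. 0 \<le> \<kappa> n \<and> \<kappa> n \<le> ?k n" for h :: "'a \<Rightarrow> real" and \<kappa> :: "nat \<Rightarrow> real"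
          using that(3)
        proof
          assume "\<exists>B. \<forall>n. \<kappa> n \<le> B"
          then have "(\<lambda>n. h (s n)) \<longlonglongrightarrow> real_of_ereal (f y)" using that(1) by blast
          moreover have "filterlim (\<lambda>n. 1 + ?k n) at_infinity sequentially"
            by (intro filterlim_at_top_imp_at_infinity filterlim_tendsto_add_at_top[OF tendsto_const kinf])
          ultimately show ?thesis by (rule tendsto_divide_0)
        next
          assume "filterlim \<kappa> at_top sequentially"
          then have l: "(\<lambda>n. \<bar>h (s n) / (1 + \<kappa> n)\<bar>) \<longlonglongrightarrow> 0"
            using that(2) tendsto_rabs_zero by blast
          show ?thesis
          proof (rule Lim_null_comparison[OF _ l], intro always_eventually allI)
            fix n
            show "norm (h (s n) / (1 + ?k n)) \<le> \<bar>h (s n) / (1 + \<kappa> n)\<bar>"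
              using that(4)[of n] kn[of n] by (auto simp: abs_divide intro!: divide_left_mono mult_pos_pos)
          qed
        qed
        have l1: "(\<lambda>n. h1 (s n) / (1 + ?k n)) \<longlonglongrightarrow> 0"
          by (rule small[OF c1 k1]) (use kn in auto)
        have l2: "(\<lambda>n. h2 (s n) / (1 + ?k n)) \<longlonglongrightarrow> 0"
          by (rule small[OF c2 k2]) (use kn in auto)
        have "(\<lambda>n. h1 (s n) / (1 + ?k n) - h2 (s n) / (1 + ?k n)) \<longlonglongrightarrow> 0 - 0"
          by (intro tendsto_diff l1 l2)
        then have "\<forall>\<^sub>F n in sequentially. - (e / 2) < h1 (s n) / (1 + ?k n) - h2 (s n) / (1 + ?k n)"
          using e by (intro order_tendstoD) auto
        \<comment> \<open>As soon as the total control exceeds 1, e times it outweighs e / 2 times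
          one plus it; the comparison function is then positive, against the choice of the
          sequence.\<close>
        moreover have "\<forall>\<^sub>F n in sequentially. 2 \<le> ?k n"
          using kinf by (auto simp: filterlim_at_top)
        ultimately have "\<forall>\<^sub>F n in sequentially. False"
        proof eventually_elim
          case (elim n)
          then have pos: "0 < 1 + ?k n" by simp
          have "- (e / 2) * (1 + ?k n) < (h1 (s n) / (1 + ?k n) - h2 (s n) / (1 + ?k n)) * (1 + ?k n)"
            using elim(1) pos by (intro mult_strict_right_mono)
          also have "\<dots> = h1 (s n) - h2 (s n)"
            using pos by (simp add: left_diff_distrib)
          finally have "- (e / 2) * (1 + ?k n) + e * ?k n < ?u (s n)"
            by simp
          moreover have "0 \<le> - (e / 2) * (1 + ?k n) + e * ?k n"
          proof -
            have "- (e / 2) * (1 + ?k n) + e * ?k n = (e / 2) * (?k n - 1)"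
              by (simp add: field_simps)
            then show ?thesis using e elim(2) by simp
          qed
          ultimately show False using s(3)[of n] d by linarith
        qed
        then show False by simp
      qed
    qed
  qed
  show ?thesis
  proof (rule ccontr)
    assume "\<not> h2 x \<le> h1 x"
    then have a: "0 < h2 x - h1 x" by simp
    have kx: "0 \<le> k1 x + k2 x" using k x by simp
    \<comment> \<open>Small enough that e * (k1 x + k2 x) stays below h2 x - h1 x; the added 1 keeps
      the denominator positive.\<close>
    define e where "e = (h2 x - h1 x) / (2 * (k1 x + k2 x + 1))"
    have "0 < e" using a kx by (simp add: e_def)
    moreover have "e * (k1 x + k2 x) < h2 x - h1 x"
      using a kx by (simp add: e_def divide_simps)
    ultimately show False using key[of e] by simp
  qed
qed

section \<open>The exit position of Brownian motion\<close>

lemma abs_inner_le_norm: "b \<in> Basis \<Longrightarrow> \<bar>z \<bullet> b\<bar> \<le> norm z"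
  using Basis_le_norm by (metis real_norm_def inner_commute)

text \<open>Cauchy-Schwarz for the squared coordinates. The moments of increments are computed
  coordinate by coordinate, so the remainder is measured that way too.\<close>

lemma norm_power4_le:
  fixes z :: "'a::euclidean_space"
  shows "(norm z) ^ 4 \<le> real DIM('a) * (\<Sum>b\<in>Basis. (z \<bullet> b) ^ 4)"
proof -
  have "(norm z)\<^sup>2 = (\<Sum>b\<in>Basis. (z \<bullet> b)\<^sup>2)"
    unfolding power2_norm_eq_inner by (subst euclidean_inner) (simp add: power2_eq_square)
  then have "(norm z) ^ 4 = (\<Sum>b\<in>Basis. (z \<bullet> b)\<^sup>2)\<^sup>2"
    using power_mult[of "norm z" 2 2] by simp
  also have "\<dots> \<le> real DIM('a) * (\<Sum>b\<in>Basis. ((z \<bullet> b)\<^sup>2)\<^sup>2)"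
    using sum_squared_le_sum_of_squares[of "\<lambda>b. (z \<bullet> b)\<^sup>2" "Basis :: 'a set"] by (simp add: mult.commute)
  finally show ?thesis
    using power_mult[of _ 2 2, symmetric, where 'a = real] by simp
qed

lemma Taylor_C2:
  fixes h :: "'a::euclidean_space \<Rightarrow> real"
  assumes D: "C2_on D h" and seg: "\<And>t. 0 \<le> t \<Longrightarrow> t \<le> 1 \<Longrightarrow> y + t *\<^sub>R z \<in> D"
  obtains t where "0 < t" "t < 1"
    "h (y + z) = h y + (\<Sum>b\<in>Basis. (z \<bullet> b) * partial b h y) +
      (\<Sum>b\<in>Basis. \<Sum>c\<in>Basis. (z \<bullet> b) * (z \<bullet> c) * partial c (partial b h) (y + t *\<^sub>R z)) / 2"
proof -
  define d where "d m t = (if m = 0 then h (y + t *\<^sub>R z)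
     else if m = 1 then (\<Sum>b\<in>Basis. (z \<bullet> b) * partial b h (y + t *\<^sub>R z))
     else (\<Sum>b\<in>Basis. \<Sum>c\<in>Basis. (z \<bullet> b) * (z \<bullet> c) * partial c (partial b h) (y + t *\<^sub>R z)))"
    for m :: nat and t
  have aff: "((\<lambda>t. y + t *\<^sub>R z) has_derivative (\<lambda>s. s *\<^sub>R z)) (at t)" for t
    by (auto intro!: derivative_eq_intros)
  have "\<forall>m t. m < 2 \<and> 0 \<le> t \<and> t \<le> 1 \<longrightarrow> DERIV (d m) t :> d (Suc m) t"
  proof (intro allI impI)
    fix m :: nat and t :: real assume a: "m < 2 \<and> 0 \<le> t \<and> t \<le> 1"
    then have inD: "y + t *\<^sub>R z \<in> D" using seg by auto
    from a consider "m = 0" | "m = 1" by linarith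
    then show "DERIV (d m) t :> d (Suc m) t"
    proof cases
      case 1
      from has_derivative_compose[OF aff C2_on_has_derivative[OF D inD]]
      have "((\<lambda>t. h (y + t *\<^sub>R z)) has_derivative (*) (\<Sum>b\<in>Basis. (z \<bullet> b) * partial b h (y + t *\<^sub>R z))) (at t)"
        by (rule has_derivative_eq_rhs) (simp add: fun_eq_iff sum_distrib_left sum_distrib_right ac_simps)
      then show ?thesis using 1 by (simp add: d_def[abs_def] has_field_derivative_def)
    next
      case 2
      have "((\<lambda>t. partial b h (y + t *\<^sub>R z)) has_real_derivative
          (\<Sum>c\<in>Basis. (z \<bullet> c) * partial c (partial b h) (y + t *\<^sub>R z))) (at t)" if b: "b \<in> Basis" for b
      proof -
        from has_derivative_compose[OF aff C2_on_partial_has_derivative[OF D inD b]]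
        show ?thesis unfolding has_field_derivative_def
          by (rule has_derivative_eq_rhs) (simp add: fun_eq_iff sum_distrib_left sum_distrib_right ac_simps)
      qed
      then have "((\<lambda>t. \<Sum>b\<in>Basis. (z \<bullet> b) * partial b h (y + t *\<^sub>R z)) has_real_derivative
          (\<Sum>b\<in>Basis. (z \<bullet> b) * (\<Sum>c\<in>Basis. (z \<bullet> c) * partial c (partial b h) (y + t *\<^sub>R z)))) (at t)"
        by (intro DERIV_sum DERIV_cmult) auto
      then show ?thesis using 2 by (simp add: d_def[abs_def] sum_distrib_left ac_simps)
    qed
  qed
  then have "\<exists>t::real. 0 < t \<and> t < 1 \<and> d 0 1 = (\<Sum>m<2. (d m 0 / fact m) * (1 - 0) ^ m) + (d 2 t / fact 2) * (1 - 0) ^ 2"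
    by (intro Taylor_up[where a = 0]) auto
  then show thesis
    using that by (auto simp: d_def numeral_2_eq_2)
qed

text \<open>For small z the second derivatives oscillate little, at a cost of e |z|^2. For |z| at
  least d everything is bounded crudely and raised to |z|^4, because the fourth moment of an
  increment is of second order in the mesh. A step may leave D, hence the bounded extension
  \<open>hb\<close>.\<close>

lemma Taylor_C2_uniform:
  fixes h :: "'a::euclidean_space \<Rightarrow> real"
  assumes D: "open D" "C2_on D h" and K: "compact K" "K \<subseteq> D"
    and hb: "\<And>z. z \<in> D \<Longrightarrow> hb z = h z" "\<And>z. \<bar>hb z\<bar> \<le> B" and e: "0 < e"
  obtains C where "0 \<le> C" "\<And>y z. y \<in> K \<Longrightarrow> \<bar>hb (y + z) - hb y - (\<Sum>b\<in>Basis. partial b h y * (z \<bullet> b))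
      - (\<Sum>b\<in>Basis. \<Sum>c\<in>Basis. partial c (partial b h) y * ((z \<bullet> b) * (z \<bullet> c))) / 2\<bar>
      \<le> e * (\<Sum>b\<in>Basis. (z \<bullet> b) * (z \<bullet> b)) + C * (\<Sum>b\<in>Basis. (z \<bullet> b) ^ 4)"
proof (cases "K = {}")
  case True
  then show ?thesis using that[of 0] by auto
next
  case False
  obtain \<rho> where \<rho>: "0 < \<rho>" "{z. infdist z K \<le> \<rho>} \<subseteq> D"
    using compact_in_open_separated[OF False K(1) D(1) K(2)] by blast
  define K' where "K' = {z. infdist z K \<le> \<rho>}"
  have K': "compact K'" "K' \<subseteq> D"
    unfolding K'_def using compact_infdist_le[OF False K(1)] \<rho> by auto
  have KK': "y + t *\<^sub>R z \<in> K'" if "y \<in> K" "norm z < \<rho>" "0 \<le> t" "t \<le> 1" for y z t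
  proof -
    have "t * norm z \<le> 1 * norm z" using that by (intro mult_right_mono) auto
    then have "dist (y + t *\<^sub>R z) y \<le> \<rho>" using that by (simp add: dist_norm)
    then show ?thesis using that infdist_le2[of y K "y + t *\<^sub>R z" \<rho>] by (simp add: K'_def)
  qed
  \<comment> \<open>The second order term is half a sum over all pairs of basis vectors; with this
    tolerance it costs e altogether.\<close>
  define e' where "e' = 2 * e / (DIM('a))\<^sup>2"
  have e': "0 < e'" using e by (simp add: e'_def)
  have "\<exists>d>0. \<forall>x\<in>K'. \<forall>x'\<in>K'. dist x' x < d \<longrightarrow> dist (partial c (partial b h) x') (partial c (partial b h) x) < e'"
    if "b \<in> Basis" "c \<in> Basis" for b c
    using compact_uniformly_continuous[OF continuous_on_subset[OF C2_on_continuous(3)[OF D(2) that] K'(2)] K'(1)] e'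
    unfolding uniformly_continuous_on_def by blast
  then obtain \<delta> where \<delta>: "\<And>b c. b \<in> Basis \<Longrightarrow> c \<in> Basis \<Longrightarrow> \<delta> b c > 0"
    "\<And>b c x x'. b \<in> Basis \<Longrightarrow> c \<in> Basis \<Longrightarrow> x \<in> K' \<Longrightarrow> x' \<in> K' \<Longrightarrow> dist x' x < \<delta> b c \<Longrightarrow>
      dist (partial c (partial b h) x') (partial c (partial b h) x) < e'"
    by metis
  define d where "d = min \<rho> (Min ((\<lambda>(b, c). \<delta> b c) ` (Basis \<times> Basis)))"
  have d: "0 < d" "d \<le> \<rho>" "\<And>b c. b \<in> Basis \<Longrightarrow> c \<in> Basis \<Longrightarrow> d \<le> \<delta> b c"
  proof -
    have "0 < Min ((\<lambda>(b, c). \<delta> b c) ` (Basis \<times> Basis))"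
      using \<delta>(1) by (subst Min_gr_iff) auto
    then show "0 < d" using \<rho> by (simp add: d_def)
    show "d \<le> \<delta> b c" if "b \<in> Basis" "c \<in> Basis" for b c
      unfolding d_def using that by (intro min.coboundedI2 Min_le) force+
  qed (simp add: d_def)
  have bd: "\<exists>G\<ge>0. \<forall>y\<in>K. \<bar>f y\<bar> \<le> G" if "continuous_on D f" for f :: "'a \<Rightarrow> real"
  proof -
    have "bounded (f ` K)"
      by (intro compact_imp_bounded compact_continuous_image continuous_on_subset[OF that K(2)] K(1))
    then obtain G where "\<forall>y\<in>K. \<bar>f y\<bar> \<le> G" by (force simp: bounded_iff)
    then show ?thesis by (intro exI[of _ "max G 0"]) auto
  qed
  obtain G where G: "\<And>b. b \<in> Basis \<Longrightarrow> G b \<ge> 0" "\<And>b y. b \<in> Basis \<Longrightarrow> y \<in> K \<Longrightarrow> \<bar>partial b h y\<bar> \<le> G b"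
    using bd[OF C2_on_continuous(2)[OF D(2)]] by metis
  obtain H where H: "\<And>b c. b \<in> Basis \<Longrightarrow> c \<in> Basis \<Longrightarrow> H b c \<ge> 0"
    "\<And>b c y. b \<in> Basis \<Longrightarrow> c \<in> Basis \<Longrightarrow> y \<in> K \<Longrightarrow> \<bar>partial c (partial b h) y\<bar> \<le> H b c"
    using bd[OF C2_on_continuous(3)[OF D(2)]] by metis
  define SG where "SG = (\<Sum>b\<in>Basis. G b)"
  define SH where "SH = (\<Sum>b\<in>Basis. \<Sum>c\<in>Basis. H b c)"
  have SGH: "0 \<le> SG" "0 \<le> SH" "0 \<le> B"
    unfolding SG_def SH_def using G(1) H(1) hb(2)[of 0] by (auto intro!: sum_nonneg)
  \<comment> \<open>Each lower power of |z| in the crude bound is raised to the fourth at the price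
    of the missing powers of d.\<close>
  define C0 where "C0 = 2 * B / d ^ 4 + SG / d ^ 3 + SH / (2 * d\<^sup>2)"
  have C0: "0 \<le> C0" unfolding C0_def using SGH d by (auto intro!: add_nonneg_nonneg divide_nonneg_nonneg)
  have n2: "(norm z)\<^sup>2 = (\<Sum>b\<in>Basis. (z \<bullet> b) * (z \<bullet> b))" for z :: 'a
    unfolding power2_norm_eq_inner by (subst euclidean_inner) simp
  show ?thesis
  proof (rule that[of "C0 * real DIM('a)"])
    show "0 \<le> C0 * real DIM('a)" using C0 by simp
    fix y z assume y: "y \<in> K"
    let ?L = "\<Sum>b\<in>Basis. partial b h y * (z \<bullet> b)"
    let ?Q = "\<lambda>x. \<Sum>b\<in>Basis. \<Sum>c\<in>Basis. partial c (partial b h) x * ((z \<bullet> b) * (z \<bullet> c))"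
    have yD: "y \<in> D" using y K by auto
    have "\<bar>hb (y + z) - hb y - ?L - ?Q y / 2\<bar> \<le> e * (norm z)\<^sup>2 + C0 * (norm z) ^ 4"
    proof (cases "norm z < d")
      case True
      have inK': "y + t *\<^sub>R z \<in> K'" if "0 \<le> t" "t \<le> 1" for t
        using KK'[OF y _ that] True d(2) by auto
      obtain t where t: "0 < t" "t < 1"
        "h (y + z) = h y + (\<Sum>b\<in>Basis. (z \<bullet> b) * partial b h y) +
          (\<Sum>b\<in>Basis. \<Sum>c\<in>Basis. (z \<bullet> b) * (z \<bullet> c) * partial c (partial b h) (y + t *\<^sub>R z)) / 2"
        using Taylor_C2[OF D(2), of y z] inK' K'(2) by blast
      have yz: "y + z \<in> D" using inK'[of 1] K'(2) by auto
      have "hb (y + z) - hb y - ?L - ?Q y / 2 = (?Q (y + t *\<^sub>R z) - ?Q y) / 2"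
        using t(3) hb(1)[OF yz] hb(1)[OF yD] by (simp add: ac_simps diff_divide_distrib)
      also have "?Q (y + t *\<^sub>R z) - ?Q y = (\<Sum>b\<in>Basis. \<Sum>c\<in>Basis.
          (partial c (partial b h) (y + t *\<^sub>R z) - partial c (partial b h) y) * ((z \<bullet> b) * (z \<bullet> c)))"
        by (simp add: sum_subtractf left_diff_distrib)
      also have "\<bar>\<dots> / 2\<bar> \<le> (\<Sum>b\<in>(Basis::'a set). \<Sum>c\<in>(Basis::'a set). e' * (norm z * norm z)) / 2"
      proof -
        have "\<bar>\<Sum>b\<in>Basis. \<Sum>c\<in>Basis.
          (partial c (partial b h) (y + t *\<^sub>R z) - partial c (partial b h) y) * ((z \<bullet> b) * (z \<bullet> c))\<bar>
          \<le> (\<Sum>b\<in>(Basis::'a set). \<Sum>c\<in>(Basis::'a set). e' * (norm z * norm z))"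
        proof (intro order_trans[OF sum_abs] sum_mono)
          fix b c :: 'a assume bc: "b \<in> Basis" "c \<in> Basis"
          have "t * norm z \<le> 1 * norm z" using t by (intro mult_right_mono) auto
          then have "dist (y + t *\<^sub>R z) y < \<delta> b c"
            using True d(3)[OF bc] t by (simp add: dist_norm)
          then have "\<bar>partial c (partial b h) (y + t *\<^sub>R z) - partial c (partial b h) y\<bar> \<le> e'"
            using \<delta>(2)[OF bc, of y "y + t *\<^sub>R z"] inK'[of 0] inK'[of t] t by (simp add: dist_real_def)
          then show "\<bar>(partial c (partial b h) (y + t *\<^sub>R z) - partial c (partial b h) y) * ((z \<bullet> b) * (z \<bullet> c))\<bar>
              \<le> e' * (norm z * norm z)"
            unfolding abs_mult using abs_inner_le_norm[of _ z] bc e' by (intro mult_mono) auto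
        qed
        then show ?thesis by simp
      qed
      also have "\<dots> = e * (norm z)\<^sup>2"
        by (simp add: e'_def power2_eq_square)
      finally show ?thesis using C0 by (simp add: add_increasing2)
    next
      case False
      then have dz: "d \<le> norm z" by simp
      have L: "\<bar>?L\<bar> \<le> SG * norm z"
        unfolding SG_def sum_distrib_right
        by (intro order_trans[OF sum_abs] sum_mono) (auto simp: abs_mult intro!: mult_mono G y abs_inner_le_norm)
      have Q: "\<bar>?Q y\<bar> \<le> SH * (norm z * norm z)"
        unfolding SH_def sum_distrib_right
        by (intro order_trans[OF sum_abs] sum_mono) (auto simp: abs_mult intro!: mult_mono H y abs_inner_le_norm mult_nonneg_nonneg)
      have "\<bar>hb (y + z) - hb y - ?L - ?Q y / 2\<bar> \<le> 2 * B + SG * norm z + SH * (norm z * norm z) / 2"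
        using L Q hb(2)[of "y + z"] hb(2)[of y] by linarith
      also have "\<dots> \<le> 2 * B / d ^ 4 * (norm z) ^ 4 + SG / d ^ 3 * (norm z) ^ 4 + SH / (2 * d\<^sup>2) * (norm z) ^ 4"
      proof -
        have p: "d ^ k * norm z ^ j \<le> norm z ^ (k + j)" for k j
          unfolding power_add using dz d by (intro mult_right_mono power_mono) auto
        have "2 * B * d ^ 4 \<le> 2 * B * norm z ^ 4" using p[of 4 0] SGH by (intro mult_left_mono) auto
        moreover have "SG * (d ^ 3 * norm z) \<le> SG * norm z ^ 4" using p[of 3 1] SGH by (intro mult_left_mono) auto
        moreover have "SH * (d\<^sup>2 * (norm z)\<^sup>2) \<le> SH * norm z ^ 4" using p[of 2 2] SGH by (intro mult_left_mono) auto
        ultimately have "2 * B \<le> 2 * B / d ^ 4 * (norm z) ^ 4" "SG * norm z \<le> SG / d ^ 3 * (norm z) ^ 4"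
          "SH * (norm z * norm z) / 2 \<le> SH / (2 * d\<^sup>2) * (norm z) ^ 4"
          using d by (simp_all add: field_simps power2_eq_square)
        then show ?thesis by linarith
      qed
      also have "\<dots> = C0 * (norm z) ^ 4" by (simp add: C0_def algebra_simps)
      finally show ?thesis using e by (simp add: add_increasing)
    qed
    also have "\<dots> \<le> e * (\<Sum>b\<in>Basis. (z \<bullet> b) * (z \<bullet> b)) + C0 * real DIM('a) * (\<Sum>b\<in>Basis. (z \<bullet> b) ^ 4)"
      using mult_left_mono[OF norm_power4_le[of z] C0] by (simp add: n2 mult.assoc)
    finally show "\<bar>hb (y + z) - hb y - ?L - ?Q y / 2\<bar>
      \<le> e * (\<Sum>b\<in>Basis. (z \<bullet> b) * (z \<bullet> b)) + C0 * real DIM('a) * (\<Sum>b\<in>Basis. (z \<bullet> b) ^ 4)" .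
  qed
qed

section \<open>Random walks frozen outside a compact set\<close>

primrec stopped_walk :: "'a::euclidean_space set \<Rightarrow> 'a \<Rightarrow> (nat \<Rightarrow> 'a) \<Rightarrow> nat \<Rightarrow> 'a" where
  "stopped_walk K x \<xi> 0 = x"
| "stopped_walk K x \<xi> (Suc n) =
    (if stopped_walk K x \<xi> n \<in> K then stopped_walk K x \<xi> n + \<xi> n else stopped_walk K x \<xi> n)"

lemma stopped_walk_cong:
  "(\<And>i. i < n \<Longrightarrow> \<xi> i = \<eta> i) \<Longrightarrow> stopped_walk K x \<xi> n = stopped_walk K x \<eta> n"
  by (induction n) auto

lemma measurable_stopped_walk_PiM:
  assumes "K \<in> sets borel" "{..<n} \<subseteq> I"
  shows "(\<lambda>e. stopped_walk K x e n) \<in> measurable (PiM I (\<lambda>_. borel)) borel"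
  using assms(2)
proof (induction n)
  case (Suc n)
  then have n: "{..<n} \<subseteq> I" "n \<in> I" by auto
  have [measurable]: "(\<lambda>e. stopped_walk K x e n) \<in> measurable (PiM I (\<lambda>_. borel)) borel"
    by (rule Suc.IH[OF n(1)])
  have [measurable]: "(\<lambda>e. e n) \<in> measurable (PiM I (\<lambda>_. borel)) (borel :: 'a measure)"
    using n(2) by (rule measurable_component_singleton)
  note assms(1)[measurable]
  show ?case by simp
qed simp

lemma measurable_stopped_walk:
  assumes "K \<in> sets borel" and [measurable]: "\<And>k. \<xi> k \<in> borel_measurable M"
  shows "(\<lambda>\<omega>. stopped_walk K x (\<lambda>i. \<xi> i \<omega>) n) \<in> borel_measurable M"
proof (induction n)
  case (Suc n)
  note this[measurable] assms(1)[measurable]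
  show ?case by simp
qed simp

text \<open>The walk up to n and the increment n are functions of disjoint blocks of an independent
  family.\<close>

lemma (in prob_space) stopped_walk_indep:
  fixes \<xi> :: "nat \<Rightarrow> 'a \<Rightarrow> 'b::euclidean_space" and G \<psi> :: "'b \<Rightarrow> real" and x :: 'b
  assumes indep: "indep_vars (\<lambda>_. borel) \<xi> {..<Suc n}" and K: "K \<in> sets borel"
    and G: "G \<in> borel_measurable borel" "\<And>z. \<bar>G z\<bar> \<le> B"
    and \<psi>: "\<psi> \<in> borel_measurable borel" "integrable M (\<lambda>\<omega>. \<psi> (\<xi> n \<omega>))"
  defines "W \<equiv> \<lambda>\<omega>. stopped_walk K x (\<lambda>i. \<xi> i \<omega>) n"
  shows "integrable M (\<lambda>\<omega>. G (W \<omega>) * \<psi> (\<xi> n \<omega>))"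
    and "expectation (\<lambda>\<omega>. G (W \<omega>) * \<psi> (\<xi> n \<omega>)) = expectation (\<lambda>\<omega>. G (W \<omega>)) * expectation (\<lambda>\<omega>. \<psi> (\<xi> n \<omega>))"
proof -
  have rv: "random_variable (PiM {..<n} (\<lambda>_. borel)) (\<lambda>\<omega>. restrict (\<lambda>i. \<xi> i \<omega>) {..<n})"
    and iv: "indep_var (PiM {..<n} (\<lambda>_. borel)) (\<lambda>\<omega>. restrict (\<lambda>i. \<xi> i \<omega>) {..<n})
      (PiM {n} (\<lambda>_. borel)) (\<lambda>\<omega>. restrict (\<lambda>i. \<xi> i \<omega>) {n})"
    using indep_var_restrict[OF indep, of "{..<n}" "{n}"] by (auto dest: indep_var_rv1)
  let ?Y1 = "\<lambda>e. G (stopped_walk K x e n)" and ?Y2 = "\<lambda>e. \<psi> (e n)"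
  have Y1: "?Y1 \<in> borel_measurable (PiM {..<n} (\<lambda>_. borel))"
    using measurable_compose[OF measurable_stopped_walk_PiM[OF K order_refl] G(1)] by simp
  have Y2: "?Y2 \<in> borel_measurable (PiM {n} (\<lambda>_. borel))"
    using measurable_compose[OF measurable_component_singleton[of n "{n}" "\<lambda>_. borel"] \<psi>(1)] by auto
  have e1: "?Y1 \<circ> (\<lambda>\<omega>. restrict (\<lambda>i. \<xi> i \<omega>) {..<n}) = (\<lambda>\<omega>. G (W \<omega>))"
    by (auto simp: fun_eq_iff W_def intro!: arg_cong[where f = G] stopped_walk_cong)
  have e2: "?Y2 \<circ> (\<lambda>\<omega>. restrict (\<lambda>i. \<xi> i \<omega>) {n}) = (\<lambda>\<omega>. \<psi> (\<xi> n \<omega>))"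
    by (auto simp: fun_eq_iff)
  have iv': "indep_var borel (\<lambda>\<omega>. G (W \<omega>)) borel (\<lambda>\<omega>. \<psi> (\<xi> n \<omega>))"
    using indep_var_compose[OF iv Y1 Y2] unfolding e1 e2 .
  have "(\<lambda>\<omega>. G (W \<omega>)) \<in> borel_measurable M"
    using measurable_comp[OF rv Y1] unfolding e1 .
  then have "integrable M (\<lambda>\<omega>. G (W \<omega>))"
    by (intro integrable_const_bound[where B = B]) (use G(2) in auto)
  with indep_var_lebesgue_integral[OF iv' this \<psi>(2)] indep_var_integrable[OF iv' this \<psi>(2)]
  show "integrable M (\<lambda>\<omega>. G (W \<omega>) * \<psi> (\<xi> n \<omega>))"
    "expectation (\<lambda>\<omega>. G (W \<omega>) * \<psi> (\<xi> n \<omega>)) = expectation (\<lambda>\<omega>. G (W \<omega>)) * expectation (\<lambda>\<omega>. \<psi> (\<xi> n \<omega>))"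
    by auto
qed

text \<open>In the expected Taylor expansion the linear terms vanish because the increment is
  centred and independent of the walk, the mixed second order terms because its coordinates are
  uncorrelated, and the diagonal ones add up to s / 2 times the expectation of a vanishing trace.
  Only the remainder is left.\<close>

lemma (in prob_space) stopped_walk_step:
  fixes \<xi> :: "nat \<Rightarrow> 'a \<Rightarrow> 'b::euclidean_space" and hb :: "'b \<Rightarrow> real" and x :: 'b
  assumes indep: "\<And>n. indep_vars (\<lambda>_. borel) \<xi> {..<n}" and rv: "\<And>k. \<xi> k \<in> borel_measurable M"
    and m1: "\<And>k b. b \<in> Basis \<Longrightarrow> has_bochner_integral M (\<lambda>\<omega>. \<xi> k \<omega> \<bullet> b) 0"
    and m2: "\<And>k b c. b \<in> Basis \<Longrightarrow> c \<in> Basis \<Longrightarrow>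
      has_bochner_integral M (\<lambda>\<omega>. (\<xi> k \<omega> \<bullet> b) * (\<xi> k \<omega> \<bullet> c)) (if b = c then s else 0)"
    and m4: "\<And>k b. b \<in> Basis \<Longrightarrow> has_bochner_integral M (\<lambda>\<omega>. (\<xi> k \<omega> \<bullet> b) ^ 4) (3 * s\<^sup>2)"
    and K: "compact K" and hbm: "hb \<in> borel_measurable borel" and hbB: "\<And>z. \<bar>hb z\<bar> \<le> B"
    and g: "\<And>b. b \<in> Basis \<Longrightarrow> continuous_on K (g b)"
    and H: "\<And>b c. b \<in> Basis \<Longrightarrow> c \<in> Basis \<Longrightarrow> continuous_on K (H b c)"
    and lap: "\<And>y. y \<in> K \<Longrightarrow> (\<Sum>b\<in>Basis. H b b y) = 0"
    and taylor: "\<And>y z. y \<in> K \<Longrightarrow> \<bar>hb (y + z) - hb y - (\<Sum>b\<in>Basis. g b y * (z \<bullet> b))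
      - (\<Sum>b\<in>Basis. \<Sum>c\<in>Basis. H b c y * ((z \<bullet> b) * (z \<bullet> c))) / 2\<bar>
      \<le> e * (\<Sum>b\<in>Basis. (z \<bullet> b) * (z \<bullet> b)) + C * (\<Sum>b\<in>Basis. (z \<bullet> b) ^ 4)"
    and eC: "0 \<le> e" "0 \<le> C"
  defines "W \<equiv> \<lambda>n \<omega>. stopped_walk K x (\<lambda>i. \<xi> i \<omega>) n"
  shows "\<bar>expectation (\<lambda>\<omega>. hb (W (Suc n) \<omega>)) - expectation (\<lambda>\<omega>. hb (W n \<omega>))\<bar>
    \<le> real DIM('b) * (e * s + C * (3 * s\<^sup>2))"
proof -
  have Kb: "K \<in> sets borel" using K by (intro borel_closed compact_imp_closed)
  have Wm: "W n \<in> borel_measurable M" for n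
    unfolding W_def by (rule measurable_stopped_walk[OF Kb rv])
  have hWi: "integrable M (\<lambda>\<omega>. hb (W n \<omega>))" for n
    using measurable_compose[OF Wm hbm] hbB by (intro integrable_const_bound[where B = B]) auto
  \<comment> \<open>\<open>g\<close> and \<open>H\<close> are controlled on K only; the indicator
    makes them bounded Borel functions on the whole space.\<close>
  have ind: "(\<lambda>y. indicator K y * f y) \<in> borel_measurable borel \<and> (\<exists>B. \<forall>y. \<bar>indicator K y * f y\<bar> \<le> B)"
    if "continuous_on K f" for f :: "'b \<Rightarrow> real"
  proof -
    have "bounded (f ` K)" by (intro compact_imp_bounded compact_continuous_image that K)
    then obtain B where "\<forall>y\<in>K. \<bar>f y\<bar> \<le> B" by (force simp: bounded_iff)
    then have "\<bar>indicator K y * f y\<bar> \<le> max B 0" for y by (auto simp: indicator_def)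
    then show ?thesis
      using borel_measurable_continuous_on_indicator[OF Kb that] by auto
  qed
  let ?I = "\<lambda>y. indicator K y :: real"
  \<comment> \<open>The indicators let one formula serve before and after freezing; once the walk is
    frozen all terms are 0.\<close>
  define R where "R \<omega> = (hb (W (Suc n) \<omega>) - hb (W n \<omega>))
      - (\<Sum>b\<in>Basis. ?I (W n \<omega>) * g b (W n \<omega>) * (\<xi> n \<omega> \<bullet> b))
      - (\<Sum>b\<in>Basis. \<Sum>c\<in>Basis. ?I (W n \<omega>) * H b c (W n \<omega>) * ((\<xi> n \<omega> \<bullet> b) * (\<xi> n \<omega> \<bullet> c))) / 2" for \<omega>
  have A: "has_bochner_integral M (\<lambda>\<omega>. ?I (W n \<omega>) * g b (W n \<omega>) * (\<xi> n \<omega> \<bullet> b)) 0" if b: "b \<in> Basis" for b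
  proof -
    obtain B where B: "\<And>y. \<bar>?I y * g b y\<bar> \<le> B" using ind[OF g[OF b]] by blast
    have *: "(\<lambda>y. ?I y * g b y) \<in> borel_measurable borel" using ind[OF g[OF b]] by blast
    show ?thesis
      using stopped_walk_indep[OF indep[of "Suc n"] Kb * B, of "\<lambda>z. z \<bullet> b" x] m1[OF b, of n]
      by (auto simp: has_bochner_integral_iff W_def)
  qed
  have Bc: "has_bochner_integral M (\<lambda>\<omega>. ?I (W n \<omega>) * H b c (W n \<omega>) * ((\<xi> n \<omega> \<bullet> b) * (\<xi> n \<omega> \<bullet> c)))
      (if b = c then s * expectation (\<lambda>\<omega>. ?I (W n \<omega>) * H b b (W n \<omega>)) else 0)" if b: "b \<in> Basis" "c \<in> Basis" for b c
  proof -
    obtain B where B: "\<And>y. \<bar>?I y * H b c y\<bar> \<le> B" using ind[OF H[OF b]] by blast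
    have *: "(\<lambda>y. ?I y * H b c y) \<in> borel_measurable borel" using ind[OF H[OF b]] by blast
    show ?thesis
      using stopped_walk_indep[OF indep[of "Suc n"] Kb * B, of "\<lambda>z. (z \<bullet> b) * (z \<bullet> c)" x] m2[OF b, of n]
      by (auto simp: has_bochner_integral_iff W_def)
  qed
  have Hi: "integrable M (\<lambda>\<omega>. ?I (W n \<omega>) * H b b (W n \<omega>))" if b: "b \<in> Basis" for b
  proof -
    obtain B where B: "\<And>y. \<bar>?I y * H b b y\<bar> \<le> B" using ind[OF H[OF b b]] by blast
    have *: "(\<lambda>y. ?I y * H b b y) \<in> borel_measurable borel" using ind[OF H[OF b b]] by blast
    show ?thesis
      using measurable_compose[OF Wm *] B by (intro integrable_const_bound[where B = B]) auto
  qed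
  have "(\<Sum>b\<in>Basis. \<Sum>c\<in>Basis. (if b = c then s * expectation (\<lambda>\<omega>. ?I (W n \<omega>) * H b b (W n \<omega>)) else 0))
      = (\<Sum>b\<in>Basis. s * expectation (\<lambda>\<omega>. ?I (W n \<omega>) * H b b (W n \<omega>)))"
    by (intro sum.cong refl) simp
  also have "\<dots> = s * expectation (\<lambda>\<omega>. \<Sum>b\<in>Basis. ?I (W n \<omega>) * H b b (W n \<omega>))"
    by (subst Bochner_Integration.integral_sum[OF Hi]) (simp_all only: sum_distrib_left)
  also have "(\<lambda>\<omega>. \<Sum>b\<in>Basis. ?I (W n \<omega>) * H b b (W n \<omega>)) = (\<lambda>_. 0)"
    using lap by (auto simp: fun_eq_iff sum_distrib_left[symmetric] indicator_def)
  finally have S0: "(\<Sum>b\<in>Basis. \<Sum>c\<in>Basis. (if b = c then s * expectation (\<lambda>\<omega>. ?I (W n \<omega>) * H b b (W n \<omega>)) else 0)) = 0"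
    by simp
  have "has_bochner_integral M R ((expectation (\<lambda>\<omega>. hb (W (Suc n) \<omega>)) - expectation (\<lambda>\<omega>. hb (W n \<omega>)))
      - (\<Sum>b\<in>(Basis::'b set). 0) - (\<Sum>b\<in>Basis. \<Sum>c\<in>Basis.
        (if b = c then s * expectation (\<lambda>\<omega>. ?I (W n \<omega>) * H b b (W n \<omega>)) else 0)) / 2)"
    unfolding R_def[abs_def]
    by (intro has_bochner_integral_diff has_bochner_integral_sum has_bochner_integral_divide A Bc
        has_bochner_integral_integrable hWi)
  then have R: "integrable M R" "expectation R = expectation (\<lambda>\<omega>. hb (W (Suc n) \<omega>)) - expectation (\<lambda>\<omega>. hb (W n \<omega>))"
    unfolding S0 by (auto simp: has_bochner_integral_iff)
  have Rb: "has_bochner_integral M (\<lambda>\<omega>. e * (\<Sum>b\<in>Basis. (\<xi> n \<omega> \<bullet> b) * (\<xi> n \<omega> \<bullet> b)) + C * (\<Sum>b\<in>Basis. (\<xi> n \<omega> \<bullet> b) ^ 4))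
      (e * (\<Sum>b\<in>(Basis::'b set). if b = b then s else 0) + C * (\<Sum>b\<in>(Basis::'b set). 3 * s\<^sup>2))"
    by (intro has_bochner_integral_add has_bochner_integral_mult_right has_bochner_integral_sum m2 m4)
  have "\<bar>R \<omega>\<bar> \<le> e * (\<Sum>b\<in>Basis. (\<xi> n \<omega> \<bullet> b) * (\<xi> n \<omega> \<bullet> b)) + C * (\<Sum>b\<in>Basis. (\<xi> n \<omega> \<bullet> b) ^ 4)" for \<omega>
  proof (cases "W n \<omega> \<in> K")
    case True
    then show ?thesis
      using taylor[OF True, of "\<xi> n \<omega>"] by (simp add: R_def) (simp add: W_def)
  next
    case False
    then have "R \<omega> = 0" by (simp add: R_def) (simp add: W_def)
    moreover have "0 \<le> (\<Sum>b\<in>Basis. (\<xi> n \<omega> \<bullet> b) * (\<xi> n \<omega> \<bullet> b))" "0 \<le> (\<Sum>b\<in>Basis. (\<xi> n \<omega> \<bullet> b) ^ 4)"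
      by (intro sum_nonneg; simp)+
    ultimately show ?thesis using eC by simp
  qed
  then have "expectation (\<lambda>\<omega>. \<bar>R \<omega>\<bar>) \<le> expectation (\<lambda>\<omega>. e * (\<Sum>b\<in>Basis. (\<xi> n \<omega> \<bullet> b) * (\<xi> n \<omega> \<bullet> b)) + C * (\<Sum>b\<in>Basis. (\<xi> n \<omega> \<bullet> b) ^ 4))"
    using R(1) Rb by (intro integral_mono) (auto simp: has_bochner_integral_iff)
  also have "\<dots> = real DIM('b) * (e * s + C * (3 * s\<^sup>2))"
    using has_bochner_integral_integral_eq[OF Rb] by (simp add: algebra_simps)
  finally show ?thesis
    using integral_abs_bound[of M R] R(2) by simp
qed

lemma (in prob_space) telescoping_expectation_bound:
  fixes W :: "nat \<Rightarrow> 'a \<Rightarrow> 'b" and hb :: "'b \<Rightarrow> real"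
  assumes step: "\<And>n. \<bar>expectation (\<lambda>\<omega>. hb (W (Suc n) \<omega>)) - expectation (\<lambda>\<omega>. hb (W n \<omega>))\<bar> \<le> d"
    and W0: "\<And>\<omega>. W 0 \<omega> = x"
  shows "\<bar>expectation (\<lambda>\<omega>. hb (W n \<omega>)) - hb x\<bar> \<le> real n * d"
proof (induction n)
  case 0
  then show ?case by (simp add: W0 prob_space)
next
  case (Suc n)
  then show ?case using step[of n] by (simp add: algebra_simps)
qed

text \<open>\<open>brownian_motion_from\<close> describes projections onto single unit vectors.
  Mixed second moments come by polarisation from the projection onto b + c, whose length need not be
  1; hence \<open>mom2\<close> for vectors of any length. The factor 3 is the fourth moment of the
  standard normal law.\<close>

lemma brownian_increment_moments:
  fixes X :: "real \<Rightarrow> 'w \<Rightarrow> 'a::euclidean_space"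
  assumes BM: "brownian_motion_from M X x" and st: "0 \<le> s" "s < t"
  shows "b \<in> Basis \<Longrightarrow> has_bochner_integral M (\<lambda>\<omega>. (X t \<omega> - X s \<omega>) \<bullet> b) 0"
    and "b \<in> Basis \<Longrightarrow> c \<in> Basis \<Longrightarrow>
      has_bochner_integral M (\<lambda>\<omega>. ((X t \<omega> - X s \<omega>) \<bullet> b) * ((X t \<omega> - X s \<omega>) \<bullet> c)) (if b = c then t - s else 0)"
    and "b \<in> Basis \<Longrightarrow> has_bochner_integral M (\<lambda>\<omega>. ((X t \<omega> - X s \<omega>) \<bullet> b) ^ 4) (3 * (t - s)\<^sup>2)"
proof -
  let ?Z = "\<lambda>\<omega>. X t \<omega> - X s \<omega>"
  define \<sigma> where "\<sigma> = sqrt (t - s)"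
  have \<sigma>: "0 < \<sigma>" "\<sigma>\<^sup>2 = t - s" using st by (auto simp: \<sigma>_def)
  have dist: "distributed M lborel (\<lambda>\<omega>. v \<bullet> ?Z \<omega>) (\<lambda>y. ennreal (normal_density 0 \<sigma> y))" if "norm v = 1" for v
    using BM st that by (auto simp: brownian_motion_from_def \<sigma>_def)
  have mom: "has_bochner_integral M (\<lambda>\<omega>. (v \<bullet> ?Z \<omega>) ^ k) I"
    if "norm v = 1" "has_bochner_integral lborel (\<lambda>y. normal_density 0 \<sigma> y * y ^ k) I" for v k I
    using that(2) distributed_integral[OF dist[OF that(1)], of "\<lambda>y. y ^ k"]
      distributed_integrable[OF dist[OF that(1)], of "\<lambda>y. y ^ k"]
    by (auto simp: has_bochner_integral_iff)
  have mom2: "has_bochner_integral M (\<lambda>\<omega>. (v \<bullet> ?Z \<omega>)\<^sup>2) ((t - s) * (norm v)\<^sup>2)" for v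
  proof (cases "v = 0")
    case False
    have "has_bochner_integral lborel (\<lambda>y. normal_density 0 \<sigma> y * y\<^sup>2) (t - s)"
      using normal_moment_even[OF \<sigma>(1), of 0 1] \<sigma>(2) by (simp add: diff_divide_distrib)
    then have "has_bochner_integral M (\<lambda>\<omega>. (sgn v \<bullet> ?Z \<omega>)\<^sup>2) (t - s)"
      using mom[of "sgn v" 2] False by (simp add: norm_sgn)
    from has_bochner_integral_mult_right[OF this, of "(norm v)\<^sup>2"]
    show ?thesis
      using False by (simp add: sgn_div_norm power_mult_distrib power_inverse mult.commute[of "t - s"] flip: mult.assoc)
  qed (simp add: has_bochner_integral_zero)
  show "has_bochner_integral M (\<lambda>\<omega>. ?Z \<omega> \<bullet> b) 0" if "b \<in> Basis"
    using mom[of b 1 0] normal_moment_odd[OF \<sigma>(1), of 0 0] that by (simp add: inner_commute)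
  show "has_bochner_integral M (\<lambda>\<omega>. (?Z \<omega> \<bullet> b) ^ 4) (3 * (t - s)\<^sup>2)" if "b \<in> Basis"
    using mom[of b 4] normal_moment_even[OF \<sigma>(1), of 0 2] that \<sigma>(2)
    by (simp add: inner_commute fact_numeral power_divide)
  show "has_bochner_integral M (\<lambda>\<omega>. (?Z \<omega> \<bullet> b) * (?Z \<omega> \<bullet> c)) (if b = c then t - s else 0)"
    if bc: "b \<in> Basis" "c \<in> Basis"
  proof -
    have "has_bochner_integral M (\<lambda>\<omega>. (((b + c) \<bullet> ?Z \<omega>)\<^sup>2 - (b \<bullet> ?Z \<omega>)\<^sup>2 - (c \<bullet> ?Z \<omega>)\<^sup>2) / 2)
        (((t - s) * (norm (b + c))\<^sup>2 - (t - s) * (norm b)\<^sup>2 - (t - s) * (norm c)\<^sup>2) / 2)"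
      by (intro has_bochner_integral_divide has_bochner_integral_diff mom2)
    also have "(\<lambda>\<omega>. (((b + c) \<bullet> ?Z \<omega>)\<^sup>2 - (b \<bullet> ?Z \<omega>)\<^sup>2 - (c \<bullet> ?Z \<omega>)\<^sup>2) / 2) = (\<lambda>\<omega>. (?Z \<omega> \<bullet> b) * (?Z \<omega> \<bullet> c))"
      by (simp add: fun_eq_iff inner_add_left power2_sum inner_commute)
    also have "((t - s) * (norm (b + c))\<^sup>2 - (t - s) * (norm b)\<^sup>2 - (t - s) * (norm c)\<^sup>2) / 2 = (if b = c then t - s else 0)"
      using bc by (simp add: power2_norm_eq_inner inner_add_left inner_add_right inner_Basis)
    finally show ?thesis .
  qed
qed

section \<open>Exit times of continuous paths\<close>

text \<open>The increments telescope up to the first grid index at which the path is outside K;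
  \<open>j\<close> is that index, or n if K is not left before.\<close>

lemma stopped_walk_path:
  assumes "\<gamma> 0 = x"
  shows "\<exists>j\<le>n. stopped_walk K x (\<lambda>i. \<gamma> (real (Suc i) * s) - \<gamma> (real i * s)) n = \<gamma> (real j * s) \<and>
    (\<forall>i<j. \<gamma> (real i * s) \<in> K) \<and> (j = n \<or> \<gamma> (real j * s) \<notin> K)"
proof (induction n)
  case 0
  then show ?case using assms by simp
next
  case (Suc n)
  then obtain j where j: "j \<le> n" "stopped_walk K x (\<lambda>i. \<gamma> (real (Suc i) * s) - \<gamma> (real i * s)) n = \<gamma> (real j * s)"
    "\<forall>i<j. \<gamma> (real i * s) \<in> K" "j = n \<or> \<gamma> (real j * s) \<notin> K" by blast
  show ?case
  proof (cases "\<gamma> (real j * s) \<in> K")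
    case True
    then have "j = n" using j by blast
    then show ?thesis using j True by (intro exI[of _ "Suc n"]) (auto simp: less_Suc_eq)
  next
    case False
    then show ?thesis using j by (intro exI[of _ j]) auto
  qed
qed

text \<open>Differs from \<open>exit_time\<close> in admitting t = 0 and in taking a single path;
  for a start on the boundary of K it may be 0.\<close>

definition first_exit :: "'a set \<Rightarrow> (real \<Rightarrow> 'a) \<Rightarrow> real" where
  "first_exit K \<gamma> = Inf {t. 0 \<le> t \<and> \<gamma> t \<notin> K}"

lemma first_exit_le: "0 \<le> t \<Longrightarrow> \<gamma> t \<notin> K \<Longrightarrow> first_exit K \<gamma> \<le> t"
  unfolding first_exit_def by (rule cInf_lower) (auto intro: bdd_belowI[of _ 0])

lemma le_first_exit:
  assumes "0 \<le> t" "\<gamma> t \<notin> K" "\<And>s. 0 \<le> s \<Longrightarrow> s < a \<Longrightarrow> \<gamma> s \<in> K"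
  shows "a \<le> first_exit K \<gamma>"
  unfolding first_exit_def
  by (rule cInf_greatest) (use assms in \<open>auto simp: not_less[symmetric]\<close>)

lemma path_leaves_open:
  fixes \<gamma> :: "real \<Rightarrow> 'a::metric_space"
  assumes cont: "continuous_on {0..} \<gamma>" and K: "closed K" and t: "0 \<le> t" "\<gamma> t \<notin> K"
  obtains \<theta> where "0 < \<theta>" "\<And>s. 0 \<le> s \<Longrightarrow> \<bar>s - t\<bar> < \<theta> \<Longrightarrow> \<gamma> s \<notin> K"
proof -
  obtain e where e: "0 < e" "\<And>z. dist z (\<gamma> t) < e \<Longrightarrow> z \<notin> K"
    using K t(2) open_dist[of "- K"] by (auto simp: closed_def)
  have "t \<in> {0..}" using t(1) by simp
  from cont[unfolded continuous_on_iff, rule_format, OF this e(1)]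
  obtain \<theta> where "0 < \<theta>" "\<And>s. s \<in> {0..} \<Longrightarrow> dist s t < \<theta> \<Longrightarrow> dist (\<gamma> s) (\<gamma> t) < e"
    by blast
  then show thesis using that e(2) by (auto simp: dist_real_def)
qed

text \<open>The complement of K is open, so a path outside K at time \<sigma> > 0 would be outside
  slightly earlier as well, against the infimum.\<close>

lemma path_at_first_exit:
  fixes \<gamma> :: "real \<Rightarrow> 'a::metric_space"
  assumes cont: "continuous_on {0..} \<gamma>" and K: "closed K" "\<gamma> 0 \<in> K"
    and \<sigma>: "0 \<le> \<sigma>" "\<sigma> \<le> first_exit K \<gamma>"
  shows "\<gamma> \<sigma> \<in> K"
proof (rule ccontr)
  assume a: "\<gamma> \<sigma> \<notin> K"
  then obtain \<theta> where \<theta>: "0 < \<theta>" "\<And>s. 0 \<le> s \<Longrightarrow> \<bar>s - \<sigma>\<bar> < \<theta> \<Longrightarrow> \<gamma> s \<notin> K"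
    using path_leaves_open[OF cont K(1) \<sigma>(1)] by blast
  have "\<sigma> \<noteq> 0" using a K by auto
  then have "0 < \<sigma>" using \<sigma> by simp
  define t where "t = max 0 (\<sigma> - \<theta> / 2)"
  have t: "0 \<le> t" "t < \<sigma>" "\<bar>t - \<sigma>\<bar> < \<theta>" using \<open>0 < \<sigma>\<close> \<theta>(1) by (auto simp: t_def max_def)
  then have "first_exit K \<gamma> \<le> t" using \<theta>(2) by (intro first_exit_le) auto
  then show False using \<sigma> t by simp
qed

lemma first_exit_nonneg: "0 \<le> t \<Longrightarrow> \<gamma> t \<notin> K \<Longrightarrow> 0 \<le> first_exit K \<gamma>"
  by (rule le_first_exit) auto

text \<open>A grid cannot notice an exit before it happens; and once outside K the path stays
  outside for a while, so a fine enough grid has a point in that interval. The horizon T keeps the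
  number of steps finite.\<close>

lemma stopped_walk_tendsto:
  fixes \<gamma> :: "real \<Rightarrow> 'a::euclidean_space"
  assumes cont: "continuous_on {0..} \<gamma>" and \<gamma>0: "\<gamma> 0 = x" and K: "closed K"
    and ex: "0 \<le> t0" "\<gamma> t0 \<notin> K" and T: "0 < T"
  shows "(\<lambda>n. stopped_walk K x (\<lambda>i. \<gamma> (real (Suc i) * (T / real (Suc n))) - \<gamma> (real i * (T / real (Suc n)))) (Suc n))
    \<longlonglongrightarrow> \<gamma> (min (first_exit K \<gamma>) T)"
proof -
  define \<sigma> where "\<sigma> = min (first_exit K \<gamma>) T"
  have \<sigma>0: "0 \<le> \<sigma>" using first_exit_nonneg[of t0 \<gamma>, OF ex] T by (simp add: \<sigma>_def)
  let ?s = "\<lambda>n. T / real (Suc n)"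
  have "\<forall>n. \<exists>j. j \<le> Suc n \<and> stopped_walk K x (\<lambda>i. \<gamma> (real (Suc i) * ?s n) - \<gamma> (real i * ?s n)) (Suc n) = \<gamma> (real j * ?s n) \<and>
    (\<forall>i<j. \<gamma> (real i * ?s n) \<in> K) \<and> (j = Suc n \<or> \<gamma> (real j * ?s n) \<notin> K)"
    by (intro allI stopped_walk_path[of \<gamma> x, OF \<gamma>0])
  from choice[OF this] obtain j where jj: "\<forall>n. j n \<le> Suc n \<and>
    stopped_walk K x (\<lambda>i. \<gamma> (real (Suc i) * ?s n) - \<gamma> (real i * ?s n)) (Suc n) = \<gamma> (real (j n) * ?s n) \<and>
    (\<forall>i<j n. \<gamma> (real i * ?s n) \<in> K) \<and> (j n = Suc n \<or> \<gamma> (real (j n) * ?s n) \<notin> K)" ..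
  have j: "j n \<le> Suc n"
    "stopped_walk K x (\<lambda>i. \<gamma> (real (Suc i) * ?s n) - \<gamma> (real i * ?s n)) (Suc n) = \<gamma> (real (j n) * ?s n)"
    "i < j n \<Longrightarrow> \<gamma> (real i * ?s n) \<in> K" "j n = Suc n \<or> \<gamma> (real (j n) * ?s n) \<notin> K" for n i
    using jj[rule_format, of n] by blast+
  define \<tau> where "\<tau> n = real (j n) * ?s n" for n
  have s0: "0 < ?s n" for n using T by simp
  have \<tau>0: "0 \<le> \<tau> n" for n using T by (simp add: \<tau>_def)
  have lower: "\<sigma> \<le> \<tau> n" for n
  proof (cases "j n = Suc n")
    case True
    then have "\<tau> n = T" by (simp add: \<tau>_def del: of_nat_Suc)
    then show ?thesis by (simp add: \<sigma>_def)
  next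
    case False
    then have "first_exit K \<gamma> \<le> \<tau> n"
      using j(4)[of n] \<tau>0[of n] by (intro first_exit_le) (auto simp: \<tau>_def)
    then show ?thesis by (simp add: \<sigma>_def)
  qed
  have "\<tau> \<longlonglongrightarrow> \<sigma>"
  proof (rule order_tendstoI)
    fix a assume "a < \<sigma>"
    then show "\<forall>\<^sub>F n in sequentially. a < \<tau> n"
      by (intro always_eventually allI less_le_trans[OF _ lower])
  next
    fix a assume a: "\<sigma> < a"
    show "\<forall>\<^sub>F n in sequentially. \<tau> n < a"
    proof (cases "T < a")
      case True
      have "\<tau> n \<le> T" for n
      proof -
        have "real (j n) * ?s n \<le> real (Suc n) * ?s n"
          using j(1)[of n] s0[of n] by (intro mult_right_mono) (simp_all del: of_nat_Suc)
        then show ?thesis by (simp add: \<tau>_def del: of_nat_Suc)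
      qed
      then show ?thesis using True le_less_trans by (intro always_eventually allI) blast
    next
      case False
      then have aT: "a \<le> T" "first_exit K \<gamma> < a" using a by (auto simp: \<sigma>_def min_def split: if_splits)
      have "{t. 0 \<le> t \<and> \<gamma> t \<notin> K} \<noteq> {}" using ex by blast
      \<comment> \<open>Right after the infimum the path may return to K again and again; it is
        enough that at some t' before a it is outside, together with a neighbourhood of
        times.\<close>
      from cInf_lessD[OF this] aT(2) obtain t' where t': "0 \<le> t'" "\<gamma> t' \<notin> K" "t' < a"
        unfolding first_exit_def by blast
      obtain \<theta> where \<theta>: "0 < \<theta>" "\<And>s. 0 \<le> s \<Longrightarrow> \<bar>s - t'\<bar> < \<theta> \<Longrightarrow> \<gamma> s \<notin> K"
        using path_leaves_open[OF cont K t'(1,2)] by blast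
      have "?s \<longlonglongrightarrow> 0"
        by (rule LIMSEQ_Suc[of "\<lambda>n. T / real n"]) (rule lim_const_over_n)
      then have "\<forall>\<^sub>F n in sequentially. ?s n < min \<theta> (a - t')"
        using \<theta>(1) t'(3) by (intro order_tendstoD) auto
      then show ?thesis
      proof eventually_elim
        case (elim n)
        \<comment> \<open>The first grid index at or after t'; its time is within one mesh of t',
          hence in the interval spent outside K.\<close>
        define i where "i = nat \<lceil>t' / ?s n\<rceil>"
        have "0 \<le> t' / ?s n" using t'(1) T by (intro divide_nonneg_nonneg) auto
        then have "0 \<le> \<lceil>t' / ?s n\<rceil>" by linarith
        then have "real i = of_int \<lceil>t' / ?s n\<rceil>" by (simp add: i_def del: of_nat_Suc)
        then have i0: "t' / ?s n \<le> real i" "real i < t' / ?s n + 1"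
          using le_of_int_ceiling[of "t' / ?s n"] of_int_ceiling_le_add_one ceiling_correct[of "t' / ?s n"] by linarith+
        have "t' \<le> real i * s \<and> real i * s < t' + s" if "t' / s \<le> real i" "real i < t' / s + 1" "0 < s" for s
          using that by (simp add: field_simps)
        from this[OF i0 s0] have i: "t' \<le> real i * ?s n" "real i * ?s n < t' + ?s n" by blast+
        have "\<gamma> (real i * ?s n) \<notin> K"
          using i elim t'(1) by (intro \<theta>(2)) auto
        then have "j n \<le> i" using j(3)[of i n] by (meson not_less)
        then have "\<tau> n \<le> real i * ?s n"
          unfolding \<tau>_def using s0[of n] by (intro mult_right_mono) auto
        then show ?case using i(2) elim by simp
      qed
    qed
  qed
  then have "(\<lambda>n. \<gamma> (\<tau> n)) \<longlonglongrightarrow> \<gamma> \<sigma>"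
    by (rule continuous_on_tendsto_compose[OF cont]) (use \<sigma>0 \<tau>0 in auto)
  then show ?thesis
    unfolding j(2) by (simp add: \<tau>_def \<sigma>_def)
qed

lemma path_exit_time:
  fixes \<gamma> :: "real \<Rightarrow> 'a::euclidean_space"
  assumes cont: "continuous_on {0..} \<gamma>" and D: "open D" "\<gamma> 0 \<in> D" and ex: "0 < t0" "\<gamma> t0 \<notin> D"
  defines "\<tau> \<equiv> Inf {t. 0 < t \<and> \<gamma> t \<notin> D}"
  shows "0 < \<tau>" "\<gamma> \<tau> \<in> frontier D" "\<And>t. 0 \<le> t \<Longrightarrow> t < \<tau> \<Longrightarrow> \<gamma> t \<in> D"
proof -
  let ?S = "{t. 0 < t \<and> \<gamma> t \<notin> D}"
  have bdd: "bdd_below ?S" by (rule bdd_belowI[of _ 0]) auto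
  have ne: "?S \<noteq> {}" using ex by blast
  have cl: "closed (- D)" using D by auto
  obtain \<theta> where \<theta>: "0 < \<theta>" "\<And>s. 0 \<le> s \<Longrightarrow> \<bar>s - 0\<bar> < \<theta> \<Longrightarrow> \<gamma> s \<in> D"
    using path_leaves_open[OF cont cl, of 0] D(2) by auto
  have "\<theta> \<le> \<tau>"
    unfolding \<tau>_def
  proof (rule cInf_greatest[OF ne])
    fix s assume "s \<in> ?S"
    then show "\<theta> \<le> s" using \<theta>(2)[of s] by (cases "s < \<theta>") auto
  qed
  then show pos: "0 < \<tau>" using \<theta> by simp
  show inD: "\<gamma> t \<in> D" if "0 \<le> t" "t < \<tau>" for t
  proof (rule ccontr)
    assume n: "\<gamma> t \<notin> D"
    then have "t \<noteq> 0" using D by auto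
    then have "\<tau> \<le> t" unfolding \<tau>_def using that n by (intro cInf_lower[OF _ bdd]) auto
    then show False using that by simp
  qed
  have nD: "\<gamma> \<tau> \<notin> D"
  proof
    assume a: "\<gamma> \<tau> \<in> D"
    have "0 \<le> \<tau>" "\<gamma> \<tau> \<notin> - D" using pos a by auto
    from path_leaves_open[OF cont cl this]
    obtain e where e: "0 < e" "\<And>s. 0 \<le> s \<Longrightarrow> \<bar>s - \<tau>\<bar> < e \<Longrightarrow> \<gamma> s \<in> D"
      by auto
    have "Inf ?S < \<tau> + e" using e(1) by (simp add: \<tau>_def)
    from cInf_lessD[OF ne this] obtain s where s: "0 < s" "\<gamma> s \<notin> D" "s < \<tau> + e" by blast
    have "\<tau> \<le> s" unfolding \<tau>_def using s by (intro cInf_lower[OF _ bdd]) auto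
    then show False using e(2)[of s] s by auto
  qed
  \<comment> \<open>Times approaching \<tau> from below: the path is in D there, so its value at
    \<tau> lies in the closure.\<close>
  define u where "u n = \<tau> * (1 - inverse (real (Suc n)))" for n
  have u: "0 \<le> u n" "u n < \<tau>" for n
  proof -
    have "inverse (real (Suc n)) \<le> 1" by (simp add: field_simps)
    then show "0 \<le> u n" using pos unfolding u_def by (intro mult_nonneg_nonneg) linarith+
    have "0 < \<tau> * inverse (real (Suc n))" using pos by simp
    then show "u n < \<tau>" unfolding u_def right_diff_distrib by linarith
  qed
  have "(\<lambda>n. \<tau> * (1 - inverse (real (Suc n)))) \<longlonglongrightarrow> \<tau> * (1 - 0)"
    by (intro tendsto_intros LIMSEQ_inverse_real_of_nat)
  then have "u \<longlonglongrightarrow> \<tau>" by (simp add: u_def[abs_def])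
  then have "(\<lambda>n. \<gamma> (u n)) \<longlonglongrightarrow> \<gamma> \<tau>"
    by (rule continuous_on_tendsto_compose[OF cont]) (simp_all add: u pos less_imp_le)
  moreover have "\<gamma> (u n) \<in> D" for n
    by (rule inD[OF u])
  ultimately have "\<gamma> \<tau> \<in> closure D"
    unfolding closure_sequential by (intro exI[of _ "\<lambda>n. \<gamma> (u n)"]) simp
  then show "\<gamma> \<tau> \<in> frontier D" using nD D by (simp add: frontier_def interior_open)
qed

text \<open>Up to a time b < \<tau> the path traces a compact subset of D, which keeps a positive
  distance from the complement and so lies in \<open>K m\<close> for large m.\<close>

lemma first_exit_exhaustion_tendsto:
  fixes \<gamma> :: "real \<Rightarrow> 'a::euclidean_space"
  assumes cont: "continuous_on {0..} \<gamma>" and D: "open D" "\<gamma> 0 \<in> D" and ex: "0 < t0" "\<gamma> t0 \<notin> D"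
    and \<rho>: "0 < \<rho>"
  defines "\<tau> \<equiv> Inf {t. 0 < t \<and> \<gamma> t \<notin> D}" and "K \<equiv> \<lambda>m. {z. \<rho> / real (Suc m) \<le> infdist z (- D)}"
  shows "(\<lambda>m. min (first_exit (K m) \<gamma>) (real (Suc m))) \<longlonglongrightarrow> \<tau>"
proof -
  note pe = path_exit_time[OF cont D ex, folded \<tau>_def]
  have cl: "closed (- D)" and ne: "- D \<noteq> {}" using D ex by auto
  have \<tau>D: "\<gamma> \<tau> \<notin> D" using pe(2) D by (simp add: frontier_def interior_open)
  have KD: "K m \<subseteq> D" for m
  proof
    fix z assume "z \<in> K m"
    then have "\<rho> / real (Suc m) \<le> infdist z (- D)" by (simp add: K_def)
    moreover have "0 < \<rho> / real (Suc m)" using \<rho> by simp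
    ultimately have "0 < infdist z (- D)" by (rule less_le_trans[rotated])
    then show "z \<in> D" using infdist_zero[of z "- D"] by (cases "z \<in> D") auto
  qed
  have up: "first_exit (K m) \<gamma> \<le> \<tau>" for m
    using pe(1) \<tau>D KD[of m] by (intro first_exit_le) auto
  show ?thesis
  proof (rule order_tendstoI)
    fix a assume "\<tau> < a"
    moreover have "min (first_exit (K m) \<gamma>) (real (Suc m)) \<le> \<tau>" for m
      using up[of m] by (rule min.coboundedI1)
    ultimately show "\<forall>\<^sub>F m in sequentially. min (first_exit (K m) \<gamma>) (real (Suc m)) < a"
      using le_less_trans by (intro always_eventually allI) blast
  next
    fix a assume a: "a < \<tau>"
    \<comment> \<open>A time strictly between a and \<tau>, lifted to 0 in case a is
      negative.\<close>
    define b where "b = max 0 ((a + \<tau>) / 2)"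
    have b: "0 \<le> b" "b < \<tau>" "a < b" using a pe(1) by (auto simp: b_def max_def)
    have cp: "compact (\<gamma> ` {0..b})"
      by (intro compact_continuous_image continuous_on_subset[OF cont]) auto
    have ne': "\<gamma> ` {0..b} \<noteq> {}" using b(1) by simp
    have ci: "continuous_on (\<gamma> ` {0..b}) (\<lambda>z. infdist z (- D))"
      by (intro continuous_on_infdist continuous_on_id)
    from continuous_attains_inf[OF cp ne' ci] obtain q where q: "q \<in> \<gamma> ` {0..b}" "\<And>z. z \<in> \<gamma> ` {0..b} \<Longrightarrow> infdist q (- D) \<le> infdist z (- D)"
      by blast
    have "q \<in> D" using q(1) pe(3) b by auto
    then have c: "0 < infdist q (- D)"
      by (intro infdist_pos_not_in_closed cl ne) simp
    have "(\<lambda>m. \<rho> / real (Suc m)) \<longlonglongrightarrow> 0"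
      by (rule LIMSEQ_Suc[of "\<lambda>n. \<rho> / real n"]) (rule lim_const_over_n)
    then have "\<forall>\<^sub>F m in sequentially. \<rho> / real (Suc m) < infdist q (- D)"
      using c by (intro order_tendstoD) auto
    moreover have "\<forall>\<^sub>F m in sequentially. b < real (Suc m)"
      using eventually_gt_at_top[of "nat \<lceil>b\<rceil>"] by eventually_elim linarith
    ultimately show "\<forall>\<^sub>F m in sequentially. a < min (first_exit (K m) \<gamma>) (real (Suc m))"
    proof eventually_elim
      case (elim m)
      have "b \<le> first_exit (K m) \<gamma>"
      proof (rule le_first_exit)
        show "0 \<le> \<tau>" "\<gamma> \<tau> \<notin> K m" using pe(1) \<tau>D KD[of m] by auto
        show "\<gamma> s \<in> K m" if "0 \<le> s" "s < b" for s
          using q(2)[of "\<gamma> s"] that elim(1) by (auto simp: K_def)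
      qed
      then show ?case using elim b by simp
    qed
  qed
qed

section \<open>From stopped walks to the exit law\<close>

lemma filterlim_at_within_sequenceI:
  assumes "u \<longlonglongrightarrow> y" "\<And>n. u n \<in> D" "y \<notin> D"
  shows "filterlim u (at y within D) sequentially"
  using assms by (auto simp: filterlim_at intro!: always_eventually)

text \<open>A sequence along which |h| is unbounded would cluster in the closure of D, where h has a
  finite limit: by continuity inside D, by the boundary values on the frontier.\<close>

lemma Dirichlet_solution_bounded:
  fixes h :: "'a::euclidean_space \<Rightarrow> real"
  assumes D: "open D" "bounded D" and h: "continuous_on D h"
    and lim: "\<And>y. y \<in> frontier D \<Longrightarrow> (h \<longlongrightarrow> \<phi> y) (at y within D)"
  obtains B where "\<And>x. x \<in> D \<Longrightarrow> \<bar>h x\<bar> \<le> B"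
proof (rule ccontr)
  assume "\<not> thesis"
  then have "\<forall>n::nat. \<exists>z. z \<in> D \<and> real n < \<bar>h z\<bar>"
    using that by (meson not_le)
  then obtain z where z: "\<And>n. z n \<in> D" "\<And>n. real n < \<bar>h (z n)\<bar>" by metis
  have "compact (closure D)" using D(2) by simp
  moreover have "\<forall>n. z n \<in> closure D" using z(1) closure_subset by blast
  ultimately obtain l r where lr: "l \<in> closure D" "strict_mono (r :: nat \<Rightarrow> nat)" "(z \<circ> r) \<longlonglongrightarrow> l"
    unfolding compact_def by blast
  have "convergent (\<lambda>n. h ((z \<circ> r) n))"
  proof (cases "l \<in> D")
    case True
    then have "(\<lambda>n. h ((z \<circ> r) n)) \<longlonglongrightarrow> h l"
      by (intro continuous_on_tendsto_compose[OF h lr(3)]) (auto simp: z(1))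
    then show ?thesis by (auto simp: convergent_def)
  next
    case False
    then have "l \<in> frontier D" using lr(1) D(1) by (simp add: frontier_def interior_open)
    from filterlim_compose[OF lim[OF this] filterlim_at_within_sequenceI[OF lr(3) _ False]] z(1)
    show ?thesis by (auto simp: convergent_def)
  qed
  then have "Bseq (\<lambda>n. h ((z \<circ> r) n))" by (rule convergent_imp_Bseq)
  then obtain B where "0 < B" "\<forall>n. norm (h ((z \<circ> r) n)) \<le> B" by (rule BseqE)
  then have B: "\<bar>h (z (r n))\<bar> \<le> B" for n by simp
  obtain n :: nat where "B < real n" using reals_Archimedean2 by blast
  then show False
    using B[of n] z(2)[of "r n"] seq_suble[OF lr(2), of n] by linarith
qed

text \<open>At time n one coordinate of the displacement has density at most 1 / sqrt n, so the
  probability that it stays in a fixed bounded interval tends to 0.\<close>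

lemma AE_brownian_exits:
  fixes X :: "real \<Rightarrow> 'w \<Rightarrow> 'a::euclidean_space"
  assumes BM: "brownian_motion_from M X x" and D: "bounded D" "x \<in> D"
  shows "AE \<omega> in M. \<exists>n. 0 < n \<and> X (real n) \<omega> \<notin> D"
proof -
  interpret prob_space M using BM by (simp add: brownian_motion_from_def)
  have Xm [measurable]: "X t \<in> borel_measurable M" if "0 \<le> t" for t
    using BM that by (simp add: brownian_motion_from_def)
  obtain L where L: "\<And>z. z \<in> D \<Longrightarrow> norm z \<le> L" using D(1) by (auto simp: bounded_iff)
  have L0: "0 \<le> L" using L[OF D(2)] norm_ge_zero order_trans by blast
  obtain v :: 'a where v: "v \<in> Basis" using nonempty_Basis by blast
  define Z where "Z n \<omega> = v \<bullet> (X (real (Suc n)) \<omega> - X 0 \<omega>)" for n \<omega>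
  have Zm: "Z n \<in> borel_measurable M" for n
    using Xm[of "real (Suc n)"] Xm[of 0] unfolding Z_def by simp
  have dist: "distributed M lborel (Z n) (\<lambda>y. ennreal (normal_density 0 (sqrt (real (Suc n))) y))" for n
  proof -
    have "\<forall>s t v. 0 \<le> s \<and> s < t \<and> norm v = 1 \<longrightarrow> distributed M lborel (\<lambda>\<omega>. v \<bullet> (X t \<omega> - X s \<omega>))
          (\<lambda>y. ennreal (normal_density 0 (sqrt (t - s)) y))"
      using BM by (simp add: brownian_motion_from_def)
    from this[rule_format, of 0 "real (Suc n)" v] v show ?thesis
      by (simp add: Z_def[abs_def])
  qed
  \<comment> \<open>Contains, up to a null set, every path that is in D at all positive integer
    times, since points of D have norm at most L.\<close>
  define A where "A = (\<Inter>n. Z n -` {- (2 * L)..2 * L} \<inter> space M)"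
  have Am: "A \<in> sets M"
    unfolding A_def using Zm by (intro sets.countable_INT) (auto intro: measurable_sets)
  have bound: "emeasure M A \<le> ennreal (4 * L / sqrt (real (Suc n)))" for n
  proof -
    have "emeasure M A \<le> emeasure M (Z n -` {- (2 * L)..2 * L} \<inter> space M)"
      by (intro emeasure_mono) (use Zm in \<open>auto simp: A_def intro: measurable_sets\<close>)
    also have "\<dots> = (\<integral>\<^sup>+y. ennreal (normal_density 0 (sqrt (real (Suc n))) y) * indicator {- (2 * L)..2 * L} y \<partial>lborel)"
      by (rule distributed_emeasure[OF dist]) simp
    also have "\<dots> \<le> (\<integral>\<^sup>+y. ennreal (1 / sqrt (real (Suc n))) * indicator {- (2 * L)..2 * L} y \<partial>lborel)"
    proof (intro nn_integral_mono mult_right_mono ennreal_leI)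
      fix y
      let ?s = "sqrt (real (Suc n))"
      have "sqrt (real (Suc n)) \<le> sqrt (2 * pi * real (Suc n))"
        using pi_ge_two mult_right_mono[of 1 "2 * pi" "real (Suc n)"] by (simp del: of_nat_Suc)
      then have "1 / sqrt (2 * pi * ?s\<^sup>2) \<le> 1 / ?s"
        by (simp add: frac_le del: of_nat_Suc)
      moreover have "exp (- (y - 0)\<^sup>2 / (2 * ?s\<^sup>2)) \<le> 1" by simp
      ultimately have "1 / sqrt (2 * pi * ?s\<^sup>2) * exp (- (y - 0)\<^sup>2 / (2 * ?s\<^sup>2)) \<le> 1 / ?s * 1"
        by (intro mult_mono) auto
      then show "normal_density 0 ?s y \<le> 1 / ?s" by (simp add: normal_density_def)
    qed auto
    also have "\<dots> = ennreal (1 / sqrt (real (Suc n))) * ennreal (4 * L)"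
      using L0 by (simp add: nn_integral_cmult_indicator)
    also have "\<dots> = ennreal (4 * L / sqrt (real (Suc n)))"
      using L0 by (simp add: ennreal_mult'[symmetric])
    finally show ?thesis .
  qed
  have "(\<lambda>n. 4 * L / sqrt (real (Suc n))) \<longlonglongrightarrow> 0"
  proof -
    have "filterlim (\<lambda>n. sqrt (real (Suc n))) at_top sequentially"
      by (rule filterlim_compose[OF sqrt_at_top]) (rule filterlim_compose[OF filterlim_real_sequentially filterlim_Suc])
    then show ?thesis by (intro tendsto_divide_0[OF tendsto_const] filterlim_at_top_imp_at_infinity)
  qed
  then have "(\<lambda>n. ennreal (4 * L / sqrt (real (Suc n)))) \<longlonglongrightarrow> ennreal 0"
    by (rule tendsto_ennrealI)
  then have "emeasure M A \<le> ennreal 0"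
    by (rule LIMSEQ_le_const) (use bound in auto)
  then have "A \<in> null_sets M" using Am by auto
  then have "AE \<omega> in M. \<omega> \<notin> A" by (rule AE_not_in)
  moreover have "AE \<omega> in M. X 0 \<omega> = x"
    using BM unfolding brownian_motion_from_def by (auto elim: eventually_mono)
  ultimately show ?thesis
    using AE_space
  proof eventually_elim
    case (elim \<omega>)
    show ?case
    proof (rule ccontr)
      assume "\<not> ?thesis"
      then have inD: "X (real (Suc n)) \<omega> \<in> D" for n by blast
      have "\<bar>Z n \<omega>\<bar> \<le> 2 * L" for n
      proof -
        have "\<bar>Z n \<omega>\<bar> \<le> norm (X (real (Suc n)) \<omega> - X 0 \<omega>)"
          unfolding Z_def by (rule Basis_le_norm[OF v, unfolded inner_commute[of _ v]])
        also have "\<dots> \<le> norm (X (real (Suc n)) \<omega>) + norm (X 0 \<omega>)" by (rule norm_triangle_ineq4)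
        also have "\<dots> \<le> 2 * L" using L[OF inD[of n]] L[OF D(2)] elim by simp
        finally show ?thesis .
      qed
      then have "\<omega> \<in> A" using elim by (auto simp: A_def abs_le_iff minus_le_iff)
      then show False using elim by simp
    qed
  qed
qed

text \<open>Path regularity holds only almost surely, so the exit position is replaced by a version
  \<open>Y\<close> that is a pointwise limit of stopped walks and therefore measurable. The limits
  are taken in the order: mesh to 0, Taylor tolerance to 0, compact sets and horizons to
  infinity.\<close>

lemma brownian_exit_position:
  fixes X :: "real \<Rightarrow> 'w \<Rightarrow> 'a::euclidean_space"
  assumes BM: "brownian_motion_from M X x" and D: "open D" "bounded D" "x \<in> D"
  obtains Y where "Y \<in> borel_measurable M" "AE \<omega> in M. X (exit_time D X \<omega>) \<omega> = Y \<omega>"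
    "\<And>\<omega>. \<omega> \<in> space M \<Longrightarrow> Y \<omega> \<in> frontier D"
    "\<And>h \<phi>. harmonic_on D h \<Longrightarrow> continuous_on (frontier D) \<phi> \<Longrightarrow>
      (\<And>y. y \<in> frontier D \<Longrightarrow> (h \<longlongrightarrow> \<phi> y) (at y within D)) \<Longrightarrow> (\<integral>\<omega>. \<phi> (Y \<omega>) \<partial>M) = (h x :: real)"
proof -
  interpret prob_space M using BM by (simp add: brownian_motion_from_def)
  have Xm: "X t \<in> borel_measurable M" if "0 \<le> t" for t
    using BM that by (simp add: brownian_motion_from_def)
  have "AE \<omega> in M. X 0 \<omega> = x \<and> continuous_on {0..} (\<lambda>t. X t \<omega>)"
    using BM by (simp add: brownian_motion_from_def)
  with AE_brownian_exits[OF BM D(2,3)]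
  have "AE \<omega> in M. (\<exists>n. 0 < n \<and> X (real n) \<omega> \<notin> D) \<and> X 0 \<omega> = x \<and> continuous_on {0..} (\<lambda>t. X t \<omega>)"
    by (rule AE_conjI)
  from AE_E[OF this] obtain N where N0: "{\<omega> \<in> space M. \<not> ((\<exists>n. 0 < n \<and> X (real n) \<omega> \<notin> D) \<and> X 0 \<omega> = x
      \<and> continuous_on {0..} (\<lambda>t. X t \<omega>))} \<subseteq> N" "emeasure M N = 0" and Nm: "N \<in> sets M" by blast
  have good: "(\<exists>n::nat. 0 < n \<and> X (real n) \<omega> \<notin> D)" "X 0 \<omega> = x" "continuous_on {0..} (\<lambda>t. X t \<omega>)"
    if "\<omega> \<in> space M" "\<omega> \<notin> N" for \<omega>
    using N0(1) that by blast+
  have AEN: "AE \<omega> in M. \<omega> \<notin> N" using N0(2) Nm by (intro AE_not_in) auto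
  have cl: "closed (- D)" using D(1) by (rule closed_Compl)
  have ne: "- D \<noteq> {}"
  proof
    assume "- D = {}"
    then have "D = UNIV" by blast
    then show False using D(2) not_bounded_UNIV by metis
  qed
  have "frontier D \<noteq> {}" using D ne by (auto simp: frontier_eq_empty)
  \<comment> \<open>A default value for the exceptional null set, taken on the frontier so that
    \<open>Y\<close> lies there for every \<omega>.\<close>
  then obtain y0 where y0: "y0 \<in> frontier D" by blast
  \<comment> \<open>With the distance of x from the complement as scale, x belongs to every
    \<open>K m\<close>.\<close>
  define \<rho> where "\<rho> = infdist x (- D)"
  have \<rho>: "0 < \<rho>" unfolding \<rho>_def using D(3) by (intro infdist_pos_not_in_closed cl ne) simp
  define K where "K m = {z. \<rho> / real (Suc m) \<le> infdist z (- D)}" for m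
  define T where "T m = real (Suc m)" for m
  have T0: "0 < T m" for m by (simp add: T_def)
  have KD: "K m \<subseteq> D" for m
  proof
    fix z assume "z \<in> K m"
    then have "\<rho> / real (Suc m) \<le> infdist z (- D)" by (simp add: K_def)
    moreover have "0 < \<rho> / real (Suc m)" using \<rho> by simp
    ultimately have "0 < infdist z (- D)" by (rule less_le_trans[rotated])
    then have "z \<notin> - D" using infdist_zero[of z "- D"] by (metis less_irrefl)
    then show "z \<in> D" by simp
  qed
  have Kcl: "closed (K m)" for m
    unfolding K_def by (intro closed_Collect_le continuous_intros continuous_on_infdist)
  have Kcp: "compact (K m)" for m
    using Kcl bounded_subset[OF D(2) KD] by (simp add: compact_eq_bounded_closed)
  have xK: "x \<in> K m" for m
    using \<rho> by (simp add: K_def \<rho>_def[symmetric] field_simps)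
  define \<xi> where "\<xi> m n i \<omega> = X (real (Suc i) * (T m / real (Suc n))) \<omega> - X (real i * (T m / real (Suc n))) \<omega>" for m n i \<omega>
  have \<xi>m: "\<xi> m n i \<in> borel_measurable M" for m n i
    unfolding \<xi>_def using T0[of m] by (intro borel_measurable_diff Xm) auto
  \<comment> \<open>The walk makes n + 1 steps of mesh T m / (n + 1), which cover exactly the time
    up to T m.\<close>
  define V where "V m n \<omega> = (if \<omega> \<in> N then y0 else stopped_walk (K m) x (\<lambda>i. \<xi> m n i \<omega>) (Suc n))" for m n \<omega>
  define U where "U m \<omega> = (if \<omega> \<in> N then y0 else X (min (first_exit (K m) (\<lambda>t. X t \<omega>)) (T m)) \<omega>)" for m \<omega>
  define Y where "Y \<omega> = (if \<omega> \<in> N then y0 else X (exit_time D X \<omega>) \<omega>)" for \<omega>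
  have walkm: "(\<lambda>\<omega>. stopped_walk (K m) x (\<lambda>i. \<xi> m n i \<omega>) k) \<in> borel_measurable M" for m n k
    using Kcl by (intro measurable_stopped_walk \<xi>m) (auto intro: borel_closed)
  have Vm: "V m n \<in> borel_measurable M" for m n
    unfolding V_def using Nm walkm by (intro measurable_If_set) (auto simp del: stopped_walk.simps)
  have exK: "\<exists>t\<ge>0. X t \<omega> \<notin> K m" if "\<omega> \<in> space M" "\<omega> \<notin> N" for \<omega> m
    using good(1)[OF that] KD[of m] by (metis of_nat_0_le_iff subsetD)
  have VU: "(\<lambda>n. V m n \<omega>) \<longlonglongrightarrow> U m \<omega>" if w: "\<omega> \<in> space M" for m \<omega>
  proof (cases "\<omega> \<in> N")
    case False
    obtain t where t: "0 \<le> t" "X t \<omega> \<notin> K m" using exK[OF w False] by blast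
    show ?thesis
      using stopped_walk_tendsto[OF good(3,2)[OF w False] Kcl t T0[of m]] False
      by (simp add: V_def U_def \<xi>_def)
  qed (simp add: V_def U_def)
  have Um: "U m \<in> borel_measurable M" for m
    by (rule borel_measurable_LIMSEQ_metric[OF Vm VU])
  have UK: "U m \<omega> \<in> K m" if w: "\<omega> \<in> space M" "\<omega> \<notin> N" for m \<omega>
  proof -
    obtain t where t: "0 \<le> t" "X t \<omega> \<notin> K m" using exK[OF w] by blast
    have "0 \<le> first_exit (K m) (\<lambda>t. X t \<omega>)" using first_exit_nonneg[of t "\<lambda>t. X t \<omega>" "K m"] t by simp
    then show ?thesis
      using path_at_first_exit[OF good(3)[OF w] Kcl, of m "min (first_exit (K m) (\<lambda>t. X t \<omega>)) (T m)"]
        good(2)[OF w] xK[of m] T0[of m] w by (simp add: U_def)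
  qed
  have UY: "(\<lambda>m. U m \<omega>) \<longlonglongrightarrow> Y \<omega>" and YF: "Y \<omega> \<in> frontier D" if w: "\<omega> \<in> space M" for \<omega>
  proof -
    have "(\<lambda>m. U m \<omega>) \<longlonglongrightarrow> Y \<omega> \<and> Y \<omega> \<in> frontier D"
    proof (cases "\<omega> \<in> N")
      case True
      then show ?thesis using y0 by (simp add: U_def Y_def)
    next
      case False
      note g = good[OF w False]
      obtain n where n: "0 < real n" "X (real n) \<omega> \<notin> D" using g(1) by auto
      have X0: "X 0 \<omega> \<in> D" using g(2) D(3) by simp
      define \<tau> where "\<tau> = Inf {t. 0 < t \<and> X t \<omega> \<notin> D}"
      have \<tau>: "0 < \<tau>" "X \<tau> \<omega> \<in> frontier D"
        using path_exit_time[OF g(3) D(1) X0 n] by (simp_all add: \<tau>_def)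
      have "(\<lambda>m. min (first_exit (K m) (\<lambda>t. X t \<omega>)) (T m)) \<longlonglongrightarrow> \<tau>"
        unfolding K_def T_def \<tau>_def by (rule first_exit_exhaustion_tendsto[OF g(3) D(1) X0 n \<rho>])
      moreover have "0 \<le> min (first_exit (K m) (\<lambda>t. X t \<omega>)) (T m)" for m
      proof -
        obtain t where "0 \<le> t" "X t \<omega> \<notin> K m" using exK[OF w False] by blast
        then show ?thesis using first_exit_nonneg[of t "\<lambda>t. X t \<omega>" "K m"] T0[of m] by simp
      qed
      ultimately have "(\<lambda>m. X (min (first_exit (K m) (\<lambda>t. X t \<omega>)) (T m)) \<omega>) \<longlonglongrightarrow> X \<tau> \<omega>"
        using \<tau>(1) by (intro continuous_on_tendsto_compose[OF g(3)]) auto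
      then show ?thesis using False \<tau>(2) by (simp add: U_def Y_def exit_time_def \<tau>_def)
    qed
    then show "(\<lambda>m. U m \<omega>) \<longlonglongrightarrow> Y \<omega>" "Y \<omega> \<in> frontier D" by auto
  qed
  have Ym: "Y \<in> borel_measurable M"
    by (rule borel_measurable_LIMSEQ_metric[OF Um UY])
  show thesis
  proof (rule that[of Y])
    show "AE \<omega> in M. X (exit_time D X \<omega>) \<omega> = Y \<omega>"
      using AEN by eventually_elim (simp add: Y_def)
    fix h \<phi> assume h: "harmonic_on D h" and \<phi>: "continuous_on (frontier D) \<phi>"
      and lim: "\<And>y. y \<in> frontier D \<Longrightarrow> (h \<longlongrightarrow> (\<phi> y :: real)) (at y within D)"
    have C2: "C2_on D h" and lap: "\<And>y. y \<in> D \<Longrightarrow> laplacian h y = 0"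
      using h by (auto simp: harmonic_on_iff)
    note hc = C2_on_continuous(1)[OF C2]
    have cpF: "compact (frontier D)" using D(2) by (rule compact_frontier_bounded)
    have disj: "D \<inter> frontier D = {}" using D(1) by (auto simp: frontier_def interior_open)
    \<comment> \<open>Glues h and its boundary values. The step that freezes the walk may jump out
      of D, so a bounded function on the whole space is needed; the value 0 elsewhere is
      arbitrary.\<close>
    define hb where "hb z = indicator D z *\<^sub>R h z + indicator (frontier D) z *\<^sub>R \<phi> z" for z
    have hbm: "hb \<in> borel_measurable borel"
      unfolding hb_def[abs_def] using D(1) hc \<phi> cpF
      by (intro borel_measurable_add borel_measurable_continuous_on_indicator)
        (auto intro: borel_open borel_closed compact_imp_closed)
    have hbD: "hb z = h z" if "z \<in> D" for z
    proof -
      have "z \<notin> frontier D" using that disj by blast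
      then show ?thesis using that by (simp add: hb_def)
    qed
    have hbF: "hb z = \<phi> z" if "z \<in> frontier D" for z
    proof -
      have "z \<notin> D" using that disj by blast
      then show ?thesis using that by (simp add: hb_def)
    qed
    obtain B where hbB: "\<And>z. \<bar>hb z\<bar> \<le> B"
    proof -
      obtain B1 where B1: "\<And>z. z \<in> D \<Longrightarrow> \<bar>h z\<bar> \<le> B1"
        using Dirichlet_solution_bounded[OF D(1,2) hc lim] by blast
      have "bounded (\<phi> ` frontier D)" by (intro compact_imp_bounded compact_continuous_image \<phi> cpF)
      then obtain B2 where B2: "\<And>z. z \<in> frontier D \<Longrightarrow> \<bar>\<phi> z\<bar> \<le> B2" by (force simp: bounded_iff)
      have "\<bar>hb z\<bar> \<le> max 0 (max B1 B2)" for z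
        using B1[of z] B2[of z] hbD[of z] hbF[of z]
        by (cases "z \<in> D"; cases "z \<in> frontier D") (auto simp: hb_def)
      then show thesis using that by blast
    qed
    have intC: "integrable M (\<lambda>\<omega>. hb (Q \<omega>))" if "Q \<in> borel_measurable M" for Q
      using measurable_compose[OF that hbm] hbB by (intro integrable_const_bound[where B = B]) auto
    have EU: "expectation (\<lambda>\<omega>. hb (U m \<omega>)) = h x" for m
    proof -
      have lim1: "(\<lambda>n. expectation (\<lambda>\<omega>. hb (V m n \<omega>))) \<longlonglongrightarrow> expectation (\<lambda>\<omega>. hb (U m \<omega>))"
      proof (rule integral_dominated_convergence[where w = "\<lambda>_. B"])
        show "(\<lambda>\<omega>. hb (U m \<omega>)) \<in> borel_measurable M" "\<And>n. (\<lambda>\<omega>. hb (V m n \<omega>)) \<in> borel_measurable M"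
          using measurable_compose[OF Um hbm] measurable_compose[OF Vm hbm] by auto
        show "AE \<omega> in M. (\<lambda>n. hb (V m n \<omega>)) \<longlonglongrightarrow> hb (U m \<omega>)"
        proof (rule AE_I2)
          fix \<omega> assume w: "\<omega> \<in> space M"
          show "(\<lambda>n. hb (V m n \<omega>)) \<longlonglongrightarrow> hb (U m \<omega>)"
          proof (cases "\<omega> \<in> N")
            case False
            then have UD: "U m \<omega> \<in> D" using UK[OF w] KD by blast
            have "isCont h (U m \<omega>)" using hc D(1) UD by (simp add: continuous_on_eq_continuous_at)
            then have "(\<lambda>n. h (V m n \<omega>)) \<longlonglongrightarrow> h (U m \<omega>)"
              by (rule isCont_tendsto_compose) (rule VU[OF w])
            moreover have "\<forall>\<^sub>F n in sequentially. V m n \<omega> \<in> D"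
              by (rule topological_tendstoD[OF VU[OF w] D(1) UD])
            then have "\<forall>\<^sub>F n in sequentially. h (V m n \<omega>) = hb (V m n \<omega>)"
              by eventually_elim (simp add: hbD)
            ultimately show ?thesis unfolding hbD[OF UD] by (rule Lim_transform_eventually)
          qed (simp add: V_def U_def)
        qed
      qed (use hbB in auto)
      \<comment> \<open>Over n + 1 steps with s = T m / (n + 1) the errors e s + 3 C s^2 add up to e
        T m, plus a term that disappears as n grows.\<close>
      have small: "\<bar>expectation (\<lambda>\<omega>. hb (U m \<omega>)) - h x\<bar> \<le> real DIM('a) * T m * e" if e: "0 < e" for e
      proof -
        from Taylor_C2_uniform[OF D(1) C2 Kcp KD hbD hbB e, of m]
        obtain C where C: "0 \<le> C" "\<And>y z. y \<in> K m \<Longrightarrow> \<bar>hb (y + z) - hb y - (\<Sum>b\<in>Basis. partial b h y * (z \<bullet> b))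
          - (\<Sum>b\<in>Basis. \<Sum>c\<in>Basis. partial c (partial b h) y * ((z \<bullet> b) * (z \<bullet> c))) / 2\<bar>
          \<le> e * (\<Sum>b\<in>Basis. (z \<bullet> b) * (z \<bullet> b)) + C * (\<Sum>b\<in>Basis. (z \<bullet> b) ^ 4)" by blast
        have est: "\<bar>expectation (\<lambda>\<omega>. hb (V m n \<omega>)) - h x\<bar> \<le> real DIM('a) * (e * T m + 3 * C * (T m)\<^sup>2 / real (Suc n))" for n
        proof -
          define s where "s = T m / real (Suc n)"
          have s: "0 < s" using T0 by (simp add: s_def)
          have \<xi>s: "\<xi> m n = (\<lambda>i \<omega>. X (real (Suc i) * s) \<omega> - X (real i * s) \<omega>)"
            by (simp add: \<xi>_def s_def fun_eq_iff)
          have "strict_mono (\<lambda>i. real i * s)"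
            using s by (intro strict_monoI mult_strict_right_mono) auto
          then have indep: "indep_vars (\<lambda>_. borel) (\<xi> m n) {..<k}" for k
            using BM unfolding brownian_motion_from_def \<xi>s by (auto dest!: spec[of _ k] spec[of _ "\<lambda>i. real i * s"])
          have ss: "0 \<le> real i * s" "real i * s < real (Suc i) * s" "real (Suc i) * s - real i * s = s" for i
            using s by (auto simp: algebra_simps)
          note mom = brownian_increment_moments[OF BM ss(1,2), unfolded ss(3)]
          have step: "\<bar>expectation (\<lambda>\<omega>. hb (stopped_walk (K m) x (\<lambda>i. \<xi> m n i \<omega>) (Suc k)))
              - expectation (\<lambda>\<omega>. hb (stopped_walk (K m) x (\<lambda>i. \<xi> m n i \<omega>) k))\<bar>
              \<le> real DIM('a) * (e * s + C * (3 * s\<^sup>2))" for k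
          proof (rule stopped_walk_step[where g = "\<lambda>b. partial b h" and H = "\<lambda>b c. partial c (partial b h)", OF indep \<xi>m _ _ _ Kcp hbm hbB])
            show "continuous_on (K m) (partial b h)" if "b \<in> Basis" for b
              by (rule continuous_on_subset[OF C2_on_continuous(2)[OF C2 that] KD])
            show "continuous_on (K m) (partial c (partial b h))" if "b \<in> Basis" "c \<in> Basis" for b c
              using continuous_on_subset[OF C2_on_continuous(3)[OF C2 that] KD] .
            show "(\<Sum>b\<in>Basis. partial b (partial b h) y) = 0" if "y \<in> K m" for y
              using lap[of y] that KD[of m] by (auto simp: laplacian_def)
          qed (use mom C e in \<open>auto simp: \<xi>s\<close>)
          have "\<bar>expectation (\<lambda>\<omega>. hb (stopped_walk (K m) x (\<lambda>i. \<xi> m n i \<omega>) (Suc n))) - hb x\<bar>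
              \<le> real (Suc n) * (real DIM('a) * (e * s + C * (3 * s\<^sup>2)))"
            by (rule telescoping_expectation_bound[where W = "\<lambda>k \<omega>. stopped_walk (K m) x (\<lambda>i. \<xi> m n i \<omega>) k", OF step]) simp
          also have "expectation (\<lambda>\<omega>. hb (stopped_walk (K m) x (\<lambda>i. \<xi> m n i \<omega>) (Suc n))) = expectation (\<lambda>\<omega>. hb (V m n \<omega>))"
          proof (rule integral_cong_AE)
            show "AE \<omega> in M. hb (stopped_walk (K m) x (\<lambda>i. \<xi> m n i \<omega>) (Suc n)) = hb (V m n \<omega>)"
              using AEN by eventually_elim (simp add: V_def)
          qed (use measurable_compose[OF walkm hbm] measurable_compose[OF Vm hbm] in \<open>simp_all del: stopped_walk.simps\<close>)
          also have "real (Suc n) * (real DIM('a) * (e * s + C * (3 * s\<^sup>2)))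
              = real DIM('a) * (e * T m + 3 * C * (T m)\<^sup>2 / real (Suc n))"
          proof -
            have "r * (c * (e * (t / r) + C * (3 * (t / r)\<^sup>2))) = c * (e * t + 3 * C * t\<^sup>2 / r)" if "0 < r" for r c t :: real
              using that by (simp add: field_simps power2_eq_square)
            note aux = this
            show ?thesis unfolding s_def by (rule aux) simp
          qed
          finally show ?thesis using hbD[OF D(3)] by simp
        qed
        have "(\<lambda>n. \<bar>expectation (\<lambda>\<omega>. hb (V m n \<omega>)) - h x\<bar>) \<longlonglongrightarrow> \<bar>expectation (\<lambda>\<omega>. hb (U m \<omega>)) - h x\<bar>"
          by (intro tendsto_intros lim1)
        moreover have "(\<lambda>n. real DIM('a) * (e * T m + 3 * C * (T m)\<^sup>2 / real (Suc n))) \<longlonglongrightarrow> real DIM('a) * (e * T m + 0)"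
          by (intro tendsto_intros LIMSEQ_Suc[of "\<lambda>n. 3 * C * (T m)\<^sup>2 / real n"] lim_const_over_n)
        ultimately have "\<bar>expectation (\<lambda>\<omega>. hb (U m \<omega>)) - h x\<bar> \<le> real DIM('a) * (e * T m + 0)"
          by (rule LIMSEQ_le) (use est in blast)
        then show ?thesis by (simp add: ac_simps)
      qed
      have "\<bar>expectation (\<lambda>\<omega>. hb (U m \<omega>)) - h x\<bar> \<le> 0"
      proof (rule field_le_epsilon)
        fix e :: real assume "0 < e"
        then show "\<bar>expectation (\<lambda>\<omega>. hb (U m \<omega>)) - h x\<bar> \<le> 0 + e"
          using small[of "e / (real DIM('a) * T m)"] T0[of m] by simp
      qed
      then show ?thesis by simp
    qed
    \<comment> \<open>Off the null set \<open>U m\<close> approaches the frontier through D; this is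
      where the boundary values of h enter.\<close>
    have "(\<lambda>m. expectation (\<lambda>\<omega>. hb (U m \<omega>))) \<longlonglongrightarrow> expectation (\<lambda>\<omega>. hb (Y \<omega>))"
    proof (rule integral_dominated_convergence[where w = "\<lambda>_. B"])
      show "(\<lambda>\<omega>. hb (Y \<omega>)) \<in> borel_measurable M" "\<And>m. (\<lambda>\<omega>. hb (U m \<omega>)) \<in> borel_measurable M"
        using measurable_compose[OF Um hbm] measurable_compose[OF Ym hbm] by auto
      show "AE \<omega> in M. (\<lambda>m. hb (U m \<omega>)) \<longlonglongrightarrow> hb (Y \<omega>)"
      proof (rule AE_I2)
        fix \<omega> assume w: "\<omega> \<in> space M"
        show "(\<lambda>m. hb (U m \<omega>)) \<longlonglongrightarrow> hb (Y \<omega>)"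
        proof (cases "\<omega> \<in> N")
          case False
          then have UD: "U m \<omega> \<in> D" for m using UK[OF w] KD by blast
          have "Y \<omega> \<notin> D" using YF[OF w] disj by blast
          from filterlim_compose[OF lim[OF YF[OF w]] filterlim_at_within_sequenceI[OF UY[OF w] UD this]]
          show ?thesis unfolding hbD[OF UD] hbF[OF YF[OF w]] .
        qed (simp add: U_def Y_def)
      qed
    qed (use hbB in auto)
    then have "h x = expectation (\<lambda>\<omega>. hb (Y \<omega>))"
      unfolding EU by (simp add: LIMSEQ_const_iff)
    also have "\<dots> = expectation (\<lambda>\<omega>. \<phi> (Y \<omega>))"
      using hbF YF by (intro Bochner_Integration.integral_cong) auto
    finally show "expectation (\<lambda>\<omega>. \<phi> (Y \<omega>)) = h x" by simp
  qed (use Ym YF in auto)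
qed

section \<open>Harmonic measures\<close>

definition closed_approx :: "'a::metric_space set \<Rightarrow> nat \<Rightarrow> 'a \<Rightarrow> real" where
  "closed_approx C n z = max 0 (1 - real n * infdist z C)"

lemma closed_approx_bounds: "0 \<le> closed_approx C n z" "closed_approx C n z \<le> 1"
  using infdist_nonneg[of z C] by (auto simp: closed_approx_def)

lemma continuous_on_closed_approx: "continuous_on S (closed_approx C n)"
  unfolding closed_approx_def[abs_def] by (intro continuous_intros continuous_on_infdist)

text \<open>C has to be nonempty because the distance to the empty set is 0 by convention, which
  makes the approximants constantly 1; the uses below treat the empty set separately.\<close>

lemma closed_approx_tendsto:
  assumes "closed C" "C \<noteq> {}"
  shows "(\<lambda>n. closed_approx C n z) \<longlonglongrightarrow> indicator C z"
proof (cases "z \<in> C")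
  case True
  then show ?thesis by (simp add: closed_approx_def infdist_zero)
next
  case False
  then have pos: "0 < infdist z C" using assms by (intro infdist_pos_not_in_closed) auto
  have "\<forall>\<^sub>F n in sequentially. closed_approx C n z = 0"
    using eventually_ge_at_top[of "nat \<lceil>1 / infdist z C\<rceil>"]
  proof eventually_elim
    case (elim n)
    then have "1 / infdist z C \<le> real n" by linarith
    then show ?case using pos by (simp add: closed_approx_def field_simps)
  qed
  then show ?thesis using False by (simp add: tendsto_eventually)
qed

lemma integral_closed_approx_tendsto:
  assumes "finite_measure M" "sets M = sets borel" "closed C" "C \<noteq> {}"
  shows "(\<lambda>n. \<integral>z. closed_approx C n z \<partial>M) \<longlonglongrightarrow> measure M C"
proof -
  interpret finite_measure M by fact
  have "(\<lambda>n. \<integral>z. closed_approx C n z \<partial>M) \<longlonglongrightarrow> (\<integral>z. indicator C z \<partial>M)"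
  proof (rule integral_dominated_convergence[where w = "\<lambda>_. 1"])
    show "(\<lambda>z. indicator C z :: real) \<in> borel_measurable M"
      using assms by (intro borel_measurable_indicator) auto
    show "closed_approx C n \<in> borel_measurable M" for n
      using borel_measurable_continuous_onI[OF continuous_on_closed_approx] assms(2)
      by (simp cong: measurable_cong_sets)
  qed (use closed_approx_tendsto[OF assms(3,4)] closed_approx_bounds[of C] in auto)
  then show ?thesis
    using assms(2) sets_eq_imp_space_eq[OF assms(2)] by simp
qed

text \<open>Closed sets form an intersection-stable generator, and their indicators are limits of
  continuous functions with values in the unit interval.\<close>

lemma measure_eqI_continuous:
  fixes M N :: "'a::metric_space measure"
  assumes M: "prob_space M" "sets M = sets borel" and N: "prob_space N" "sets N = sets borel"
    and eq: "\<And>\<phi> :: 'a \<Rightarrow> real. continuous_on UNIV \<phi> \<Longrightarrow> (\<And>z. 0 \<le> \<phi> z) \<Longrightarrow> (\<And>z. \<phi> z \<le> 1) \<Longrightarrow>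
      (\<integral>\<^sup>+z. ennreal (\<phi> z) \<partial>M) = (\<integral>\<^sup>+z. ennreal (\<phi> z) \<partial>N)"
  shows "M = N"
proof (rule measure_eqI_generator_eq[where E = "Collect closed" and \<Omega> = UNIV and A = "\<lambda>_. UNIV"])
  interpret M: prob_space M by fact
  interpret N: prob_space N by fact
  show "Int_stable (Collect closed)" by (auto simp: Int_stable_def)
  show "sets M = sigma_sets UNIV (Collect closed)" "sets N = sigma_sets UNIV (Collect closed)"
    using M(2) N(2) by (simp_all add: borel_eq_closed)
  fix C :: "'a set" assume "C \<in> Collect closed"
  then have C: "closed C" by simp
  show "emeasure M C = emeasure N C"
  proof (cases "C = {}")
    case False
    have "(\<integral>z. closed_approx C n z \<partial>M) = (\<integral>z. closed_approx C n z \<partial>N)" for n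
      using eq[OF continuous_on_closed_approx closed_approx_bounds, of C n] closed_approx_bounds[of C n]
      by (simp add: integral_eq_nn_integral borel_measurable_continuous_onI[OF continuous_on_closed_approx] M(2) N(2)
          cong: measurable_cong_sets)
    then have "(\<lambda>n. \<integral>z. closed_approx C n z \<partial>N) \<longlonglongrightarrow> measure M C"
      using integral_closed_approx_tendsto[OF M.finite_measure_axioms M(2) C False] by simp
    with integral_closed_approx_tendsto[OF N.finite_measure_axioms N(2) C False]
    have "measure M C = measure N C" using LIMSEQ_unique by blast
    then show ?thesis by (simp add: M.emeasure_eq_measure N.emeasure_eq_measure)
  qed simp
next
  interpret M: prob_space M by fact
  show "emeasure M UNIV \<noteq> \<infinity>" by simp
qed auto

section \<open>The kernel of harmonic measures\<close>

text \<open>Brownian motion enters the rest of the argument only through its exit laws. Off D the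
  law is a point mass, which makes \<mu> a kernel on the whole space.\<close>

locale harmonic_measures =
  fixes D :: "'a::euclidean_space set" and \<mu> :: "'a \<Rightarrow> 'a measure"
  assumes openD: "open D" and connD: "connected D" and boundedD: "bounded D"
    and prob: "\<And>x. prob_space (\<mu> x)" and sets\<mu>: "\<And>x. sets (\<mu> x) = sets borel"
    and out: "\<And>x. x \<notin> D \<Longrightarrow> \<mu> x = return borel x"
    and dirichlet: "\<And>\<phi>::'a \<Rightarrow> real. continuous_on UNIV \<phi> \<Longrightarrow> \<exists>h. harmonic_on D h \<and>
      (\<forall>y\<in>frontier D. (h \<longlongrightarrow> \<phi> y) (at y within D)) \<and> (\<forall>x\<in>D. (\<integral>z. \<phi> z \<partial>\<mu> x) = h x)"
begin

definition H :: "('a \<Rightarrow> ennreal) \<Rightarrow> 'a \<Rightarrow> ennreal" where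
  "H f x = (\<integral>\<^sup>+z. f z \<partial>\<mu> x)"

lemma space\<mu>: "space (\<mu> x) = UNIV"
  using sets_eq_imp_space_eq[OF sets\<mu>] by simp

lemma measurable\<mu>: "borel_measurable (\<mu> x) = borel_measurable borel"
  by (intro measurable_cong_sets sets\<mu> refl)

text \<open>On D the integral is a harmonic, hence continuous, function; off D it is \<phi>
  itself.\<close>

lemma integral_\<mu>_measurable:
  fixes \<phi> :: "'a \<Rightarrow> real"
  assumes "continuous_on UNIV \<phi>"
  shows "(\<lambda>x. \<integral>z. \<phi> z \<partial>\<mu> x) \<in> borel_measurable borel"
proof -
  obtain h where h: "harmonic_on D h" "\<And>x. x \<in> D \<Longrightarrow> (\<integral>z. \<phi> z \<partial>\<mu> x) = h x"
    using dirichlet[OF assms] by blast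
  have hc: "continuous_on D h" using h(1) by (auto simp: harmonic_on_iff intro: C2_on_continuous)
  have \<phi>m: "\<phi> \<in> borel_measurable borel" using assms by (rule borel_measurable_continuous_onI)
  have "(\<lambda>x. indicator D x *\<^sub>R h x + indicator (- D) x *\<^sub>R \<phi> x) \<in> borel_measurable borel"
    using openD hc assms
    by (intro borel_measurable_add borel_measurable_continuous_on_indicator)
      (auto intro: continuous_on_subset borel_closed)
  also have "(\<lambda>x. indicator D x *\<^sub>R h x + indicator (- D) x *\<^sub>R \<phi> x) = (\<lambda>x. \<integral>z. \<phi> z \<partial>\<mu> x)"
    using h(2) out \<phi>m by (auto simp: fun_eq_iff indicator_def integral_return)
  finally show ?thesis .
qed

text \<open>Measurability in the starting point is inherited from the solutions of the Dirichlet
  problem, first for continuous integrands and then for closed sets.\<close>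

lemma \<mu>_kernel: "\<mu> \<in> measurable borel (prob_algebra borel)"
proof (rule measurable_prob_algebra_generated[where G = "Collect closed" and \<Omega> = UNIV])
  show "sets borel = sigma_sets UNIV (Collect closed :: 'a set set)"
    by (simp add: borel_eq_closed)
  show "Int_stable (Collect closed :: 'a set set)" by (auto simp: Int_stable_def)
  fix C :: "'a set" assume "C \<in> Collect closed"
  then have C: "closed C" by simp
  show "(\<lambda>x. emeasure (\<mu> x) C) \<in> borel_measurable borel"
  proof (cases "C = {}")
    case False
    have "(\<lambda>x. measure (\<mu> x) C) \<in> borel_measurable borel"
      by (rule borel_measurable_LIMSEQ_metric[OF integral_\<mu>_measurable[OF continuous_on_closed_approx]])
        (rule integral_closed_approx_tendsto[OF prob_space.finite_measure[OF prob] sets\<mu> C False])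
    then have "(\<lambda>x. ennreal (measure (\<mu> x) C)) \<in> borel_measurable borel" by simp
    then show ?thesis
      by (simp add: finite_measure.emeasure_eq_measure[OF prob_space.finite_measure[OF prob]])
  qed simp
qed (use prob sets\<mu> in auto)

lemma \<mu>_subprob_kernel: "\<mu> \<in> measurable borel (subprob_algebra borel)"
  by (rule measurable_prob_algebraD[OF \<mu>_kernel])

lemma H_measurable: "f \<in> borel_measurable borel \<Longrightarrow> H f \<in> borel_measurable borel"
  unfolding H_def[abs_def]
  by (rule measurable_compose[OF \<mu>_subprob_kernel nn_integral_measurable_subprob_algebra])

lemma outside_cball:
  assumes "z \<notin> D" "cball x R \<subseteq> D" "r < R"
  shows "r \<le> norm (z - x)"
proof -
  have "z \<notin> cball x R" using assms by blast
  then show ?thesis using assms(3) by (simp add: dist_norm norm_minus_commute)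
qed

text \<open>At bottom an identity of measures: \<mu> x is the mixture of the \<mu> z weighted by the
  mollifier. Tested on a continuous \<phi> it is the mean value property of a Dirichlet solution; as
  an equality of measures it covers every Borel f, infinite values included.\<close>

lemma H_mollifier_mean:
  assumes R: "cball x R \<subseteq> D" "0 < r" "r < R" and f: "f \<in> borel_measurable borel"
  shows "H f x = (\<integral>\<^sup>+z. ennreal (mollifier 3 r (z - x)) * H f z \<partial>lborel)"
proof -
  have xD: "x \<in> D" using R by auto
  define N where "N = density lborel (\<lambda>z. ennreal (mollifier 3 r (z - x)))"
  have mm: "(\<lambda>z. ennreal (mollifier 3 r (z - x))) \<in> borel_measurable borel"
    by (intro measurable_compose[OF _ measurable_ennreal] borel_measurable_continuous_onI continuous_intros)
  have setsN: "sets N = sets borel" by (simp add: N_def)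
  have N: "prob_space N"
  proof
    have "emeasure N (space N) = (\<integral>\<^sup>+z. ennreal (mollifier 3 r (z - x)) \<partial>lborel)"
      unfolding N_def using mm by (simp add: emeasure_density)
    also have "\<dots> = ennreal (\<integral>z. mollifier 3 r (z - x) \<partial>lborel)"
      using R by (intro nn_integral_eq_integral integrable_mollifier) (auto simp: mollifier_nonneg)
    finally show "emeasure N (space N) = 1" using R by (simp add: integral_mollifier_eq_1)
  qed
  have \<mu>N: "\<mu> \<in> measurable N (prob_algebra borel)" "\<mu> \<in> measurable N (subprob_algebra borel)"
    using \<mu>_kernel \<mu>_subprob_kernel setsN by (simp_all cong: measurable_cong_sets)
  have NA: "N \<in> space (prob_algebra N)" using N by (simp add: space_prob_algebra)
  have "\<mu> x = N \<bind> \<mu>"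
  proof (rule measure_eqI_continuous[OF prob sets\<mu>])
    show "prob_space (N \<bind> \<mu>)" by (rule prob_space_bind'[OF NA \<mu>N(1)])
    show "sets (N \<bind> \<mu>) = sets borel" by (rule sets_bind'[OF NA \<mu>N(1)])
    fix \<phi> :: "'a \<Rightarrow> real" assume \<phi>: "continuous_on UNIV \<phi>" "\<And>z. 0 \<le> \<phi> z" "\<And>z. \<phi> z \<le> 1"
    obtain h where h: "harmonic_on D h" "\<And>x. x \<in> D \<Longrightarrow> (\<integral>z. \<phi> z \<partial>\<mu> x) = h x"
      using dirichlet[OF \<phi>(1)] by blast
    have \<phi>m: "\<phi> \<in> borel_measurable borel" using \<phi>(1) by (rule borel_measurable_continuous_onI)
    have conv: "(\<integral>\<^sup>+z. ennreal (\<phi> z) \<partial>\<mu> y) = ennreal (\<integral>z. \<phi> z \<partial>\<mu> y)" for y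
      using \<phi> \<phi>m by (intro nn_integral_eq_integral finite_measure.integrable_const_bound[where B = 1]
          prob_space.finite_measure prob) (auto simp: measurable\<mu>)
    have "(\<integral>\<^sup>+z. ennreal (\<phi> z) \<partial>(N \<bind> \<mu>)) = (\<integral>\<^sup>+y. \<integral>\<^sup>+z. ennreal (\<phi> z) \<partial>\<mu> y \<partial>N)"
      using \<phi>m by (intro nn_integral_bind[OF _ \<mu>N(2)]) simp
    also have "\<dots> = (\<integral>\<^sup>+y. ennreal (mollifier 3 r (y - x)) * ennreal (\<integral>z. \<phi> z \<partial>\<mu> y) \<partial>lborel)"
      unfolding conv N_def using mm integral_\<mu>_measurable[OF \<phi>(1)] by (intro nn_integral_density) auto
    also have "\<dots> = (\<integral>\<^sup>+y. ennreal (h y * mollifier 3 r (y - x)) \<partial>lborel)"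
    proof (rule nn_integral_cong)
      fix y
      show "ennreal (mollifier 3 r (y - x)) * ennreal (\<integral>z. \<phi> z \<partial>\<mu> y) = ennreal (h y * mollifier 3 r (y - x))"
      proof (cases "y \<in> D")
        case True
        have "0 \<le> h y" unfolding h(2)[OF True, symmetric] by (rule Bochner_Integration.integral_nonneg[OF \<phi>(2)])
        then show ?thesis using True h(2) R by (simp add: ennreal_mult mollifier_nonneg mult.commute)
      next
        case False
        then have "r \<le> norm (y - x)" by (rule outside_cball) (use R in auto)
        then show ?thesis using R by (simp add: mollifier_eq_0)
      qed
    qed
    also have "\<dots> = ennreal (\<integral>y. h y * mollifier 3 r (y - x) \<partial>lborel)"
    proof (rule nn_integral_eq_integral)
      have hc: "continuous_on D h" using h(1) by (auto simp: harmonic_on_iff intro: C2_on_continuous)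
      show "integrable lborel (\<lambda>y. h y * mollifier 3 r (y - x))"
        using R by (intro integrable_compact_support[of "cball x R"] continuous_intros continuous_on_subset[OF hc])
          (auto simp: mollifier_eq_0 dist_norm norm_minus_commute)
      show "AE y in lborel. 0 \<le> h y * mollifier 3 r (y - x)"
      proof (rule AE_I2)
        fix y
        show "0 \<le> h y * mollifier 3 r (y - x)"
        proof (cases "y \<in> D")
          case True
          have "0 \<le> h y" unfolding h(2)[OF True, symmetric] by (rule Bochner_Integration.integral_nonneg[OF \<phi>(2)])
          then show ?thesis using R by (simp add: mollifier_nonneg)
        next
          case False
          then have "r \<le> norm (y - x)" by (rule outside_cball) (use R in auto)
          then show ?thesis using R by (simp add: mollifier_eq_0)
        qed
      qed
    qed
    also have "\<dots> = ennreal (h x)"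
      using harmonic_mollifier_mean[OF openD h(1) R] by simp
    finally show "(\<integral>\<^sup>+z. ennreal (\<phi> z) \<partial>\<mu> x) = (\<integral>\<^sup>+z. ennreal (\<phi> z) \<partial>(N \<bind> \<mu>))"
      using conv h(2)[OF xD] by simp
  qed
  then have "H f x = (\<integral>\<^sup>+z. f z \<partial>(N \<bind> \<mu>))" by (simp add: H_def)
  also have "\<dots> = (\<integral>\<^sup>+y. H f y \<partial>N)"
    unfolding H_def by (rule nn_integral_bind[OF f \<mu>N(2)])
  also have "\<dots> = (\<integral>\<^sup>+z. ennreal (mollifier 3 r (z - x)) * H f z \<partial>lborel)"
    unfolding N_def using mm H_measurable[OF f] by (intro nn_integral_density) auto
  finally show ?thesis .
qed

text \<open>A small kernel centred near x is pointwise at most a constant times the large kernel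
  centred at x. The constant does not depend on f, and \<open>H f x\<close> may be infinite.\<close>

lemma H_Harnack:
  assumes r: "0 < r" "cball x (2 * r) \<subseteq> D"
  obtains C where "0 \<le> C" "\<And>f y. f \<in> borel_measurable borel \<Longrightarrow> y \<in> cball x (r / 4) \<Longrightarrow> H f y \<le> ennreal C * H f x"
proof -
  define I where "I = (\<integral>y. bump 3 y \<partial>(lborel :: 'a measure))"
  have I: "0 < I" unfolding I_def by (rule bump_integral_pos) simp
  \<comment> \<open>On the support of the small kernel |z - x| is at most r / 2, so the large bump
    is at least (1 - 1 / 4)^3 there.\<close>
  define c where "c = (3 / 4) ^ 3 / (r ^ DIM('a) * I)"
  have c: "0 < c" using I r by (simp add: c_def)
  \<comment> \<open>An upper bound of the small kernel divided by the lower bound c of the large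
    one.\<close>
  define C where "C = 1 / ((r / 4) ^ DIM('a) * I) / c"
  have C: "0 \<le> C" using c I r by (simp add: C_def)
  have le: "mollifier 3 (r / 4) (z - y) \<le> C * mollifier 3 r (z - x)" if y: "y \<in> cball x (r / 4)" for y z
  proof (cases "norm (z - y) < r / 4")
    case True
    have "norm (z - x) \<le> norm (z - y) + norm (y - x)"
      using norm_triangle_ineq[of "z - y" "y - x"] by simp
    then have zx: "norm (z - x) \<le> r / 2" using True y by (simp add: dist_norm norm_minus_commute)
    define w where "w = (z - x) /\<^sub>R r"
    have "norm w = norm (z - x) / r" using r by (simp add: w_def divide_inverse mult.commute)
    then have "norm w \<le> 1 / 2" using zx r by (simp add: divide_le_eq)
    then have "(norm w)\<^sup>2 \<le> (1 / 2)\<^sup>2" by (intro power_mono) auto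
    then have "w \<bullet> w \<le> 1 / 4" by (simp add: power2_norm_eq_inner power_divide)
    then have "(3 / 4) ^ 3 \<le> bump 3 w"
      unfolding bump_def by (intro power_mono) auto
    then have "c \<le> mollifier 3 r (z - x)"
      unfolding c_def mollifier_def I_def[symmetric] w_def using I r by (intro divide_right_mono) auto
    moreover have "mollifier 3 (r / 4) (z - y) \<le> 1 / ((r / 4) ^ DIM('a) * I)"
      unfolding mollifier_def I_def[symmetric] using I r by (intro divide_right_mono bump_le_1) auto
    moreover have "1 / ((r / 4) ^ DIM('a) * I) = C * c" using c by (simp add: C_def)
    ultimately show ?thesis using C mult_left_mono[of c "mollifier 3 r (z - x)" C] by linarith
  next
    case False
    then show ?thesis using r C by (simp add: mollifier_eq_0 mollifier_nonneg)
  qed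
  show thesis
  proof (rule that[OF C])
    fix f :: "'a \<Rightarrow> ennreal" and y assume f: "f \<in> borel_measurable borel" and y: "y \<in> cball x (r / 4)"
    have "cball y r \<subseteq> cball x (2 * r)"
    proof
      fix z assume "z \<in> cball y r"
      then show "z \<in> cball x (2 * r)" using dist_triangle[of x z y] y r by simp
    qed
    then have "cball y r \<subseteq> D" using r by blast
    then have "H f y = (\<integral>\<^sup>+z. ennreal (mollifier 3 (r / 4) (z - y)) * H f z \<partial>lborel)"
      using r f by (intro H_mollifier_mean) auto
    also have "\<dots> \<le> (\<integral>\<^sup>+z. ennreal C * (ennreal (mollifier 3 r (z - x)) * H f z) \<partial>lborel)"
    proof (rule nn_integral_mono)
      fix z
      have "ennreal (mollifier 3 (r / 4) (z - y)) \<le> ennreal C * ennreal (mollifier 3 r (z - x))"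
        using le[OF y, of z] C r by (simp add: ennreal_mult[symmetric] mollifier_nonneg ennreal_leI)
      then show "ennreal (mollifier 3 (r / 4) (z - y)) * H f z \<le> ennreal C * (ennreal (mollifier 3 r (z - x)) * H f z)"
        unfolding mult.assoc[symmetric] by (rule mult_right_mono) simp
    qed
    also have "\<dots> = ennreal C * (\<integral>\<^sup>+z. ennreal (mollifier 3 r (z - x)) * H f z \<partial>lborel)"
    proof (rule nn_integral_cmult)
      have "(\<lambda>z. ennreal (mollifier 3 r (z - x))) \<in> borel_measurable borel"
        by (intro measurable_compose[OF _ measurable_ennreal] borel_measurable_continuous_onI continuous_intros)
      then show "(\<lambda>z. ennreal (mollifier 3 r (z - x)) * H f z) \<in> borel_measurable lborel"
        using H_measurable[OF f] by simp
    qed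
    also have "(\<integral>\<^sup>+z. ennreal (mollifier 3 r (z - x)) * H f z \<partial>lborel) = H f x"
      using r f by (intro H_mollifier_mean[symmetric, of x "2 * r"]) auto
    finally show "H f y \<le> ennreal C * H f x" .
  qed
qed

text \<open>By the Harnack estimate the sets where \<open>H f\<close> is finite and where it is
  infinite are both open, and D is connected.\<close>

lemma H_finite:
  assumes f: "f \<in> borel_measurable borel" and x0: "x0 \<in> D" "H f x0 < \<infinity>" and x: "x \<in> D"
  shows "H f x < \<infinity>"
proof -
  define A where "A = {y \<in> D. H f y < \<infinity>}"
  define B where "B = {y \<in> D. H f y = \<infinity>}"
  have near: "H f y < \<infinity>" if a: "0 < r" "cball x (2 * r) \<subseteq> D" "y \<in> cball x (r / 4)" "H f x < \<infinity>" for x y r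
  proof -
    obtain C where "0 \<le> C" "H f y \<le> ennreal C * H f x"
      using H_Harnack[OF a(1,2)] f a(3) by metis
    then show ?thesis using a(4) by (metis ennreal_less_top ennreal_mult_less_top infinity_ennreal_def le_less_trans)
  qed
  have rad: "\<exists>r>0. cball y (4 * r) \<subseteq> D" if y: "y \<in> D" for y
  proof -
    obtain e where "0 < e" "cball y e \<subseteq> D" using openD y open_contains_cball by blast
    then show ?thesis by (intro exI[of _ "e / 4"]) auto
  qed
  have "open A"
    unfolding open_contains_ball
  proof
    fix y assume y: "y \<in> A"
    then obtain r where r: "0 < r" "cball y (4 * r) \<subseteq> D" using rad by (auto simp: A_def)
    then have "cball y (2 * r) \<subseteq> D" using subset_cball[of "2 * r" "4 * r" y] by force
    then have "ball y (r / 4) \<subseteq> A"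
      using near[OF r(1)] y r(1) by (auto simp: A_def subset_iff)
    then show "\<exists>e>0. ball y e \<subseteq> A" using r(1) by (intro exI[of _ "r / 4"]) auto
  qed
  moreover have "open B"
    unfolding open_contains_ball
  proof
    fix y assume y: "y \<in> B"
    then obtain r where r: "0 < r" "cball y (4 * r) \<subseteq> D" using rad by (auto simp: B_def)
    \<comment> \<open>The same estimate with exchanged roles: finiteness at z would spread to y. The
      radius 4 * r leaves room for the ball of radius 2 * r around z.\<close>
    have "z \<in> B" if z: "z \<in> ball y (r / 4)" for z
    proof -
      have sub: "cball z (2 * r) \<subseteq> D"
      proof
        fix w assume "w \<in> cball z (2 * r)"
        then have "dist y w \<le> 4 * r" using dist_triangle[of y w z] z r(1) by simp
        then show "w \<in> D" using r(2) by auto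
      qed
      have "\<not> H f z < \<infinity>"
        using near[OF r(1) sub, of y] z y by (auto simp: B_def dist_commute)
      moreover have "z \<in> D" using sub r(1) by auto
      ultimately show ?thesis by (simp add: B_def not_less top_unique)
    qed
    then show "\<exists>e>0. ball y e \<subseteq> B" using r(1) by (intro exI[of _ "r / 4"]) auto
  qed
  moreover have "A \<inter> B \<inter> D = {}" by (auto simp: A_def B_def)
  moreover have "D \<subseteq> A \<union> B" by (auto simp: A_def B_def less_top)
  ultimately have "A \<inter> D = {} \<or> B \<inter> D = {}" using connD by (intro connectedD) auto
  moreover have "x0 \<in> A \<inter> D" using x0 by (simp add: A_def)
  ultimately have "x \<notin> B" using x by auto
  then show ?thesis using x by (simp add: B_def less_top)
qed

text \<open>The Harnack estimate supplies the local bounds, and \<open>H_mollifier_mean\<close> the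
  mean value property, that \<open>mollifier_mean_imp_harmonic\<close> asks for.\<close>

lemma H_harmonic:
  assumes f: "f \<in> borel_measurable borel" and fin: "\<And>x. x \<in> D \<Longrightarrow> H f x < \<infinity>"
  shows "harmonic_on D (\<lambda>x. enn2real (H f x))"
proof (rule mollifier_mean_imp_harmonic[OF openD])
  show "(\<lambda>x. enn2real (H f x)) \<in> borel_measurable borel"
    using H_measurable[OF f] by simp
  fix x
  show "\<exists>r>0. \<exists>C. \<forall>z\<in>cball x r. \<bar>enn2real (H f z)\<bar> \<le> C" if x: "x \<in> D"
  proof -
    obtain e where e: "0 < e" "cball x e \<subseteq> D" using openD x open_contains_cball by blast
    obtain C where C: "0 \<le> C" "\<And>f y. f \<in> borel_measurable borel \<Longrightarrow> y \<in> cball x (e / 2 / 4) \<Longrightarrow> H f y \<le> ennreal C * H f x"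
      using H_Harnack[of "e / 2" x] e by auto
    have "enn2real (H f z) \<le> enn2real (ennreal C * H f x)" if "z \<in> cball x (e / 2 / 4)" for z
      using C(2)[OF f that] fin[OF x] by (intro enn2real_mono) (auto simp: ennreal_mult_less_top)
    then show ?thesis using e by (intro exI[of _ "e / 2 / 4"] conjI exI[of _ "enn2real (ennreal C * H f x)"]) auto
  qed
  fix r R assume R: "0 < r" "r < R" "cball x R \<subseteq> D"
  have "(\<integral>z. enn2real (H f z) * mollifier 3 r (z - x) \<partial>lborel)
      = enn2real (\<integral>\<^sup>+z. ennreal (enn2real (H f z) * mollifier 3 r (z - x)) \<partial>lborel)"
  proof (rule integral_eq_nn_integral)
    have "(\<lambda>z. mollifier 3 r (z - x)) \<in> borel_measurable borel"
      by (intro borel_measurable_continuous_onI continuous_intros)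
    then show "(\<lambda>z. enn2real (H f z) * mollifier 3 r (z - x)) \<in> borel_measurable lborel"
      using H_measurable[OF f] by simp
  qed (use R in \<open>auto simp: mollifier_nonneg\<close>)
  also have "(\<integral>\<^sup>+z. ennreal (enn2real (H f z) * mollifier 3 r (z - x)) \<partial>lborel)
      = (\<integral>\<^sup>+z. ennreal (mollifier 3 r (z - x)) * H f z \<partial>lborel)"
  proof (rule nn_integral_cong)
    fix z
    show "ennreal (enn2real (H f z) * mollifier 3 r (z - x)) = ennreal (mollifier 3 r (z - x)) * H f z"
    proof (cases "z \<in> D")
      case True
      then show ?thesis using fin[OF True] R by (simp add: ennreal_mult mollifier_nonneg mult.commute)
    next
      case False
      then have "r \<le> norm (z - x)" by (rule outside_cball) (use R in auto)
      then show ?thesis using R by (simp add: mollifier_eq_0)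
    qed
  qed
  also have "\<dots> = H f x" by (rule H_mollifier_mean[OF R(3,1,2) f, symmetric])
  finally show "enn2real (H f x) = (\<integral>z. enn2real (H f z) * mollifier 3 r (z - x) \<partial>lborel)" by simp
qed

end

section \<open>Controlled convergence\<close>

text \<open>Neither summand may be 0, since nothing lies strictly below 0.\<close>

lemma ennreal_less_add_split:
  fixes a b c :: ennreal
  assumes "c < a + b" "a \<noteq> 0" "b \<noteq> 0"
  obtains c1 c2 where "c1 < a" "c2 < b" "c < c1 + c2"
proof -
  have "c < top" using assms(1) by (rule less_le_trans) simp
  then obtain r where r: "c = ennreal r" "0 \<le> r" by (cases c) auto
  show thesis
  proof (cases "a = top \<or> b = top")
    case True
    then show thesis
    proof
      assume "a = top"
      then show thesis
        using that[of "ennreal (r + 1)" 0] r assms(3) by (simp add: zero_less_iff_neq_zero ennreal_less_iff)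
    next
      assume "b = top"
      then show thesis
        using that[of 0 "ennreal (r + 1)"] r assms(2) by (simp add: zero_less_iff_neq_zero ennreal_less_iff)
    qed
  next
    case False
    then obtain s t where st: "a = ennreal s" "0 \<le> s" "b = ennreal t" "0 \<le> t"
      by (cases a; cases b) auto
    have st0: "0 < s" "0 < t" using st assms by (auto simp: less_le)
    have rst: "r < s + t"
      using assms(1) r st by (simp add: ennreal_plus[symmetric] ennreal_less_iff del: ennreal_plus)
    \<comment> \<open>A third of the slack: lowering both summands by at most d leaves their sum
      above r, and the halves below keep them nonnegative.\<close>
    define d where "d = (s + t - r) / 3"
    have d: "0 < d" "s + t = r + 3 * d" using rst by (simp_all add: d_def field_simps)
    define s' where "s' = max (s / 2) (s - d)"
    define t' where "t' = max (t / 2) (t - d)"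
    have "0 \<le> s'" "s' < s" "0 \<le> t'" "t' < t" "r < s' + t'"
      using st0 d by (auto simp: s'_def t'_def max_def)
    then show thesis
      using that[of "ennreal s'" "ennreal t'"] st r
      by (simp add: ennreal_plus[symmetric] ennreal_less_iff del: ennreal_plus)
  qed
qed

lemma ennreal_le_suminf: "(f i :: ennreal) \<le> (\<Sum>n. f n)"
  using sum_le_suminf[of f "{i}"] by simp

context harmonic_measures
begin

text \<open>Stands in for lower semicontinuity through the one consequence that the squeeze uses;
  stable under sums, positive multiples and countable suprema.\<close>

definition lower_admissible :: "('a \<Rightarrow> ennreal) \<Rightarrow> bool" where
  "lower_admissible u \<longleftrightarrow> u \<in> borel_measurable borel \<and>
    (\<forall>y\<in>frontier D. \<forall>c<u y. \<forall>\<^sub>F x in at y within D. c < H u x)"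

text \<open>The bound on v is what later estimates \<open>H f\<close> by a constant plus a small
  multiple of the control, as the clause for a control tending to infinity requires.\<close>

definition upper_admissible :: "('a \<Rightarrow> ennreal) \<Rightarrow> bool" where
  "upper_admissible v \<longleftrightarrow> v \<in> borel_measurable borel \<and> (\<exists>m<\<infinity>. \<forall>z. v z \<le> m) \<and>
    (\<forall>y\<in>frontier D. \<forall>c>v y. \<forall>\<^sub>F x in at y within D. H v x < c)"

lemma H_mono: "(\<And>z. f z \<le> g z) \<Longrightarrow> H f x \<le> H g x"
  unfolding H_def by (rule nn_integral_mono) simp

lemma H_add: "f \<in> borel_measurable borel \<Longrightarrow> g \<in> borel_measurable borel \<Longrightarrow> H (\<lambda>z. f z + g z) x = H f x + H g x"
  unfolding H_def by (rule nn_integral_add) (simp_all add: measurable\<mu>)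

lemma H_cmult: "f \<in> borel_measurable borel \<Longrightarrow> H (\<lambda>z. c * f z) x = c * H f x"
  unfolding H_def by (rule nn_integral_cmult) (simp_all add: measurable\<mu>)

lemma H_const: "H (\<lambda>_. c) x = c"
  unfolding H_def using prob_space.emeasure_space_1[OF prob, of x] by simp

lemma H_continuous_tendsto:
  fixes \<phi> :: "'a \<Rightarrow> real"
  assumes \<phi>: "continuous_on UNIV \<phi>" "\<And>z. 0 \<le> \<phi> z" "\<And>z. \<phi> z \<le> 1" and y: "y \<in> frontier D"
  shows "((\<lambda>x. H (\<lambda>z. ennreal (\<phi> z)) x) \<longlongrightarrow> ennreal (\<phi> y)) (at y within D)"
proof -
  obtain h where h: "(h \<longlongrightarrow> \<phi> y) (at y within D)" "\<And>x. x \<in> D \<Longrightarrow> (\<integral>z. \<phi> z \<partial>\<mu> x) = h x"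
    using dirichlet[OF \<phi>(1)] y by blast
  have \<phi>m: "\<phi> \<in> borel_measurable borel" using \<phi>(1) by (rule borel_measurable_continuous_onI)
  have conv: "H (\<lambda>z. ennreal (\<phi> z)) x = ennreal (\<integral>z. \<phi> z \<partial>\<mu> x)" for x
    unfolding H_def using \<phi> \<phi>m by (intro nn_integral_eq_integral finite_measure.integrable_const_bound[where B = 1]
        prob_space.finite_measure prob) (auto simp: measurable\<mu>)
  have "((\<lambda>x. ennreal (h x)) \<longlongrightarrow> ennreal (\<phi> y)) (at y within D)"
    by (rule tendsto_ennrealI[OF h(1)])
  then show ?thesis
    by (rule Lim_transform_within[of _ _ _ _ 1]) (use h(2) conv in auto)
qed

text \<open>A continuous tent below the indicator, with value 1 at y, carries the boundary limit
  over.\<close>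

lemma lower_admissible_open:
  assumes "open S"
  shows "lower_admissible (indicator S)"
  unfolding lower_admissible_def
proof (intro conjI ballI allI impI)
  show "indicator S \<in> borel_measurable borel" using assms by (intro borel_measurable_indicator) auto
  fix y and c :: ennreal assume y: "y \<in> frontier D" and c: "c < indicator S y"
  have "y \<in> S" by (rule ccontr) (use c in simp)
  then have c1: "c < 1" using c by simp
  obtain r where r: "0 < r" "cball y r \<subseteq> S" using assms \<open>y \<in> S\<close> open_contains_cball by blast
  define \<phi> where "\<phi> z = max 0 (1 - dist z y / r)" for z
  have \<phi>: "continuous_on UNIV \<phi>" "\<And>z. 0 \<le> \<phi> z" "\<And>z. \<phi> z \<le> 1" "\<phi> y = 1"
    unfolding \<phi>_def[abs_def] using r(1) by (auto intro!: continuous_intros)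
  have le: "ennreal (\<phi> z) \<le> indicator S z" for z
  proof (cases "z \<in> S")
    case False
    then have "z \<notin> cball y r" using r(2) by blast
    then have "r < dist z y" by (simp add: dist_commute)
    then have "1 < dist z y / r" using r(1) by simp
    then show ?thesis by (simp add: \<phi>_def)
  qed (use \<phi>(3) in simp)
  have "c < ennreal (\<phi> y)" using c1 \<phi>(4) by simp
  with H_continuous_tendsto[OF \<phi>(1,2,3) y]
  have "\<forall>\<^sub>F x in at y within D. c < H (\<lambda>z. ennreal (\<phi> z)) x"
    by (rule order_tendstoD(1))
  then show "\<forall>\<^sub>F x in at y within D. c < H (indicator S) x"
    by (rule eventually_mono) (erule less_le_trans[OF _ H_mono[OF le]])
qed

text \<open>At y outside S a continuous majorant of the indicator that vanishes at y does the work;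
  at y in S it suffices that \<open>H\<close> of an indicator is at most 1.\<close>

lemma upper_admissible_closed:
  assumes "closed S"
  shows "upper_admissible (indicator S)"
  unfolding upper_admissible_def
proof (intro conjI ballI allI impI)
  show "indicator S \<in> borel_measurable borel" using assms by (intro borel_measurable_indicator) auto
  show "\<exists>m<\<infinity>. \<forall>z. (indicator S z :: ennreal) \<le> m"
    by (intro exI[of _ 1]) (auto simp: indicator_def)
  fix y and c :: ennreal assume y: "y \<in> frontier D" and c: "indicator S y < c"
  show "\<forall>\<^sub>F x in at y within D. H (indicator S) x < c"
  proof (cases "y \<in> S")
    case True
    have le1: "H (indicator S) x \<le> 1" for x
      using H_mono[of "indicator S" "\<lambda>_. 1" x] by (simp add: H_const indicator_def)
    have "1 < c" using c True by simp
    then show ?thesis by (intro always_eventually allI) (rule le_less_trans[OF le1])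
  next
    case False
    have "open (- S)" using assms by (rule open_Compl)
    then obtain r where r: "0 < r" "cball y r \<subseteq> - S" using False open_contains_cball by blast
    define \<phi> where "\<phi> z = min 1 (dist z y / r)" for z
    have \<phi>: "continuous_on UNIV \<phi>" "\<And>z. 0 \<le> \<phi> z" "\<And>z. \<phi> z \<le> 1" "\<phi> y = 0"
      unfolding \<phi>_def[abs_def] using r(1) by (auto intro!: continuous_intros)
    have le: "indicator S z \<le> ennreal (\<phi> z)" for z
    proof (cases "z \<in> S")
      case True
      then have "z \<notin> cball y r" using r(2) by blast
      then have "r < dist z y" by (simp add: dist_commute)
      then have "1 < dist z y / r" using r(1) by simp
      then show ?thesis using True by (simp add: \<phi>_def)
    qed simp
    have "ennreal (\<phi> y) < c" using c False \<phi>(4) by simp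
    with H_continuous_tendsto[OF \<phi>(1,2,3) y]
    have "\<forall>\<^sub>F x in at y within D. H (\<lambda>z. ennreal (\<phi> z)) x < c"
      by (rule order_tendstoD(2))
    then show ?thesis
      by (rule eventually_mono) (erule le_less_trans[OF H_mono[OF le]])
  qed
qed

lemma lower_admissible_add:
  assumes u: "lower_admissible u1" "lower_admissible u2"
  shows "lower_admissible (\<lambda>z. u1 z + u2 z)"
  unfolding lower_admissible_def
proof (intro conjI ballI allI impI)
  have m: "u1 \<in> borel_measurable borel" "u2 \<in> borel_measurable borel"
    using u by (auto simp: lower_admissible_def)
  then show "(\<lambda>z. u1 z + u2 z) \<in> borel_measurable borel" by simp
  fix y and c :: ennreal assume y: "y \<in> frontier D" and c: "c < u1 y + u2 y"
  have 1: "\<forall>\<^sub>F x in at y within D. d < H u1 x" if "d < u1 y" for d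
    using u(1) y that by (auto simp: lower_admissible_def)
  have 2: "\<forall>\<^sub>F x in at y within D. d < H u2 x" if "d < u2 y" for d
    using u(2) y that by (auto simp: lower_admissible_def)
  \<comment> \<open>The value 0 cannot be undercut, so \<open>ennreal_less_add_split\<close> needs
    both values positive; if one is 0, the other alone exceeds c.\<close>
  consider "u1 y = 0" | "u2 y = 0" | "u1 y \<noteq> 0" "u2 y \<noteq> 0" by blast
  then show "\<forall>\<^sub>F x in at y within D. c < H (\<lambda>z. u1 z + u2 z) x"
  proof cases
    case 1
    then have "c < u2 y" using c by simp
    from 2[OF this] show ?thesis
      by eventually_elim (simp add: H_add m add_increasing less_le_trans)
  next
    case 2
    then have "c < u1 y" using c by simp
    from 1[OF this] show ?thesis
      by eventually_elim (simp add: H_add m add_increasing2 less_le_trans)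
  next
    case 3
    then obtain c1 c2 where cc: "c1 < u1 y" "c2 < u2 y" "c < c1 + c2"
      using ennreal_less_add_split[OF c] by metis
    from 1[OF cc(1)] 2[OF cc(2)] show ?thesis
    proof eventually_elim
      case (elim x)
      have "c < c1 + c2" by (rule cc(3))
      also have "\<dots> \<le> H u1 x + H u2 x" using elim by (intro add_mono) auto
      finally show ?case by (simp add: H_add m)
    qed
  qed
qed

lemma lower_admissible_cmult:
  assumes u: "lower_admissible u" and a: "0 < a" "a < \<infinity>"
  shows "lower_admissible (\<lambda>z. a * u z)"
  unfolding lower_admissible_def
proof (intro conjI ballI allI impI)
  have m: "u \<in> borel_measurable borel" using u by (auto simp: lower_admissible_def)
  then show "(\<lambda>z. a * u z) \<in> borel_measurable borel" by simp
  have iff: "c < a * t \<longleftrightarrow> c / a < t" for c t :: ennreal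
    using a by (subst divide_less_ennreal) (auto simp: mult.commute less_top)
  fix y and c :: ennreal assume y: "y \<in> frontier D" and c: "c < a * u y"
  then show "\<forall>\<^sub>F x in at y within D. c < H (\<lambda>z. a * u z) x"
    using u unfolding H_cmult[OF m] iff by (auto simp: lower_admissible_def)
qed

text \<open>Suprema preserve lower bounds on \<open>H u\<close>, not upper ones; this is why the
  approximation below takes its minorant from a single index.\<close>

lemma lower_admissible_SUP:
  assumes u: "\<And>i::nat. lower_admissible (u i)"
  shows "lower_admissible (\<lambda>z. SUP i. u i z)"
  unfolding lower_admissible_def
proof (intro conjI ballI allI impI)
  show "(\<lambda>z. SUP i. u i z) \<in> borel_measurable borel"
    using u by (intro borel_measurable_SUP) (auto simp: lower_admissible_def)
  fix y and c :: ennreal assume y: "y \<in> frontier D" and c: "c < (SUP i. u i y)"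
  then obtain i where "c < u i y" by (auto simp: less_SUP_iff)
  then have "\<forall>\<^sub>F x in at y within D. c < H (u i) x"
    using u[of i] y by (auto simp: lower_admissible_def)
  then show "\<forall>\<^sub>F x in at y within D. c < H (\<lambda>z. SUP i. u i z) x"
    by (rule eventually_mono) (erule less_le_trans, rule H_mono, rule SUP_upper, simp)
qed

lemma upper_admissible_add:
  assumes v: "upper_admissible v1" "upper_admissible v2"
  shows "upper_admissible (\<lambda>z. v1 z + v2 z)"
  unfolding upper_admissible_def
proof (intro conjI ballI allI impI)
  have m: "v1 \<in> borel_measurable borel" "v2 \<in> borel_measurable borel"
    using v by (auto simp: upper_admissible_def)
  then show "(\<lambda>z. v1 z + v2 z) \<in> borel_measurable borel" by simp
  obtain m1 m2 where b: "m1 < \<infinity>" "\<And>z. v1 z \<le> m1" "m2 < \<infinity>" "\<And>z. v2 z \<le> m2"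
    using v by (auto simp: upper_admissible_def)
  then show "\<exists>m<\<infinity>. \<forall>z. v1 z + v2 z \<le> m"
    by (intro exI[of _ "m1 + m2"]) (auto intro: add_mono)
  fix y and c :: ennreal assume y: "y \<in> frontier D" and c: "v1 y + v2 y < c"
  obtain t1 t2 where t: "v1 y = ennreal t1" "0 \<le> t1" "v2 y = ennreal t2" "0 \<le> t2"
    using b le_less_trans[OF b(2)[of y] b(1)] le_less_trans[OF b(4)[of y] b(3)]
    by (cases "v1 y"; cases "v2 y") auto
  obtain s where s: "ennreal s \<le> c" "t1 + t2 < s"
  proof (cases c)
    case (real r)
    then show ?thesis using that[of r] c t by (simp add: ennreal_plus[symmetric] ennreal_less_iff del: ennreal_plus)
  next
    case top
    then show ?thesis using that[of "t1 + t2 + 1"] by simp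
  qed
  define d where "d = (s - t1 - t2) / 2"
  have d: "0 < d" using s by (simp add: d_def)
  have "\<forall>\<^sub>F x in at y within D. H v1 x < ennreal (t1 + d)" "\<forall>\<^sub>F x in at y within D. H v2 x < ennreal (t2 + d)"
    using v y t d by (auto simp: upper_admissible_def ennreal_less_iff)
  then show "\<forall>\<^sub>F x in at y within D. H (\<lambda>z. v1 z + v2 z) x < c"
  proof eventually_elim
    case (elim x)
    then have "H v1 x + H v2 x < ennreal (t1 + d) + ennreal (t2 + d)"
      by (rule add_strict_mono)
    also have "\<dots> = ennreal s" using t d by (simp add: ennreal_plus[symmetric] d_def field_simps del: ennreal_plus)
    finally show ?case using s(1) by (simp add: H_add m)
  qed
qed

lemma upper_admissible_cmult:
  assumes v: "upper_admissible v" and a: "0 < a" "a < \<infinity>"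
  shows "upper_admissible (\<lambda>z. a * v z)"
  unfolding upper_admissible_def
proof (intro conjI ballI allI impI)
  have m: "v \<in> borel_measurable borel" using v by (auto simp: upper_admissible_def)
  then show "(\<lambda>z. a * v z) \<in> borel_measurable borel" by simp
  obtain b where "b < \<infinity>" "\<And>z. v z \<le> b" using v by (auto simp: upper_admissible_def)
  then show "\<exists>m<\<infinity>. \<forall>z. a * v z \<le> m"
    using a by (intro exI[of _ "a * b"]) (auto intro: mult_left_mono simp: ennreal_mult_less_top)
  have iff: "a * t < c \<longleftrightarrow> t < c / a" for c t :: ennreal
  proof -
    have ac: "a * (c / a) = c"
      using a by (simp add: ennreal_times_divide mult.commute[of a] ennreal_mult_divide_eq less_top)
    show ?thesis
    proof
      assume "a * t < c"
      then show "t < c / a" using ac mult_left_mono[of "c / a" t a] by (intro not_le_imp_less notI) auto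
    next
      assume "t < c / a"
      then have "a * t < a * (c / a)" using a by (intro ennreal_mult_strict_left_mono) auto
      then show "a * t < c" using ac by simp
    qed
  qed
  fix y and c :: ennreal assume y: "y \<in> frontier D" and c: "a * v y < c"
  then show "\<forall>\<^sub>F x in at y within D. H (\<lambda>z. a * v z) x < c"
    using v unfolding H_cmult[OF m] iff by (auto simp: upper_admissible_def)
qed

text \<open>Finiteness of \<open>H v x\<close> is what permits cancelling it from both
  sides.\<close>

lemma H_diff_le:
  assumes m: "u \<in> borel_measurable borel" "v \<in> borel_measurable borel"
    and le: "\<And>z. v z \<le> u z" "H u x \<le> H v x + e" and fin: "H v x < \<infinity>"
  shows "H (\<lambda>z. u z - v z) x \<le> e"
proof -
  have "H u x = H (\<lambda>z. (u z - v z) + v z) x"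
    using le(1) by (simp add: diff_add_cancel_ennreal)
  also have "\<dots> = H (\<lambda>z. u z - v z) x + H v x"
    using m by (intro H_add) auto
  finally have "H v x + H (\<lambda>z. u z - v z) x \<le> H v x + e"
    using le(2) by (simp add: add.commute)
  then show ?thesis using fin by (auto simp: ennreal_add_left_cancel_le)
qed

text \<open>The Vitali--Caratheodory theorem for the harmonic measure at \<open>x0\<close>, with semicontinuity replaced by
  the boundary behaviour of the integrals that it would entail.\<close>

lemma admissible_approx:
  assumes f: "f \<in> borel_measurable borel" and fin: "H f x0 < \<infinity>" and e: "0 < (e::real)"
  shows "\<exists>u v. lower_admissible u \<and> upper_admissible v \<and> (\<forall>z. v z \<le> f z) \<and> (\<forall>z. f z \<le> u z) \<and>
    H u x0 \<le> H v x0 + ennreal e"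
  using f fin e
proof (induction arbitrary: e rule: borel_measurable_induct)
  case (cong f g)
  then have "f = g" by auto
  then show ?case using cong by simp
next
  case (set A)
  interpret prob_space "\<mu> x0" by (rule prob)
  have fm: "emeasure (\<mu> x0) (space (\<mu> x0)) \<noteq> \<infinity>" by simp
  have A: "A \<in> sets borel" using set by simp
  have e2: "0 < ennreal (e / 2)" using set by simp
  \<comment> \<open>Outer regularity gives an open superset and inner regularity a compact subset,
    each at a cost of e / 2.\<close>
  have lt: "emeasure (\<mu> x0) A < emeasure (\<mu> x0) A + ennreal (e / 2)"
    using ennreal_add_left_cancel_less[of "emeasure (\<mu> x0) A" 0 "ennreal (e / 2)"] e2 by simp
  then have "(INF U \<in> {U. A \<subseteq> U \<and> open U}. emeasure (\<mu> x0) U) < emeasure (\<mu> x0) A + ennreal (e / 2)"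
    unfolding outer_regular[OF sets\<mu> fm A, symmetric] .
  then obtain U where U: "A \<subseteq> U" "open U" "emeasure (\<mu> x0) U < emeasure (\<mu> x0) A + ennreal (e / 2)"
    by (auto simp: INF_less_iff)
  have "emeasure (\<mu> x0) A < (SUP K \<in> {K. K \<subseteq> A \<and> compact K}. emeasure (\<mu> x0) K + ennreal (e / 2))"
  proof -
    have "(SUP K \<in> {K. K \<subseteq> A \<and> compact K}. emeasure (\<mu> x0) K + ennreal (e / 2)) =
        (SUP K \<in> {K. K \<subseteq> A \<and> compact K}. emeasure (\<mu> x0) K) + ennreal (e / 2)"
      by (intro ennreal_SUP_add_left) auto
    with lt show ?thesis unfolding inner_regular[OF sets\<mu> fm A, symmetric] by simp
  qed
  then obtain K where K: "K \<subseteq> A" "compact K" "emeasure (\<mu> x0) A < emeasure (\<mu> x0) K + ennreal (e / 2)"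
    by (auto simp: less_SUP_iff)
  have Kb: "closed K" using K(2) by (rule compact_imp_closed)
  have HI: "H (indicator B) x0 = emeasure (\<mu> x0) B" if "B \<in> sets borel" for B
    unfolding H_def using that sets\<mu> by simp
  show ?case
  proof (intro exI conjI allI)
    show "lower_admissible (indicator U)" by (rule lower_admissible_open[OF U(2)])
    show "upper_admissible (indicator K)" by (rule upper_admissible_closed[OF Kb])
    show "indicator K z \<le> (indicator A z :: ennreal)" "indicator A z \<le> (indicator U z :: ennreal)" for z
      using U(1) K(1) by (auto simp: indicator_def)
    have "emeasure (\<mu> x0) U \<le> emeasure (\<mu> x0) K + ennreal (e / 2) + ennreal (e / 2)"
      using U(3) add_right_mono[OF less_imp_le[OF K(3)], of "ennreal (e / 2)"] by (meson less_imp_le order_trans)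
    also have "\<dots> = emeasure (\<mu> x0) K + ennreal e"
      using set by (simp add: add.assoc ennreal_plus[symmetric] del: ennreal_plus)
    finally show "H (indicator U) x0 \<le> H (indicator K) x0 + ennreal e"
      using U(2) Kb by (simp add: HI)
  qed
next
  case (mult f c)
  show ?case
  proof (cases "c = 0")
    case True
    show ?thesis
    proof (intro exI conjI allI)
      show "lower_admissible (indicator {})" "upper_admissible (indicator {})"
        by (rule lower_admissible_open upper_admissible_closed; simp)+
    qed (use True in \<open>auto simp: H_def\<close>)
  next
    case False
    then obtain a where a: "c = ennreal a" "0 < a"
      using mult(1) by (cases c) (auto simp: less_le)
    have c: "0 < c" "c < \<infinity>" using a by auto
    have "H f x0 < \<infinity>"
      using mult.prems(1) c False unfolding H_cmult[OF mult(2)] by (auto simp: ennreal_mult_less_top)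
    \<comment> \<open>Precision e / a becomes e after multiplication by c.\<close>
    from mult.IH[OF this, of "e / a"] obtain u v where uv: "lower_admissible u" "upper_admissible v"
      "\<And>z. v z \<le> f z" "\<And>z. f z \<le> u z" "H u x0 \<le> H v x0 + ennreal (e / a)"
      using mult.prems(2) a(2) by auto
    have um: "u \<in> borel_measurable borel" "v \<in> borel_measurable borel"
      using uv by (auto simp: lower_admissible_def upper_admissible_def)
    show ?thesis
    proof (intro exI conjI allI)
      show "lower_admissible (\<lambda>z. c * u z)" by (rule lower_admissible_cmult[OF uv(1) c])
      show "upper_admissible (\<lambda>z. c * v z)" by (rule upper_admissible_cmult[OF uv(2) c])
      show "c * v z \<le> c * f z" "c * f z \<le> c * u z" for z using uv by (auto intro: mult_left_mono)
      have "c * H u x0 \<le> c * (H v x0 + ennreal (e / a))" using uv(5) by (intro mult_left_mono) auto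
      also have "\<dots> = c * H v x0 + ennreal e"
        using a mult.prems(2) by (simp add: distrib_left ennreal_mult'[symmetric])
      finally show "H (\<lambda>z. c * u z) x0 \<le> H (\<lambda>z. c * v z) x0 + ennreal e" by (simp add: H_cmult um)
    qed
  qed
next
  case (add f g)
  have "H g x0 + H f x0 < \<infinity>" using add.prems(1) add by (simp add: H_add)
  then have fin: "H f x0 < \<infinity>" "H g x0 < \<infinity>" by auto
  have e2: "0 < e / 2" using add.prems by simp
  obtain u1 v1 where 1: "lower_admissible u1" "upper_admissible v1"
      "\<And>z. v1 z \<le> f z" "\<And>z. f z \<le> u1 z" "H u1 x0 \<le> H v1 x0 + ennreal (e / 2)"
    using add.IH(1)[OF fin(1) e2] by blast
  obtain u2 v2 where 2: "lower_admissible u2" "upper_admissible v2"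
      "\<And>z. v2 z \<le> g z" "\<And>z. g z \<le> u2 z" "H u2 x0 \<le> H v2 x0 + ennreal (e / 2)"
    using add.IH(2)[OF fin(2) e2] by blast
  have m: "u1 \<in> borel_measurable borel" "v1 \<in> borel_measurable borel" "u2 \<in> borel_measurable borel" "v2 \<in> borel_measurable borel"
    using 1 2 by (auto simp: lower_admissible_def upper_admissible_def)
  show ?case
  proof (intro exI conjI allI)
    show "lower_admissible (\<lambda>z. u2 z + u1 z)" by (rule lower_admissible_add[OF 2(1) 1(1)])
    show "upper_admissible (\<lambda>z. v2 z + v1 z)" by (rule upper_admissible_add[OF 2(2) 1(2)])
    show "v2 z + v1 z \<le> g z + f z" "g z + f z \<le> u2 z + u1 z" for z using 1 2 by (auto intro: add_mono)
    have "H u2 x0 + H u1 x0 \<le> (H v2 x0 + ennreal (e / 2)) + (H v1 x0 + ennreal (e / 2))"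
      using 1(5) 2(5) by (rule add_mono[rotated])
    also have "\<dots> = H v2 x0 + H v1 x0 + (ennreal (e / 2) + ennreal (e / 2))" by (simp add: ac_simps)
    also have "ennreal (e / 2) + ennreal (e / 2) = ennreal e"
      using e2 by (simp add: ennreal_plus[symmetric] del: ennreal_plus)
    finally show "H (\<lambda>z. u2 z + u1 z) x0 \<le> H (\<lambda>z. v2 z + v1 z) x0 + ennreal e" by (simp add: H_add m)
  qed
next
  case (seq F)
  define F0 where "F0 = (SUP i. F i)"
  have F0z: "F0 z = (SUP i. F i z)" for z by (simp add: F0_def image_comp)
  have Fle: "F i z \<le> F0 z" for i z unfolding F0z by (rule SUP_upper) simp
  have F0m: "F0 \<in> borel_measurable borel"
  proof -
    have "F0 = (\<lambda>z. SUP i. F i z)" by (simp add: fun_eq_iff F0z)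
    moreover have "(\<lambda>z. SUP i. F i z) \<in> borel_measurable borel"
      using seq(1) by (intro borel_measurable_SUP) auto
    ultimately show ?thesis by simp
  qed
  have fin0: "H F0 x0 < \<infinity>" using seq.prems(1) unfolding F0_def .
  have fin: "H (F i) x0 < \<infinity>" for i
    by (rule le_less_trans[OF H_mono[OF Fle] fin0])
  \<comment> \<open>These tolerances sum to e / 2 and each is at most e / 4; with another e / 4 for
    stopping at a single index the total is e.\<close>
  define \<epsilon> where "\<epsilon> i = e / 4 * (1 / 2) ^ i" for i :: nat
  have \<epsilon>0: "0 < \<epsilon> i" for i using seq.prems(2) by (simp add: \<epsilon>_def)
  have "\<forall>i. \<exists>u v. lower_admissible u \<and> upper_admissible v \<and> (\<forall>z. v z \<le> F i z) \<and> (\<forall>z. F i z \<le> u z) \<and>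
    H u x0 \<le> H v x0 + ennreal (\<epsilon> i)"
    by (intro allI seq.IH[OF fin \<epsilon>0])
  then obtain u v where uv: "\<And>i. lower_admissible (u i)" "\<And>i. upper_admissible (v i)"
    "\<And>i z. v i z \<le> F i z" "\<And>i z. F i z \<le> u i z" "\<And>i. H (u i) x0 \<le> H (v i) x0 + ennreal (\<epsilon> i)"
    by metis
  have um: "u i \<in> borel_measurable borel" for i using uv(1) by (auto simp: lower_admissible_def)
  have Fm: "F i \<in> borel_measurable borel" for i by (rule seq(1))
  have diff: "H (\<lambda>z. u i z - F i z) x0 \<le> ennreal (\<epsilon> i)" for i
    by (rule H_diff_le[OF um Fm uv(4) _ fin]) (rule order_trans[OF uv(5) add_right_mono[OF H_mono[OF uv(3)]]])
  \<comment> \<open>The accumulated excess of the majorants; it keeps the supremum of all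
    \<open>u i\<close> below \<open>F0 + w\<close>.\<close>
  define w where "w z = (\<Sum>i. u i z - F i z)" for z
  have wm: "w \<in> borel_measurable borel"
    unfolding w_def using um Fm by measurable
  have Hw: "H w x0 \<le> ennreal (e / 2)"
  proof -
    have "H w x0 = (\<Sum>i. H (\<lambda>z. u i z - F i z) x0)"
      unfolding H_def w_def using um Fm by (intro nn_integral_suminf) (auto simp: measurable\<mu>)
    also have "\<dots> \<le> (\<Sum>i. ennreal (\<epsilon> i))" using diff by (intro suminf_le) auto
    also have "\<dots> = ennreal (\<Sum>i. \<epsilon> i)"
      using \<epsilon>0 by (intro suminf_ennreal2) (auto simp: \<epsilon>_def less_imp_le intro!: summable_mult summable_geometric)
    also have "(\<Sum>i. \<epsilon> i) = e / 2"
      unfolding \<epsilon>_def by (subst suminf_mult) (auto simp: suminf_geometric)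
    finally show ?thesis .
  qed
  have ule: "(SUP i. u i z) \<le> F0 z + w z" for z
  proof (rule SUP_least)
    fix i
    have "u i z = F i z + (u i z - F i z)" using uv(4)[of i z] by (simp add: add_diff_inverse_ennreal)
    also have "\<dots> \<le> F0 z + w z"
      unfolding w_def by (intro add_mono Fle ennreal_le_suminf)
    finally show "u i z \<le> F0 z + w z" .
  qed
  have "H F0 x0 = (SUP i. H (F i) x0)"
    unfolding H_def F0z using seq(1) \<open>incseq F\<close> by (intro nn_integral_monotone_convergence_SUP) (auto simp: measurable\<mu>)
  \<comment> \<open>By monotone convergence one index captures \<open>H F0 x0\<close> up to e / 4,
    and its minorant \<open>v i\<close> serves for the limit.\<close>
  have "\<exists>i. H F0 x0 \<le> H (F i) x0 + ennreal (e / 4)"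
  proof (rule ccontr)
    assume "\<nexists>i. H F0 x0 \<le> H (F i) x0 + ennreal (e / 4)"
    then have "H (F i) x0 + ennreal (e / 4) \<le> H F0 x0" for i by (auto simp: not_le less_imp_le)
    then have "(SUP i. H (F i) x0 + ennreal (e / 4)) \<le> H F0 x0" by (rule SUP_least)
    then have "H F0 x0 + ennreal (e / 4) \<le> H F0 x0 + 0"
      using \<open>H F0 x0 = (SUP i. H (F i) x0)\<close> by (simp add: ennreal_SUP_add_left)
    then show False using fin0 seq.prems(2) by (simp add: ennreal_add_left_cancel_le)
  qed
  then obtain i where i: "H F0 x0 \<le> H (F i) x0 + ennreal (e / 4)" by blast
  have \<epsilon>i: "\<epsilon> i \<le> e / 4"
    using seq.prems(2) power_le_one[of "1/2::real" i] unfolding \<epsilon>_def by (intro mult_left_le) auto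
  show ?case
  proof (intro exI conjI allI)
    show "lower_admissible (\<lambda>z. SUP i. u i z)" by (rule lower_admissible_SUP[OF uv(1)])
    show "upper_admissible (v i)" by (rule uv(2))
    show "v i z \<le> (SUP i. F i) z" for z
      using order_trans[OF uv(3) Fle] by (simp add: F0_def)
    show "(SUP i. F i) z \<le> (SUP i. u i z)" for z
      using F0z[of z] uv(4) by (auto simp: F0_def intro!: SUP_mono)
    have "H (\<lambda>z. SUP i. u i z) x0 \<le> H F0 x0 + H w x0"
      using H_mono[of "\<lambda>z. SUP i. u i z" "\<lambda>z. F0 z + w z" x0, OF ule] F0m wm by (simp add: H_add)
    also have "\<dots> \<le> (H (F i) x0 + ennreal (e / 4)) + ennreal (e / 2)"
      by (intro add_mono i Hw)
    also have "H (F i) x0 \<le> H (v i) x0 + ennreal (e / 4)"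
      using H_mono[of "F i" "u i" x0] uv(4)[of i] uv(5)[of i] ennreal_leI[OF \<epsilon>i]
      by (meson add_left_mono order_trans)
    finally have "H (\<lambda>z. SUP i. u i z) x0 \<le> H (v i) x0 + (ennreal (e / 4) + ennreal (e / 4) + ennreal (e / 2))"
      by (simp add: ac_simps add_right_mono)
    also have "ennreal (e / 4) + ennreal (e / 4) + ennreal (e / 2) = ennreal e"
      using seq.prems(2) by (simp add: ennreal_plus[symmetric] del: ennreal_plus)
    finally show "H (\<lambda>z. SUP i. u i z) x0 \<le> H (v i) x0 + ennreal e" .
  qed
qed

section \<open>Squeezing between admissible functions\<close>

text \<open>\<open>gap\<close> confines h, \<open>H (u n)\<close> and \<open>H (v n)\<close> to an
  interval of length 2^-n k. Where k is bounded this is uniformly small and the one-sided boundary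
  limits of both ends close in on \<open>f y\<close>; where k tends to infinity, boundedness of v n
  gives h at most \<open>m n\<close> plus 2^-n k for every n.\<close>

lemma admissible_imp_controlled_convergence:
  assumes f: "f \<in> borel_measurable borel" and g: "g \<in> borel_measurable borel"
    and fin: "\<And>x. x \<in> D \<Longrightarrow> H f x < \<infinity>" "\<And>x. x \<in> D \<Longrightarrow> H g x < \<infinity>"
    and u: "\<And>n. lower_admissible (u n)" "\<And>n z. f z \<le> u n z"
    and v: "\<And>n. upper_admissible (v n)" "\<And>n z. v n z \<le> f z"
    and gap: "\<And>n x. x \<in> D \<Longrightarrow> H (u n) x \<le> H (v n) x + ennreal ((1 / 2) ^ n) * H g x"
  shows "controlled_convergence D (\<lambda>y. enn2ereal (f y)) (\<lambda>x. enn2real (H f x)) (\<lambda>x. enn2real (H g x))"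
proof -
  define h where "h x = enn2real (H f x)" for x
  define k where "k x = enn2real (H g x)" for x
  have Hf: "H f x = ennreal (h x)" and Hg: "H g x = ennreal (k x)" if "x \<in> D" for x
    using fin[OF that] by (simp_all add: h_def k_def)
  have h0: "0 \<le> h x" and k0: "0 \<le> k x" for x by (simp_all add: h_def k_def)
  have "\<exists>m\<ge>0. \<forall>z. v n z \<le> ennreal m" for n
  proof -
    obtain m where m: "m < \<infinity>" "\<And>z. v n z \<le> m" using v(1)[of n] by (auto simp: upper_admissible_def)
    then show ?thesis by (intro exI[of _ "enn2real m"]) simp
  qed
  then obtain m where m: "\<And>n. 0 \<le> m n" "\<And>n z. v n z \<le> ennreal (m n)" by metis
  have gap': "H (u n) x \<le> H (v n) x + ennreal ((1 / 2) ^ n * k x)" if "x \<in> D" for n x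
    using gap[OF that, of n] Hg[OF that] k0 by (simp add: ennreal_mult)
  have up: "h x < c + (1 / 2) ^ n * k x" if x: "x \<in> D" and c: "H (v n) x < ennreal c" "0 \<le> c" for n x c
  proof -
    have "H f x \<le> H (u n) x" by (rule H_mono[OF u(2)])
    also have "\<dots> \<le> H (v n) x + ennreal ((1 / 2) ^ n * k x)" by (rule gap'[OF x])
    also have "\<dots> < ennreal c + ennreal ((1 / 2) ^ n * k x)"
      using c(1) by (simp add: add.commute[of _ "ennreal ((1 / 2) ^ n * k x)"] ennreal_add_left_cancel_less)
    also have "\<dots> = ennreal (c + (1 / 2) ^ n * k x)" using c(2) k0 by simp
    finally have "ennreal (h x) < ennreal (c + (1 / 2) ^ n * k x)" unfolding Hf[OF x] .
    then show ?thesis using h0 by (simp add: ennreal_less_iff)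
  qed
  have low: "c < h x + (1 / 2) ^ n * k x" if x: "x \<in> D" and c: "ennreal c < H (u n) x" "0 \<le> c" for n x c
  proof -
    have "ennreal c < H (u n) x" by (rule c)
    also have "\<dots> \<le> H (v n) x + ennreal ((1 / 2) ^ n * k x)" by (rule gap'[OF x])
    also have "\<dots> \<le> H f x + ennreal ((1 / 2) ^ n * k x)" by (intro add_right_mono H_mono v(2))
    also have "\<dots> = ennreal (h x + (1 / 2) ^ n * k x)" unfolding Hf[OF x] using h0 k0 by simp
    finally show ?thesis using c(2) by (simp add: ennreal_less_iff)
  qed
  have bd: "h x \<le> m n + (1 / 2) ^ n * k x" if x: "x \<in> D" for n x
  proof -
    have "H f x \<le> H (u n) x" by (rule H_mono[OF u(2)])
    also have "\<dots> \<le> H (v n) x + ennreal ((1 / 2) ^ n * k x)" by (rule gap'[OF x])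
    also have "\<dots> \<le> ennreal (m n) + ennreal ((1 / 2) ^ n * k x)"
      using H_mono[of "v n" "\<lambda>_. ennreal (m n)" x, OF m(2)] by (intro add_right_mono) (simp add: H_const)
    also have "\<dots> = ennreal (m n + (1 / 2) ^ n * k x)" using m(1) k0 by simp
    finally show ?thesis unfolding Hf[OF x] using m(1)[of n] k0[of x] by (subst (asm) ennreal_le_iff) auto
  qed
  show ?thesis
    unfolding controlled_convergence_def h_def[symmetric] k_def[symmetric]
  proof (intro allI impI ballI)
    fix A y assume A: "A \<subseteq> D" and y: "y \<in> frontier D \<inter> closure A"
    have yD: "y \<notin> D" using y openD by (simp add: frontier_def interior_open)
    \<comment> \<open>As y is outside D it is a limit point of A, so nothing false can hold
      eventually along the filter.\<close>
    then have "A - {y} = A" using A by blast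
    then have "y \<in> closure (A - {y})" using y by simp
    then have nb: "at y within A \<noteq> bot" by (simp add: trivial_limit_within islimpt_in_closure)
    have evA: "\<forall>\<^sub>F x in at y within A. x \<in> D \<and> P x" if "\<forall>\<^sub>F x in at y within D. P x" for P
      using that unfolding eventually_at_filter by (rule eventually_mono) (use A in auto)
    have evD: "\<forall>\<^sub>F x in at y within A. x \<in> D"
      using A unfolding eventually_at_filter by (intro always_eventually) auto
    have small: "\<exists>n. (1 / 2) ^ n * B < e" if eB: "0 < e" "0 < B" for e B :: real
    proof -
      obtain n where "(1 / 2 :: real) ^ n < e / B"
        using real_arch_pow_inv[of "e / B" "1 / 2"] eB by auto
      then show ?thesis using eB by (auto simp: field_simps intro!: exI[of _ n])
    qed
    have yF: "y \<in> frontier D" using y by simp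
    show "(Limsup (at y within A) (\<lambda>x. ereal (k x)) < \<infinity> \<longrightarrow>
         \<bar>enn2ereal (f y)\<bar> \<noteq> \<infinity> \<and> (h \<longlongrightarrow> real_of_ereal (enn2ereal (f y))) (at y within A)) \<and>
        (filterlim k at_top (at y within A) \<longrightarrow> ((\<lambda>x. h x / (1 + k x)) \<longlongrightarrow> 0) (at y within A))"
    proof (intro conjI[of "_ \<longrightarrow> _"] impI)
      assume ls: "Limsup (at y within A) (\<lambda>x. ereal (k x)) < \<infinity>"
      then obtain B0 :: nat where "Limsup (at y within A) (\<lambda>x. ereal (k x)) < ereal (real B0)"
        using less_PInf_Ex_of_nat by auto
      then have kB0: "\<forall>\<^sub>F x in at y within A. ereal (k x) < ereal (real B0)" by (rule Limsup_lessD)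
      define B where "B = real B0 + 1"
      have B: "0 < B" by (simp add: B_def)
      have kB: "\<forall>\<^sub>F x in at y within A. k x < B"
        using kB0 by eventually_elim (simp add: B_def)
      have kn: "(1 / 2) ^ n * k x \<le> (1 / 2) ^ n * B" if "k x < B" for n x
        using that by (intro mult_left_mono) auto
      have "f y \<noteq> top"
      proof
        assume "f y = top"
        then have "u 0 y = top" using u(2)[where n = 0 and z = y] by (simp add: top_unique)
        \<comment> \<open>At n = 0 the bound h <= m 0 + k allows \<open>H (u 0)\<close> at most m 0
          + 2 k, which stays below m 0 + 2 B.\<close>
        then have "\<forall>\<^sub>F x in at y within D. ennreal (m 0 + 2 * B) < H (u 0) x"
          using u(1)[of 0] yF by (auto simp: lower_admissible_def)
        from evA[OF this] kB have "\<forall>\<^sub>F x in at y within A. False"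
        proof eventually_elim
          case (elim x)
          then have "m 0 + 2 * B < h x + (1 / 2) ^ 0 * k x" using m(1)[of 0] B by (intro low) auto
          then show ?case using bd[of x 0] elim by simp
        qed
        then show False using nb by simp
      qed
      then obtain a where a: "f y = ennreal a" "0 \<le> a" by (cases "f y") auto
      have "(h \<longlongrightarrow> a) (at y within A)"
      proof (rule order_tendstoI)
        fix c assume c: "a < c"
        \<comment> \<open>The error 2^-n B takes less than half of the distance from a to c; the
          other half separates \<open>v n y\<close> from the threshold (a + c) / 2.\<close>
        obtain n where n: "(1 / 2) ^ n * B < (c - a) / 2" using small[of "(c - a) / 2" B] c B by auto
        have "v n y \<le> ennreal a" using v(2)[of n y] a by simp
        also have "ennreal a < ennreal ((a + c) / 2)" using c a by (simp add: ennreal_less_iff)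
        finally have "\<forall>\<^sub>F x in at y within D. H (v n) x < ennreal ((a + c) / 2)"
          using v(1)[of n] yF by (auto simp: upper_admissible_def)
        from evA[OF this] kB show "\<forall>\<^sub>F x in at y within A. h x < c"
        proof eventually_elim
          case (elim x)
          then have "h x < (a + c) / 2 + (1 / 2) ^ n * k x" using a c by (intro up) auto
          then show ?case using kn[OF elim(2), of n] n by argo
        qed
      next
        fix c assume c: "c < a"
        show "\<forall>\<^sub>F x in at y within A. c < h x"
        proof (cases "c < 0")
          \<comment> \<open>\<open>ennreal\<close> maps negative numbers to 0, so negative
            thresholds are handled by nonnegativity of h instead.\<close>
          case True
          then show ?thesis by (intro always_eventually allI) (rule less_le_trans[OF _ h0])
        next
          case False
          obtain n where n: "(1 / 2) ^ n * B < (a - c) / 2" using small[of "(a - c) / 2" B] c B by auto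
          have "ennreal ((a + c) / 2) < ennreal a" using c False by (simp add: ennreal_less_iff)
          also have "ennreal a \<le> u n y" using u(2)[where n = n and z = y] a by simp
          finally have "\<forall>\<^sub>F x in at y within D. ennreal ((a + c) / 2) < H (u n) x"
            using u(1)[of n] yF by (auto simp: lower_admissible_def)
          from evA[OF this] kB show ?thesis
          proof eventually_elim
            case (elim x)
            then have "(a + c) / 2 < h x + (1 / 2) ^ n * k x" using a c False by (intro low) auto
            then show ?case using kn[OF elim(2), of n] n by argo
          qed
        qed
      qed
      then show "\<bar>enn2ereal (f y)\<bar> \<noteq> \<infinity> \<and> (h \<longlongrightarrow> real_of_ereal (enn2ereal (f y))) (at y within A)"
        using a by simp
    next
      assume ki: "filterlim k at_top (at y within A)"
      show "((\<lambda>x. h x / (1 + k x)) \<longlongrightarrow> 0) (at y within A)"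
      proof (rule order_tendstoI)
        fix c :: real assume "c < 0"
        then show "\<forall>\<^sub>F x in at y within A. c < h x / (1 + k x)"
          using h0 k0 by (intro always_eventually allI) (auto intro: less_le_trans divide_nonneg_nonneg)
      next
        fix c :: real assume c: "0 < c"
        \<comment> \<open>This makes the part of the bound proportional to k less than c / 2 times
          k; once k is at least 2 * m n / c, the constant \<open>m n\<close> fits into the other
          half.\<close>
        obtain n where n: "(1 / 2) ^ n * 1 < c / 2" using small[of "c / 2" 1] c by auto
        have "\<forall>\<^sub>F x in at y within A. 2 * m n / c \<le> k x"
          using ki by (auto simp: filterlim_at_top)
        with evD show "\<forall>\<^sub>F x in at y within A. h x / (1 + k x) < c"
        proof eventually_elim
          case (elim x)
          have "h x \<le> m n + (1 / 2) ^ n * k x" by (rule bd[OF elim(1)])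
          also have "\<dots> \<le> c / 2 * k x + c / 2 * k x"
            using elim(2) n k0[of x] c by (intro add_mono mult_right_mono) (auto simp: field_simps)
          also have "\<dots> < c * (1 + k x)" using c by (simp add: algebra_simps)
          finally show ?case using k0[of x] by (simp add: pos_divide_less_eq add_pos_nonneg)
        qed
      qed
    qed
  qed
qed

text \<open>Weighted by 2^n, gaps of at most 4^-n at x0 still form a convergent series, and
  \<open>H_finite\<close> carries its finiteness from x0 to D. Conversely each single term bounds
  the n-th gap by 2^-n times \<open>H g\<close>, now at every point of D.\<close>

lemma controlling_function_exists:
  assumes f: "f \<in> borel_measurable borel" and x0: "x0 \<in> D" "H f x0 < \<infinity>"
  obtains g where "g \<in> borel_measurable borel" "\<And>x. x \<in> D \<Longrightarrow> H g x < \<infinity>"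
    "controlled_convergence D (\<lambda>y. enn2ereal (f y)) (\<lambda>x. enn2real (H f x)) (\<lambda>x. enn2real (H g x))"
proof -
  have "\<forall>n. \<exists>u v. lower_admissible u \<and> upper_admissible v \<and> (\<forall>z. v z \<le> f z) \<and> (\<forall>z. f z \<le> u z) \<and>
    H u x0 \<le> H v x0 + ennreal ((1 / 4) ^ n)"
    by (intro allI admissible_approx[OF f x0(2)]) simp
  then obtain u v where uv: "\<And>n. lower_admissible (u n)" "\<And>n. upper_admissible (v n)"
    "\<And>n z. v n z \<le> f z" "\<And>n z. f z \<le> u n z" "\<And>n::nat. H (u n) x0 \<le> H (v n) x0 + ennreal ((1 / 4) ^ n)"
    by metis
  have m: "u n \<in> borel_measurable borel" "v n \<in> borel_measurable borel" for n
    using uv(1)[of n] uv(2)[of n] by (auto simp: lower_admissible_def upper_admissible_def)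
  have vu: "v n z \<le> u n z" for n z by (rule order_trans[OF uv(3,4)])
  have dm: "(\<lambda>z. u n z - v n z) \<in> borel_measurable borel" for n using m by simp
  define g where "g z = (\<Sum>n. ennreal (2 ^ n) * (u n z - v n z))" for z
  have gm: "g \<in> borel_measurable borel" unfolding g_def using dm by measurable
  have Hg: "H g x = (\<Sum>n. ennreal (2 ^ n) * H (\<lambda>z. u n z - v n z) x)" for x
  proof -
    have "H g x = (\<Sum>n. H (\<lambda>z. ennreal (2 ^ n) * (u n z - v n z)) x)"
      unfolding H_def g_def using dm by (intro nn_integral_suminf) (auto simp: measurable\<mu>)
    then show ?thesis using dm by (simp add: H_cmult)
  qed
  have "H g x0 \<le> (\<Sum>n. ennreal ((1 / 2) ^ n))"
    unfolding Hg
  proof (intro suminf_le allI)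
    fix n
    have "H (v n) x0 < \<infinity>" by (rule le_less_trans[OF H_mono[OF uv(3)] x0(2)])
    then have "H (\<lambda>z. u n z - v n z) x0 \<le> ennreal ((1 / 4) ^ n)"
      by (intro H_diff_le m vu uv(5))
    then have "ennreal (2 ^ n) * H (\<lambda>z. u n z - v n z) x0 \<le> ennreal (2 ^ n) * ennreal ((1 / 4) ^ n)"
      by (rule mult_left_mono) simp
    also have "\<dots> = ennreal ((1 / 2) ^ n)"
      by (simp add: ennreal_mult[symmetric] power_mult_distrib[symmetric])
    finally show "ennreal (2 ^ n) * H (\<lambda>z. u n z - v n z) x0 \<le> ennreal ((1 / 2) ^ n)" .
  qed auto
  also have "\<dots> < \<infinity>"
    by (subst suminf_ennreal2) (auto intro!: summable_geometric)
  finally have fin: "H g x < \<infinity>" if "x \<in> D" for x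
    by (rule H_finite[OF gm x0(1) _ that])
  have "controlled_convergence D (\<lambda>y. enn2ereal (f y)) (\<lambda>x. enn2real (H f x)) (\<lambda>x. enn2real (H g x))"
  proof (rule admissible_imp_controlled_convergence[OF f gm H_finite[OF f x0] fin uv(1,4,2,3)])
    fix n x assume x: "x \<in> D"
    let ?d = "H (\<lambda>z. u n z - v n z) x"
    have "ennreal (2 ^ n) * ?d \<le> H g x"
      unfolding Hg by (rule ennreal_le_suminf)
    then have "ennreal ((1 / 2) ^ n) * (ennreal (2 ^ n) * ?d) \<le> ennreal ((1 / 2) ^ n) * H g x"
      by (rule mult_left_mono) simp
    then have d: "?d \<le> ennreal ((1 / 2) ^ n) * H g x"
      by (simp add: mult.assoc[symmetric] ennreal_mult[symmetric] power_mult_distrib[symmetric])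
    have "H (u n) x = H (\<lambda>z. v n z + (u n z - v n z)) x"
      using vu by (simp add: add_diff_inverse_ennreal)
    also have "\<dots> = H (v n) x + ?d" using m by (intro H_add) auto
    finally show "H (u n) x \<le> H (v n) x + ennreal ((1 / 2) ^ n) * H g x"
      using d by (simp add: add_left_mono)
  qed
  then show thesis using that gm fin by blast
qed

end

section \<open>Transfer to Brownian motion\<close>

lemma harmonic_on_cong:
  assumes D: "open D" and eq: "\<And>x. x \<in> D \<Longrightarrow> u x = U x" and U: "harmonic_on D U"
  shows "harmonic_on D u"
proof -
  have C2: "C2_on D U" and lap: "\<And>x. x \<in> D \<Longrightarrow> laplacian U x = 0"
    using U by (auto simp: harmonic_on_iff)
  have p1: "partial b u x = partial b U x" if "x \<in> D" for b x
    unfolding partial_def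
    using frechet_derivative_transform_within_open[of U x D u] C2 D that eq
    by (auto simp: C2_on_def)
  have p2: "partial b (partial b u) x = partial b (partial b U) x" if "x \<in> D" "b \<in> Basis" for b x
    unfolding partial_def[of b "partial b u"] partial_def[of b "partial b U"]
    using frechet_derivative_transform_within_open[of "partial b U" x D "partial b u"] C2 D that p1
    by (auto simp: C2_on_def)
  have "laplacian u x = 0" if "x \<in> D" for x
    using lap[OF that] p2[OF that] by (simp add: laplacian_def)
  moreover have "C2_on D u"
    by (rule C2_on_local[OF D]) (use D C2 eq in blast)
  ultimately show ?thesis by (simp add: harmonic_on_iff)
qed

text \<open>\<open>HD\<close> and \<open>H\<close> are known to agree on D only, and f agrees with
  its Borel extension on the frontier only.\<close>

lemma controlled_convergence_cong:
  assumes "\<And>y. y \<in> frontier D \<Longrightarrow> f y = f' y" "\<And>x. x \<in> D \<Longrightarrow> h x = h' x" "\<And>x. x \<in> D \<Longrightarrow> k x = k' x"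
    and cc: "controlled_convergence D f' h' k'"
  shows "controlled_convergence D f h k"
  unfolding controlled_convergence_def
proof (intro allI impI ballI)
  fix A y assume A: "A \<subseteq> D" and y: "y \<in> frontier D \<inter> closure A"
  have ev: "\<forall>\<^sub>F x in at y within A. h x = h' x \<and> k x = k' x"
    unfolding eventually_at_filter using A assms(2,3) by (intro always_eventually) auto
  have "Limsup (at y within A) (\<lambda>x. ereal (k x)) = Limsup (at y within A) (\<lambda>x. ereal (k' x))"
    by (rule Limsup_eq) (use ev in \<open>auto elim: eventually_mono\<close>)
  moreover have "(h \<longlongrightarrow> l) (at y within A) \<longleftrightarrow> (h' \<longlongrightarrow> l) (at y within A)" for l
    by (rule tendsto_cong) (use ev in \<open>auto elim: eventually_mono\<close>)
  moreover have "filterlim k at_top (at y within A) \<longleftrightarrow> filterlim k' at_top (at y within A)"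
    by (rule filterlim_cong) (use ev in \<open>auto elim: eventually_mono\<close>)
  moreover have "((\<lambda>x. h x / (1 + k x)) \<longlongrightarrow> 0) (at y within A) \<longleftrightarrow> ((\<lambda>x. h' x / (1 + k' x)) \<longlongrightarrow> 0) (at y within A)"
    by (rule tendsto_cong) (use ev in \<open>auto elim: eventually_mono\<close>)
  moreover have "f y = f' y" using assms(1) y by blast
  ultimately show "(Limsup (at y within A) (\<lambda>x. ereal (k x)) < \<infinity> \<longrightarrow>
      \<bar>f y\<bar> \<noteq> \<infinity> \<and> (h \<longlongrightarrow> real_of_ereal (f y)) (at y within A)) \<and>
      (filterlim k at_top (at y within A) \<longrightarrow> ((\<lambda>x. h x / (1 + k x)) \<longlongrightarrow> 0) (at y within A))"
    using cc A y unfolding controlled_convergence_def by simp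
qed

theorem theorem2p5:
  fixes D :: "'a::euclidean_space set"
    and P :: "'a \<Rightarrow> 'w measure" and X :: "real \<Rightarrow> 'w \<Rightarrow> 'a"
    and f :: "'a \<Rightarrow> ennreal"
  assumes BM: "\<forall>x. brownian_motion_from (P x) X x"
    and dom: "open D" "connected D" "D \<noteq> {}" "bounded D"
    and dirichlet: "\<forall>\<phi>::'a \<Rightarrow> real. continuous_on (frontier D) \<phi> \<longrightarrow>
        (\<exists>h. harmonic_on D h \<and> (\<forall>y\<in>frontier D. (h \<longlongrightarrow> \<phi> y) (at y within D)))"
    and f_meas: "f \<in> borel_measurable (restrict_space borel (frontier D))"
    and not_infty: "\<exists>x\<in>D. HD P X D f x \<noteq> \<infinity>"
  shows "(\<forall>x\<in>D. HD P X D f x \<noteq> \<infinity>)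
    \<and> harmonic_on D (\<lambda>x. enn2real (HD P X D f x))
    \<and> (\<exists>g. g \<in> borel_measurable (restrict_space borel (frontier D))
          \<and> (\<forall>x\<in>D. HD P X D g x \<noteq> \<infinity>)
          \<and> superharmonic_on D (\<lambda>x. enn2real (HD P X D g x))
          \<and> controlled_convergence D (\<lambda>y. enn2ereal (f y))
               (\<lambda>x. enn2real (HD P X D f x)) (\<lambda>x. enn2real (HD P X D g x)))
    \<and> (\<forall>h k. harmonic_on D h \<and> superharmonic_on D k \<and> (\<forall>x\<in>D. 0 \<le> k x)
          \<and> controlled_convergence D (\<lambda>y. enn2ereal (f y)) h k
          \<longrightarrow> (\<forall>x\<in>D. h x = enn2real (HD P X D f x)))"
proof -
  \<comment> \<open>Bundles the conclusions of \<open>brownian_exit_position\<close> so that one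
    version can be chosen for all starting points at once.\<close>
  define exit_position where "exit_position x Y \<longleftrightarrow> Y \<in> borel_measurable (P x) \<and>
      (AE \<omega> in P x. X (exit_time D X \<omega>) \<omega> = Y \<omega>) \<and> (\<forall>\<omega>\<in>space (P x). Y \<omega> \<in> frontier D) \<and>
      (\<forall>h \<phi>. harmonic_on D h \<longrightarrow> continuous_on (frontier D) \<phi> \<longrightarrow>
        (\<forall>y\<in>frontier D. (h \<longlongrightarrow> \<phi> y) (at y within D)) \<longrightarrow> (\<integral>\<omega>. \<phi> (Y \<omega>) \<partial>P x) = (h x :: real))" for x Y
  have "\<forall>x\<in>D. \<exists>Y. exit_position x Y"
  proof
    fix x assume x: "x \<in> D"
    show "\<exists>Y. exit_position x Y"
    proof (rule brownian_exit_position[OF BM[rule_format] dom(1,4) x])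
      fix Y assume "Y \<in> borel_measurable (P x)" "AE \<omega> in P x. X (exit_time D X \<omega>) \<omega> = Y \<omega>"
        "\<And>\<omega>. \<omega> \<in> space (P x) \<Longrightarrow> Y \<omega> \<in> frontier D"
        "\<And>h \<phi>. harmonic_on D h \<Longrightarrow> continuous_on (frontier D) \<phi> \<Longrightarrow>
          (\<And>y. y \<in> frontier D \<Longrightarrow> (h \<longlongrightarrow> \<phi> y) (at y within D)) \<Longrightarrow> (\<integral>\<omega>. \<phi> (Y \<omega>) \<partial>P x) = (h x :: real)"
      then have "exit_position x Y" unfolding exit_position_def by simp
      then show ?thesis by (rule exI[of _ Y])
    qed
  qed
  from bchoice[OF this] obtain Y where "\<forall>x\<in>D. exit_position x (Y x)" ..
  then have Y: "Y x \<in> borel_measurable (P x)" "AE \<omega> in P x. X (exit_time D X \<omega>) \<omega> = Y x \<omega>"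
    "\<And>\<omega>. \<omega> \<in> space (P x) \<Longrightarrow> Y x \<omega> \<in> frontier D"
    "\<And>h \<phi>. harmonic_on D h \<Longrightarrow> continuous_on (frontier D) \<phi> \<Longrightarrow>
      \<forall>y\<in>frontier D. (h \<longlongrightarrow> \<phi> y) (at y within D) \<Longrightarrow> (\<integral>\<omega>. \<phi> (Y x \<omega>) \<partial>P x) = (h x :: real)"
    if "x \<in> D" for x
    using that unfolding exit_position_def by simp_all
  define \<mu> where "\<mu> x = (if x \<in> D then distr (P x) borel (Y x) else return borel x)" for x
  interpret harmonic_measures D \<mu>
  proof (rule harmonic_measures.intro)
    show "prob_space (\<mu> x)" for x
      using BM[rule_format, of x] Y(1)[of x]
      by (auto simp: \<mu>_def brownian_motion_from_def prob_space_return intro: prob_space.prob_space_distr)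
    fix \<phi> :: "'a \<Rightarrow> real" assume \<phi>: "continuous_on UNIV \<phi>"
    then have \<phi>F: "continuous_on (frontier D) \<phi>" by (rule continuous_on_subset) simp
    then obtain h where h: "harmonic_on D h" "\<forall>y\<in>frontier D. (h \<longlongrightarrow> \<phi> y) (at y within D)"
      using dirichlet by blast
    have "(\<integral>z. \<phi> z \<partial>\<mu> x) = h x" if x: "x \<in> D" for x
      using Y(4)[OF x h(1) \<phi>F h(2)] x borel_measurable_continuous_onI[OF \<phi>]
      by (simp add: \<mu>_def integral_distr[OF Y(1)[OF x]])
    then show "\<exists>h. harmonic_on D h \<and> (\<forall>y\<in>frontier D. (h \<longlongrightarrow> \<phi> y) (at y within D)) \<and>
      (\<forall>x\<in>D. (\<integral>z. \<phi> z \<partial>\<mu> x) = h x)" using h by blast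
  qed (use dom in \<open>auto simp: \<mu>_def\<close>)
  \<comment> \<open>The exit position lies on the frontier almost surely, so only the values of q
    there matter and q itself need not be Borel on the whole space.\<close>
  have HD_eq: "HD P X D q x = H q' x"
    if x: "x \<in> D" and q: "q' \<in> borel_measurable borel" "\<And>y. y \<in> frontier D \<Longrightarrow> q y = q' y" for q q' x
  proof -
    have "HD P X D q x = (\<integral>\<^sup>+\<omega>. q' (Y x \<omega>) \<partial>P x)"
      unfolding HD_def
    proof (rule nn_integral_cong_AE)
      show "AE \<omega> in P x. q (X (exit_time D X \<omega>) \<omega>) = q' (Y x \<omega>)"
        using Y(2)[OF x] AE_space by eventually_elim (use q(2) Y(3)[OF x] in simp)
    qed
    also have "\<dots> = H q' x"
      using x q(1) by (simp add: H_def \<mu>_def nn_integral_distr[OF Y(1)[OF x]])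
    finally show ?thesis .
  qed
  \<comment> \<open>f is measurable on the frontier only; extending it by 0 makes it Borel without
    changing its values there.\<close>
  define f0 where "f0 z = f z * indicator (frontier D) z" for z
  have f0m: "f0 \<in> borel_measurable borel"
    using f_meas unfolding f0_def[abs_def]
    by (subst (asm) borel_measurable_restrict_space_iff_ennreal) (auto intro: borel_closed)
  have HDf: "HD P X D f x = H f0 x" if "x \<in> D" for x
    by (rule HD_eq[OF that f0m]) (simp add: f0_def)
  obtain x0 where x0: "x0 \<in> D" "H f0 x0 < \<infinity>"
    using not_infty HDf by (auto simp: less_top)
  note fin = H_finite[OF f0m x0]
  obtain g where g: "g \<in> borel_measurable borel" "\<And>x. x \<in> D \<Longrightarrow> H g x < \<infinity>"
    "controlled_convergence D (\<lambda>y. enn2ereal (f0 y)) (\<lambda>x. enn2real (H f0 x)) (\<lambda>x. enn2real (H g x))"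
    using controlling_function_exists[OF f0m x0] by blast
  have HDg: "HD P X D g x = H g x" if "x \<in> D" for x
    by (rule HD_eq[OF that g(1)]) simp
  have harm_f: "harmonic_on D (\<lambda>x. enn2real (HD P X D f x))"
    by (rule harmonic_on_cong[OF dom(1) _ H_harmonic[OF f0m fin]]) (simp add: HDf)
  have harm_g: "harmonic_on D (\<lambda>x. enn2real (HD P X D g x))"
    by (rule harmonic_on_cong[OF dom(1) _ H_harmonic[OF g(1,2)]]) (simp add: HDg)
  have sup_g: "superharmonic_on D (\<lambda>x. enn2real (HD P X D g x))"
    by (rule harmonic_imp_superharmonic(1)[OF dom(1) harm_g])
  have cc: "controlled_convergence D (\<lambda>y. enn2ereal (f y))
      (\<lambda>x. enn2real (HD P X D f x)) (\<lambda>x. enn2real (HD P X D g x))"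
    by (rule controlled_convergence_cong[OF _ _ _ g(3)]) (simp_all add: f0_def HDf HDg)
  \<comment> \<open>Two comparisons with exchanged roles; the control found for
    \<open>HD P X D f\<close> is harmonic and therefore superharmonic, as the comparison
    requires.\<close>
  have uniq: "h x = enn2real (HD P X D f x)"
    if "harmonic_on D h" "superharmonic_on D k" "\<forall>x\<in>D. 0 \<le> k x"
      "controlled_convergence D (\<lambda>y. enn2ereal (f y)) h k" "x \<in> D" for h k x
  proof (rule antisym)
    show "h x \<le> enn2real (HD P X D f x)"
      by (rule controlled_convergence_comparison[OF dom(1,4) harm_f that(1) sup_g that(2) _ _ cc that(4,5)])
        (use that(3) in auto)
    show "enn2real (HD P X D f x) \<le> h x"
      by (rule controlled_convergence_comparison[OF dom(1,4) that(1) harm_f that(2) sup_g _ _ that(4) cc that(5)])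
        (use that(3) in auto)
  qed
  show ?thesis
  proof (intro conjI exI[of _ g] allI impI ballI)
    show "g \<in> borel_measurable (restrict_space borel (frontier D))"
      by (rule measurable_restrict_space1[OF g(1)])
    show "HD P X D f x \<noteq> \<infinity>" "HD P X D g x \<noteq> \<infinity>" if "x \<in> D" for x
      using fin[OF that] g(2)[OF that] HDf[OF that] HDg[OF that] by auto
    show "h x = enn2real (HD P X D f x)"
      if "harmonic_on D h \<and> superharmonic_on D k \<and> (\<forall>x\<in>D. 0 \<le> k x) \<and>
        controlled_convergence D (\<lambda>y. enn2ereal (f y)) h k" "x \<in> D" for h k x
      using that by (intro uniq[of h k]) auto
  qed (rule harm_f sup_g cc)+
qed

end
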